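(* Let $f(\cdot,\xi)$ and $\omega$ satisfy: (i) the samples $\xi^k$ are drawn i.i.d. from $\Xi$; (ii) $\omega$ is $L_\omega$-Lipschitz continuous over its domain; (iii) $\omega$ is $\kappa$-weakly convex; (iv) $f(\cdot,\xi)$ is $\lambda$-weakly convex for all $\xi\sim\Xi$, $\operatorname{dom}\omega\subseteq\operatorname{int}(\operatorname{dom} f)$, and $\mathbb{E}_\xi[\|g\|^2]\le L_f^2$ for $g\in\partial f(x,\xi)$ and all $x\in\operatorname{dom}\omega$; (v) the delays $\tau_k$ arise in a distributed environment with $m$ workers. Let $\rho>2\lambda+\kappa$, $r>0$, and let either $\beta>0$ and $K>r^{1/\beta}$, or $\beta=0$ and $r<1$. Run the safeguarded DSGD with threshold $T=r^{-1}mK^\beta$ and $$\gamma_k\equiv\gamma=\frac{\sqrt{K}}{\alpha\sqrt{\eta}}+\rho+\kappa+4\lambda,\qquad \eta=1+\frac{r}{K^\beta-r},$$ for some $\alpha>0$, and let $k^*$ be chosen uniformly at random among the iterations $k\in\{1,\dots,K\}$ with $\tau_k\le T$. Then $$\mathbb{E}\big[\|\nabla\psi_{1/\rho}(x^{k^*})\|^2\big]\le\frac{2\rho}{\rho-2\lambda-\kappa}\left[\frac{\eta(\rho+2\lambda)D}{K}+\frac{\sqrt{\eta}\,D}{\sqrt{K}\,\alpha}+\frac{4\eta^{3/2}\rho L_f(L_f+L_\omega)m\alpha}{\sqrt{K}}+\frac{8\eta^2\rho\lambda(L_f+L_\omega)^2m^2\alpha^2}{rK^{1-\beta}}\right],$$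 where $D=\psi_{1/\rho}(x^1)-\inf_x\psi(x)$.
   Context: Problem: $\min_{x\in\mathbb{R}^n}\psi(x):=f(x)+\omega(x)$ with $f(x):=\mathbb{E}_{\xi\sim\Xi}[f(x,\xi)]$, where $f(\cdot,\xi)$ is continuous and $\omega$ is lower semicontinuous. A function $g$ is $\kappa$-weakly convex if $g+\frac{\kappa}{2}\|\cdot\|^2$ is convex ($\kappa\ge0$). The subdifferential is $\partial f(x)=\{v: f(y)\ge f(x)+\langle v,y-x\rangle+o(\|x-y\|),\ y\to x\}$. Moreau envelope (for $\rho$ larger than the weak convexity constant of $\psi$): $\psi_{1/\rho}(x)=\min_y\{\psi(y)+\frac{\rho}{2}\|x-y\|^2\}$, $\operatorname{prox}_{\psi/\rho}(x)=\arg\min_y\{\psi(y)+\frac{\rho}{2}\|x-y\|^2\}$; $\nabla\psi_{1/\rho}(x)=\rho(x-\operatorname{prox}_{\psi/\rho}(x))$. Safeguarded DSGD: given $x^1\in\operatorname{dom}\omega$, for $k=1,\dots,K$: if $\tau_k\le T$, take $g^{k-\tau_k}\in\partial f(x^{k-\tau_k},\xi^{k-\tau_k})$ and set $x^{k+1}=\arg\min_{x}\{\langle g^{k-\tau_k},x-x^k\rangle+\omega(x)+\frac{\gamma_k}{2}\|x-x^k\|^2\}$; otherwise set $x^{k+1}=x^k$. Delays in an environment with $m$ workers: each worker carries a delay counter, initially $0$. At iteration $k$ the master uses the information sent by one worker; $\tau_k$ is the current value of that worker's counter. After iteration $k$ this worker's counter is reset to $0$ and the counters of the other $m-1$ workers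 each increase by $1$. The delay sequence is regarded as pre-defined, independent of the data sampling and of the algorithm; the expectation is over the samples and $k^*$ with the delay sequence given. Convention: $x^{k-j}=x^1$ if $j\ge k$. The sample $\xi^{k-\tau_k}$ used at iteration $k$ is a draw from $\Xi$ independent of $x^1,\dots,x^k$. *)

theory Defs
  imports "HOL-Probability.Probability" "HOL-Library.Landau_Symbols"
begin

text \<open>
  Extended-real-valued functions model objectives with an effective domain: the domain is the set
  where the function is finite.  For the functions that are never \<open>-\<infinity>\<close> this is the usual
  \<open>{x. h x < \<infinity>}\<close>; for a function given by an expectation it is the set where the expectation
  exists and is finite.
\<close>

definition edom :: "('a \<Rightarrow> ereal) \<Rightarrow> 'a set"
  where "edom h = {x. \<bar>h x\<bar> \<noteq> \<infinity>}"

text \<open>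
  An extended-real-valued function without the value \<open>-\<infinity>\<close> is convex iff its effective domain is
  convex and it is convex there (\<^const>\<open>convex_on\<close> includes convexity of the set).
\<close>

definition weakly_convex :: "real \<Rightarrow> ('a::euclidean_space \<Rightarrow> ereal) \<Rightarrow> bool"
  where "weakly_convex c h \<longleftrightarrow>
    (\<forall>x. h x \<noteq> -\<infinity>) \<and>
    convex_on (edom h) (\<lambda>x. real_of_ereal (h x) + c / 2 * (norm x)\<^sup>2)"

definition lower_semicontinuous :: "('a::euclidean_space \<Rightarrow> ereal) \<Rightarrow> bool"
  where "lower_semicontinuous h \<longleftrightarrow> (\<forall>x. h x \<le> Liminf (at x) h)"

definition subdifferential :: "('a::euclidean_space \<Rightarrow> ereal) \<Rightarrow> 'a \<Rightarrow> 'a set"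
  where "subdifferential h x =
    {v. x \<in> edom h \<and>
        (\<exists>R. R \<in> o[at x](\<lambda>y. norm (x - y)) \<and>
             (\<forall>\<^sub>F y in at x. h y \<ge> h x + ereal (v \<bullet> (y - x) + R y)))}"

text \<open>
  Expectation of an extended-real-valued random variable, by positive and negative part.  It is
  \<open>\<infinity>\<close> as soon as the positive part has infinite expectation.
\<close>

definition expectation_ereal :: "'s measure \<Rightarrow> ('s \<Rightarrow> ereal) \<Rightarrow> ereal"
  where "expectation_ereal N h =
    enn2ereal (\<integral>\<^sup>+s. e2ennreal (h s) \<partial>N) - enn2ereal (\<integral>\<^sup>+s. e2ennreal (- h s) \<partial>N)"

text \<open>\<open>moreau_envelope h \<rho>\<close> is the envelope usually written with index \<open>1/\<rho>\<close>.\<close>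

definition moreau_envelope :: "('a::euclidean_space \<Rightarrow> ereal) \<Rightarrow> real \<Rightarrow> 'a \<Rightarrow> ereal"
  where "moreau_envelope h \<rho> x = (INF y. h y + ereal (\<rho> / 2 * (norm (x - y))\<^sup>2))"

definition gradient :: "('a::euclidean_space \<Rightarrow> real) \<Rightarrow> 'a \<Rightarrow> 'a"
  where "gradient h x = (THE D. GDERIV h x :> D)"

text \<open>
  \<open>sched k\<close> is the worker whose information is used at iteration \<open>k \<ge> 1\<close>;
  \<open>delay_counter sched k j\<close> is the counter of worker \<open>j\<close> after iteration \<open>k\<close>
  (\<open>k = 0\<close>: initially).
\<close>

primrec delay_counter :: "(nat \<Rightarrow> nat) \<Rightarrow> nat \<Rightarrow> nat \<Rightarrow> nat" where
  "delay_counter sched 0 j = 0"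
| "delay_counter sched (Suc k) j = (if sched (Suc k) = j then 0 else delay_counter sched k j + 1)"

definition delay :: "(nat \<Rightarrow> nat) \<Rightarrow> nat \<Rightarrow> nat"
  where "delay sched k = delay_counter sched (k - 1) (sched k)"

text \<open>
  Independence of two random variables whose ranges may have different types
  (\<^const>\<open>prob_space.indep_var\<close> needs equal types).
\<close>

definition independent_rvs ::
  "'w measure \<Rightarrow> 'b measure \<Rightarrow> ('w \<Rightarrow> 'b) \<Rightarrow> 'c measure \<Rightarrow> ('w \<Rightarrow> 'c) \<Rightarrow> bool"
  where "independent_rvs M A X B Y \<longleftrightarrow>
    X \<in> measurable M A \<and> Y \<in> measurable M B \<and>
    prob_space.indep_set M (sets (vimage_algebra (space M) X A)) (sets (vimage_algebra (space M) Y B))"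

text \<open>
  A run of the safeguarded delayed stochastic (sub)gradient method on the probability space \<open>M\<close>.
  Samples and subgradients are indexed by the iteration that uses them: \<open>\<xi> k\<close> and \<open>g k\<close> stand for
  the sample and the subgradient with index \<open>k - \<tau> k\<close> in the algorithm.  This keeps apart the
  samples of different workers that all evaluate at the common starting point.  Truncated
  subtraction makes \<open>max 1 (k - \<tau> k)\<close> the convention that iterates with nonpositive index are the
  first iterate.  The subgradients are arbitrary random choices from the subdifferential.
\<close>

definition safeguarded_dsgd ::
  "'w measure \<Rightarrow> ('a::euclidean_space \<Rightarrow> 's \<Rightarrow> ereal) \<Rightarrow> ('a \<Rightarrow> ereal) \<Rightarrow> nat \<Rightarrow> (nat \<Rightarrow> nat) \<Rightarrow> real \<Rightarrow>
   (nat \<Rightarrow> real) \<Rightarrow> 'a \<Rightarrow> (nat \<Rightarrow> 'w \<Rightarrow> 's) \<Rightarrow> (nat \<Rightarrow> 'w \<Rightarrow> 'a) \<Rightarrow> (nat \<Rightarrow> 'w \<Rightarrow> 'a) \<Rightarrow> bool"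
  where "safeguarded_dsgd M f \<omega> K \<tau> T \<gamma> x1 \<xi> g x \<longleftrightarrow>
    (\<forall>w\<in>space M. x 1 w = x1) \<and>
    (\<forall>k\<in>{1..K}.
       if real (\<tau> k) \<le> T then
         g k \<in> borel_measurable M \<and>
         (AE w in M. g k w \<in> subdifferential (\<lambda>y. f y (\<xi> k w)) (x (max 1 (k - \<tau> k)) w)) \<and>
         (\<forall>w\<in>space M.
            is_arg_min
              (\<lambda>y. ereal (g k w \<bullet> (y - x k w)) + \<omega> y + ereal (\<gamma> k / 2 * (norm (y - x k w))\<^sup>2))
              (\<lambda>_. True) (x (k + 1) w))
       else (\<forall>w\<in>space M. x (k + 1) w = x k w))"

end

theory Submission
  imports Defs
begin

text \<open>
  The Moreau envelope \<open>\<psi>\<^sub>1\<^sub>/\<^sub>\<rho>\<close> serves as a potential.  Write \<open>x\<close> for an iterate, \<open>x\<^sup>+\<close> for the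
  next one, \<open>x'\<close> for the delayed iterate at which the subgradient \<open>g\<close> was taken and \<open>y\<close> for the
  proximal point of \<open>x\<close>.  Then \<open>\<psi>\<^sub>1\<^sub>/\<^sub>\<rho>(x\<^sup>+) \<le> \<psi>(y) + \<rho>/2 * norm (x\<^sup>+ - y)\<^sup>2\<close>, so the
  potential decreases as soon as the step moves the iterate towards \<open>y\<close>.  That it does so follows
  from two strong convexity inequalities, one for the subproblem that defines \<open>x\<^sup>+\<close>, tested at
  \<open>y\<close>, and one for the proximal problem that defines \<open>y\<close>, tested at \<open>x\<^sup>+\<close>.  The subgradient
  inequality at \<open>x'\<close> links them.  What remains are products of \<open>norm g\<close> and the Lipschitz
  constant \<open>L\<^sub>f\<close> of \<open>F\<close> with the displacements \<open>norm (x\<^sup>+ - x)\<close> and \<open>\<Delta> = norm (x - x')\<close>, a multiple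
  of \<open>\<Delta>\<^sup>2\<close>, and a sampling error.  This is lemma \<open>descent\<close>, an inequality that holds for almost
  every outcome.

  On average the sampling error vanishes, because \<open>y\<close> and \<open>x'\<close> are functions of the past and the
  sample is independent of the past (\<open>\<delta>_mean_zero\<close>).  One step has length at most
  \<open>(norm g + L\<^sub>\<omega>) / c\<close> with \<open>c\<close> of order \<open>sqrt K\<close>, and \<open>\<Delta>\<close> is at most a sum of \<open>\<tau>\<close> steps;
  so \<open>\<Delta>\<close> is of order \<open>\<tau> / c\<close>.  Summation over the iterations that are not skipped telescopes
  (\<open>summed_descent\<close>) and leaves the sums of \<open>\<tau>\<close> and of \<open>\<tau>\<^sup>2\<close>.  Counting the increments of the
  workers' counters gives \<open>m * K\<close> as a bound for the total delay (\<open>sum_delay_le\<close>).  With the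
  threshold \<open>T\<close> the squares sum to at most \<open>T * m * K\<close>, and at least the fraction \<open>1 / \<eta>\<close> of
  the iterations stays below the threshold (\<open>card_small_delays\<close>).

  A point that needs care is the second moment of the subgradients used by the method.  They are
  arbitrary random choices, whereas the moment bound concerns measurable selections at a fixed
  point.  Both are compared with an envelope \<open>G2(y, s)\<close> of the squared norms of all subgradients of
  \<open>f(\<cdot>, s)\<close> at \<open>y\<close>.  It is jointly measurable, because it is the supremum of the squared norms of
  countably many measurable selections, one for each direction in a dense sequence; the selection
  for a direction attains the directional derivative there.  Such selections come from iterated directional derivatives (\<open>subgrad\<close>).
\<close>

section \<open>Proximal maps of Lipschitz weakly convex functions\<close>

lemma norm_sq_convex_combination:
  fixes a b :: "'a::real_inner"
  shows "(norm ((1 - t) *\<^sub>R a + t *\<^sub>R b))\<^sup>2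
    = (1 - t) * (norm a)\<^sup>2 + t * (norm b)\<^sup>2 - t * (1 - t) * (norm (a - b))\<^sup>2"
  unfolding power2_norm_eq_inner
  by (simp add: inner_add_left inner_add_right inner_diff_left inner_diff_right inner_commute
      algebra_simps power2_eq_square)

lemma complete_square_linear_term:
  fixes v x z :: "'a::real_inner"
  assumes c: "c > 0"
  shows "c / 2 * (norm (x - (1 / c) *\<^sub>R v - z))\<^sup>2
    = c / 2 * (norm (z - x))\<^sup>2 + v \<bullet> (z - x) + (norm v)\<^sup>2 / (2 * c)"
proof -
  have "(norm (x - (1 / c) *\<^sub>R v - z))\<^sup>2
      = (norm (z - x))\<^sup>2 + 2 / c * (v \<bullet> (z - x)) + (norm v)\<^sup>2 / c\<^sup>2"
    unfolding power2_norm_eq_inner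
    by (simp add: inner_diff_left inner_diff_right inner_commute power2_eq_square
        diff_divide_distrib add_divide_distrib algebra_simps)
  then show ?thesis using c by (simp add: field_simps power2_eq_square)
qed

text \<open>The real-valued function \<open>\<phi>\<close> on \<open>C\<close> stands for an extended-real-valued function with
  effective domain \<open>C\<close>.  It is instantiated twice: with the objective, for the Moreau envelope, and
  with the regulariser, for the subproblem of the method.\<close>
locale weakly_convex_lipschitz =
  fixes C :: "'a::euclidean_space set" and \<phi> :: "'a \<Rightarrow> real" and L \<mu> \<rho> :: real
  assumes closed_C: "closed C" and C_nonempty: "C \<noteq> {}"
    and lipschitz: "L-lipschitz_on C \<phi>"
    and weakly_convex_phi: "convex_on C (\<lambda>y. \<phi> y + \<mu> / 2 * (norm y)\<^sup>2)"
    and mu_nonneg: "0 \<le> \<mu>" and mu_less_rho: "\<mu> < \<rho>"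
begin

definition is_prox :: "'a \<Rightarrow> 'a \<Rightarrow> bool"
  where "is_prox x p \<longleftrightarrow>
    p \<in> C \<and> (\<forall>y\<in>C. \<phi> p + \<rho> / 2 * (norm (x - p))\<^sup>2 \<le> \<phi> y + \<rho> / 2 * (norm (x - y))\<^sup>2)"

definition prox :: "'a \<Rightarrow> 'a"
  where "prox x = (SOME p. is_prox x p)"

definition env :: "'a \<Rightarrow> real"
  where "env x = \<phi> (prox x) + \<rho> / 2 * (norm (x - prox x))\<^sup>2"

lemma phi_le: "y \<in> C \<Longrightarrow> z \<in> C \<Longrightarrow> \<phi> y \<le> \<phi> z + L * norm (y - z)"
  using lipschitz_onD[OF lipschitz, of y z] by (simp add: dist_norm dist_real_def)

text \<open>A Lipschitz function decreases at most linearly, so the quadratic penalty makes the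
  sublevel sets bounded.\<close>
lemma is_prox_exists: "\<exists>p. is_prox x p"
proof -
  obtain x0 where x0: "x0 \<in> C" using C_nonempty by blast
  define h where "h y = \<phi> y + \<rho> / 2 * (norm (x - y))\<^sup>2" for y
  have rho: "\<rho> > 0" using mu_nonneg mu_less_rho by linarith
  have L0: "L \<ge> 0" using lipschitz lipschitz_on_nonneg by blast
  \<comment> \<open>The radius is chosen such that outside of it the quadratic beats both the linear decrease of
    \<open>\<phi>\<close> and the value of the penalised function at \<open>x0\<close>.\<close>
  define b where "b = L * norm (x0 - x) + \<rho> / 2 * (norm (x - x0))\<^sup>2"
  define R where "R = max (norm (x0 - x)) (2 * (L + b + 1) / \<rho> + 1)"
  have far: "h y > h x0" if y: "y \<in> C" "norm (x - y) > R" for y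
  proof -
    have n1: "norm (x - y) > 2 * (L + b + 1) / \<rho>" "norm (x - y) > 1"
    proof -
      have b0: "b \<ge> 0" unfolding b_def using L0 rho by auto
      then have "2 * (L + b + 1) / \<rho> \<ge> 0" using L0 rho by auto
      then show "norm (x - y) > 2 * (L + b + 1) / \<rho>" "norm (x - y) > 1"
        using y(2) unfolding R_def by linarith+
    qed
    have b0: "b \<ge> 0" unfolding b_def using L0 rho by auto
    have "norm (x0 - y) \<le> norm (x0 - x) + norm (x - y)"
      using norm_triangle_ineq[of "x0 - x" "x - y"] by simp
    then have "L * norm (x0 - y) \<le> L * norm (x0 - x) + L * norm (x - y)"
      using L0 by (metis distrib_left mult_left_mono)
    then have "\<phi> x0 \<le> \<phi> y + L * norm (x0 - x) + L * norm (x - y)"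
      using phi_le[OF x0 y(1)] by linarith
    moreover have "\<rho> / 2 * (norm (x - y))\<^sup>2 > (L + b) * norm (x - y)"
    proof -
      have "\<rho> / 2 * norm (x - y) > L + b"
        using n1(1) rho by (simp add: field_simps)
      then have "\<rho> / 2 * norm (x - y) * norm (x - y) > (L + b) * norm (x - y)"
        using n1(2) by (intro mult_strict_right_mono) auto
      then show ?thesis by (simp add: power2_eq_square)
    qed
    moreover have "b * norm (x - y) \<ge> b"
      using b0 n1(2) mult_left_mono[of 1 "norm (x - y)" b] by linarith
    ultimately show ?thesis unfolding h_def b_def by (simp add: algebra_simps)
  qed
  have cont: "continuous_on (C \<inter> cball x R) h"
    unfolding h_def
    using lipschitz_on_continuous_on[OF lipschitz]
    by (intro continuous_intros) (auto intro: continuous_on_subset)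
  have "x0 \<in> C \<inter> cball x R"
    using x0 by (auto simp: R_def dist_norm norm_minus_commute)
  moreover have "compact (C \<inter> cball x R)"
    using closed_C by (simp add: closed_Int_compact)
  ultimately obtain p where p: "p \<in> C \<inter> cball x R" "\<forall>y\<in>C \<inter> cball x R. h p \<le> h y"
    using continuous_attains_inf[OF _ _ cont] by blast
  have "h p \<le> h y" if "y \<in> C" for y
  proof (cases "norm (x - y) \<le> R")
    case True
    then show ?thesis using p(2) that by (auto simp: dist_norm)
  next
    case False
    then have "h x0 < h y" using far that by simp
    moreover have "h p \<le> h x0" using p(2) \<open>x0 \<in> C \<inter> cball x R\<close> by blast
    ultimately show ?thesis by simp
  qed
  then show ?thesis using p(1) unfolding is_prox_def h_def by blast
qed

lemma is_prox_prox: "is_prox x (prox x)"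
  unfolding prox_def using is_prox_exists by (rule someI_ex)

lemma prox_in: "prox x \<in> C"
  using is_prox_prox is_prox_def by blast

text \<open>The penalised function is strongly convex with modulus \<open>\<rho> - \<mu>\<close>, so it grows quadratically
  away from its minimiser: compare the minimiser with points of the segment towards \<open>y\<close> and let
  them approach it.\<close>
lemma is_prox_growth:
  assumes p: "is_prox x p" and y: "y \<in> C"
  shows "\<phi> p + \<rho> / 2 * (norm (x - p))\<^sup>2 + (\<rho> - \<mu>) / 2 * (norm (y - p))\<^sup>2
    \<le> \<phi> y + \<rho> / 2 * (norm (x - y))\<^sup>2"
proof -
  define h where "h y = \<phi> y + \<rho> / 2 * (norm (x - y))\<^sup>2" for y
  have pC: "p \<in> C" using p is_prox_def by blast
  have step: "h p + (\<rho> - \<mu>) / 2 * (norm (y - p))\<^sup>2 * (1 - t) \<le> h y" if t: "0 < t" "t < 1" for t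
  proof -
    define z where "z = (1 - t) *\<^sub>R p + t *\<^sub>R y"
    have zC: "z \<in> C" unfolding z_def
      using weakly_convex_phi pC y t
      by (simp add: convex_on_def convex_alt)
    have cv: "\<phi> z + \<mu> / 2 * (norm z)\<^sup>2
        \<le> (1 - t) * (\<phi> p + \<mu> / 2 * (norm p)\<^sup>2) + t * (\<phi> y + \<mu> / 2 * (norm y)\<^sup>2)"
      unfolding z_def using weakly_convex_phi pC y t by (intro convex_onD) auto
    have nz: "(norm z)\<^sup>2 = (1 - t) * (norm p)\<^sup>2 + t * (norm y)\<^sup>2 - t * (1 - t) * (norm (y - p))\<^sup>2"
      unfolding z_def norm_sq_convex_combination by (simp add: norm_minus_commute)
    have nxz: "(norm (x - z))\<^sup>2
        = (1 - t) * (norm (x - p))\<^sup>2 + t * (norm (x - y))\<^sup>2 - t * (1 - t) * (norm (y - p))\<^sup>2"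
    proof -
      have "x - z = (1 - t) *\<^sub>R (x - p) + t *\<^sub>R (x - y)"
        unfolding z_def by (simp add: algebra_simps)
      then show ?thesis using norm_sq_convex_combination[of t "x - p" "x - y"]
        by (simp add: norm_minus_commute)
    qed
    have "h z \<le> (1 - t) * h p + t * h y - (\<rho> - \<mu>) / 2 * (t * (1 - t) * (norm (y - p))\<^sup>2)"
      using cv unfolding h_def nz nxz
      by (simp add: algebra_simps add_divide_distrib diff_divide_distrib)
    moreover have "h p \<le> h z" using p zC unfolding is_prox_def h_def by blast
    ultimately have "t * (h p + (\<rho> - \<mu>) / 2 * (norm (y - p))\<^sup>2 * (1 - t)) \<le> t * h y"
      by (simp add: algebra_simps add_divide_distrib diff_divide_distrib)
    then show ?thesis using t by simp
  qed
  have "((\<lambda>t. h p + (\<rho> - \<mu>) / 2 * (norm (y - p))\<^sup>2 * (1 - t)) \<longlongrightarrow>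
      h p + (\<rho> - \<mu>) / 2 * (norm (y - p))\<^sup>2 * (1 - 0)) (at_right 0)"
    by (intro tendsto_intros)
  moreover have "\<forall>\<^sub>F t in at_right 0. h p + (\<rho> - \<mu>) / 2 * (norm (y - p))\<^sup>2 * (1 - t) \<le> h y"
    unfolding eventually_at_right_field using step by (intro exI[of _ 1]) auto
  ultimately have "h p + (\<rho> - \<mu>) / 2 * (norm (y - p))\<^sup>2 * (1 - 0) \<le> h y"
    by (intro tendsto_upperbound) auto
  then show ?thesis by (simp add: h_def)
qed

lemmas prox_growth = is_prox_growth[OF is_prox_prox]

lemma is_prox_lipschitz:
  assumes "is_prox x p" "is_prox y q"
  shows "(\<rho> - \<mu>) * norm (p - q) \<le> \<rho> * norm (x - y)"
proof -
  have C: "p \<in> C" "q \<in> C" using assms is_prox_def by blast+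
  have "(\<rho> - \<mu>) * (norm (p - q))\<^sup>2
      \<le> \<rho> / 2 * ((norm (x - q))\<^sup>2 - (norm (y - q))\<^sup>2 + (norm (y - p))\<^sup>2 - (norm (x - p))\<^sup>2)"
    using is_prox_growth[OF assms(1) C(2)] is_prox_growth[OF assms(2) C(1)]
    by (simp add: norm_minus_commute[of q p] algebra_simps add_divide_distrib diff_divide_distrib)
  also have "\<dots> = \<rho> * ((p - q) \<bullet> (x - y))"
  proof -
    have "(norm (x - q))\<^sup>2 - (norm (y - q))\<^sup>2 + (norm (y - p))\<^sup>2 - (norm (x - p))\<^sup>2
        = 2 * ((p - q) \<bullet> (x - y))"
      unfolding power2_norm_eq_inner
      by (simp add: inner_diff_left inner_diff_right inner_commute)
    then show ?thesis by simp
  qed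
  also have "\<dots> \<le> \<rho> * (norm (p - q) * norm (x - y))"
    using mu_nonneg mu_less_rho by (intro mult_left_mono norm_cauchy_schwarz) auto
  finally have "norm (p - q) * ((\<rho> - \<mu>) * norm (p - q)) \<le> norm (p - q) * (\<rho> * norm (x - y))"
    by (simp add: power2_eq_square algebra_simps)
  then show ?thesis
    using mu_nonneg mu_less_rho by (cases "p = q") auto
qed

lemma is_prox_unique: "is_prox x p \<Longrightarrow> prox x = p"
  using is_prox_lipschitz[OF is_prox_prox, of x p x] mu_less_rho
  by (simp add: mult_le_0_iff)

lemma prox_lipschitz: "norm (prox x - prox y) \<le> \<rho> / (\<rho> - \<mu>) * norm (x - y)"
  using is_prox_lipschitz[OF is_prox_prox is_prox_prox, of x y] mu_less_rho
  by (simp add: field_simps)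

lemma continuous_on_prox: "continuous_on S prox"
proof -
  have "(\<rho> / (\<rho> - \<mu>))-lipschitz_on S prox"
    using prox_lipschitz mu_nonneg mu_less_rho
    by (intro lipschitz_onI) (auto simp: dist_norm)
  then show ?thesis by (rule lipschitz_on_continuous_on)
qed

lemma env_le: "y \<in> C \<Longrightarrow> env x \<le> \<phi> y + \<rho> / 2 * (norm (x - y))\<^sup>2"
  using is_prox_prox[of x] by (auto simp: env_def is_prox_def)

lemma env_diff_le: "env y - env x \<le> \<rho> / 2 * ((norm (y - prox x))\<^sup>2 - (norm (x - prox x))\<^sup>2)"
  using env_le[OF prox_in, of y x] unfolding env_def by (simp add: algebra_simps)

lemma env_upper: "env y \<le> env x + \<rho> * ((x - prox x) \<bullet> (y - x)) + \<rho> / 2 * (norm (y - x))\<^sup>2"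
proof -
  have "(norm (y - prox x))\<^sup>2 - (norm (x - prox x))\<^sup>2
      = 2 * ((x - prox x) \<bullet> (y - x)) + (norm (y - x))\<^sup>2"
    unfolding power2_norm_eq_inner by (simp add: inner_diff_left inner_diff_right inner_commute)
  with env_diff_le[of y x] show ?thesis by (simp add: algebra_simps)
qed

text \<open>Exchanging the two points in the quadratic upper bound gives a lower bound with the
  gradient candidate at \<open>y\<close> instead of \<open>x\<close>; the Lipschitz bound for the proximal map turns one
  into the other.\<close>
lemma env_gderiv: "GDERIV env x :> \<rho> *\<^sub>R (x - prox x)"
proof -
  define B where "B = \<rho> * (1 + \<rho> / (\<rho> - \<mu>)) + \<rho> / 2"
  have rho: "\<rho> > 0" using mu_nonneg mu_less_rho by linarith
  have B: "\<bar>env y - env x - (\<rho> *\<^sub>R (x - prox x)) \<bullet> (y - x)\<bar> \<le> B * (norm (y - x))\<^sup>2" for y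
  proof (rule abs_leI)
    have "\<rho> * (1 + \<rho> / (\<rho> - \<mu>)) \<ge> 0" using rho mu_less_rho by simp
    then have "\<rho> / 2 * (norm (y - x))\<^sup>2 \<le> B * (norm (y - x))\<^sup>2"
      unfolding B_def by (intro mult_right_mono) auto
    then show "env y - env x - (\<rho> *\<^sub>R (x - prox x)) \<bullet> (y - x) \<le> B * (norm (y - x))\<^sup>2"
      using env_upper[of y x] by simp
    have "(prox y - prox x - (y - x)) \<bullet> (y - x) \<le> norm (prox y - prox x - (y - x)) * norm (y - x)"
      by (rule norm_cauchy_schwarz)
    also have "\<dots> \<le> (\<rho> / (\<rho> - \<mu>) * norm (y - x) + norm (y - x)) * norm (y - x)"
      using prox_lipschitz[of y x] norm_triangle_ineq4[of "prox y - prox x" "y - x"]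
      by (intro mult_right_mono) auto
    finally have "\<rho> * ((prox y - prox x - (y - x)) \<bullet> (y - x))
        \<le> \<rho> * ((1 + \<rho> / (\<rho> - \<mu>)) * (norm (y - x))\<^sup>2)"
      using rho by (intro mult_left_mono) (simp_all add: algebra_simps power2_eq_square)
    moreover have "env x \<le> env y + \<rho> * ((y - prox y) \<bullet> (x - y)) + \<rho> / 2 * (norm (x - y))\<^sup>2"
      by (rule env_upper)
    moreover have "(y - prox y) \<bullet> (x - y)
        = (prox y - prox x - (y - x)) \<bullet> (y - x) - (x - prox x) \<bullet> (y - x)"
      by (simp add: inner_diff_left inner_diff_right inner_commute)
    ultimately show "- (env y - env x - (\<rho> *\<^sub>R (x - prox x)) \<bullet> (y - x)) \<le> B * (norm (y - x))\<^sup>2"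
      unfolding B_def by (simp add: algebra_simps norm_minus_commute)
  qed
  have "((\<lambda>y. norm (env y - env x - (\<rho> *\<^sub>R (x - prox x)) \<bullet> (y - x)) / norm (y - x)) \<longlongrightarrow> 0) (at x)"
  proof (rule tendsto_sandwich[of "\<lambda>_. 0" _ _ "\<lambda>y. B * norm (y - x)"])
    show "\<forall>\<^sub>F y in at x. norm (env y - env x - (\<rho> *\<^sub>R (x - prox x)) \<bullet> (y - x)) / norm (y - x)
        \<le> B * norm (y - x)"
      unfolding eventually_at_filter
    proof (intro always_eventually allI impI)
      fix y assume "y \<noteq> x"
      then have "norm (y - x) > 0" by simp
      then show "norm (env y - env x - (\<rho> *\<^sub>R (x - prox x)) \<bullet> (y - x)) / norm (y - x)
          \<le> B * norm (y - x)"
        using B[of y] by (simp only: real_norm_def pos_divide_le_eq power2_eq_square mult.assoc)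
    qed
    have "((\<lambda>y. B * norm (y - x)) \<longlongrightarrow> B * norm (x - x)) (at x)"
      by (intro tendsto_intros)
    then show "((\<lambda>y. B * norm (y - x)) \<longlongrightarrow> 0) (at x)" by simp
  qed auto
  then show ?thesis
    unfolding gderiv_def has_derivative_iff_norm
    by (intro conjI bounded_linear_inner_left) (simp only: inner_commute)
qed

lemma gradient_env: "gradient env x = \<rho> *\<^sub>R (x - prox x)"
  unfolding gradient_def
proof (rule the_equality)
  show "GDERIV env x :> \<rho> *\<^sub>R (x - prox x)" by (rule env_gderiv)
  fix D assume "GDERIV env x :> D"
  then have "(\<lambda>h. h \<bullet> D) = (\<lambda>h. h \<bullet> (\<rho> *\<^sub>R (x - prox x)))"
    using env_gderiv[of x] unfolding gderiv_def by (rule has_derivative_unique)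
  then have "h \<bullet> D = h \<bullet> (\<rho> *\<^sub>R (x - prox x))" for h by (rule fun_cong)
  then show "D = \<rho> *\<^sub>R (x - prox x)" by (rule vector_eq_ldot[THEN iffD1, OF allI])
qed

lemma continuous_on_env: "continuous_on S env"
  by (intro continuous_at_imp_continuous_on ballI has_derivative_continuous[OF env_gderiv[unfolded gderiv_def]])

lemma moreau_envelope_eq_env:
  assumes h: "\<And>y. h y = (if y \<in> C then ereal (\<phi> y) else \<infinity>)"
  shows "moreau_envelope h \<rho> x = ereal (env x)"
  unfolding moreau_envelope_def
proof (rule INF_eqI)
  show "ereal (env x) \<le> h y + ereal (\<rho> / 2 * (norm (x - y))\<^sup>2)" for y
    using env_le[of y x] by (auto simp: h)
  show "b \<le> ereal (env x)" if "\<And>y. y \<in> UNIV \<Longrightarrow> b \<le> h y + ereal (\<rho> / 2 * (norm (x - y))\<^sup>2)" for b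
    using that[of "prox x"] prox_in[of x] by (simp add: h env_def)
qed

end

section \<open>Measurable selection of subgradients by iterated directional derivatives\<close>

text \<open>The limit is taken along a fixed sequence of step sizes, so that measurability in a parameter
  is inherited from \<open>\<phi>\<close> without any assumption on existence of the limit.\<close>
definition dirderiv :: "('a::real_normed_vector \<Rightarrow> real) \<Rightarrow> 'a \<Rightarrow> 'a \<Rightarrow> real"
  where "dirderiv \<phi> y d = lim (\<lambda>n. (\<phi> (y + (1 / real (Suc n)) *\<^sub>R d) - \<phi> y) / (1 / real (Suc n)))"

lemma inverse_Suc_at_right_0: "filterlim (\<lambda>n. 1 / real (Suc n)) (at_right 0) sequentially"
  unfolding filterlim_at
  using LIMSEQ_inverse_real_of_nat by (auto simp: inverse_eq_divide)

lemma dirderiv_eqI: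
  assumes "((\<lambda>t. (\<phi> (y + t *\<^sub>R d) - \<phi> y) / t) \<longlongrightarrow> L) (at_right 0)"
  shows "dirderiv \<phi> y d = L"
  unfolding dirderiv_def
  using filterlim_compose[OF assms inverse_Suc_at_right_0] by (intro limI)

lemma dirderiv_measurable:
  assumes "(\<lambda>w. p w e) \<in> borel_measurable N"
    and "\<And>t. (\<lambda>w. p w (e + t *\<^sub>R d)) \<in> borel_measurable N"
  shows "(\<lambda>w. dirderiv (p w) e d) \<in> borel_measurable N"
  unfolding dirderiv_def using assms
  by (intro borel_measurable_lim_metric borel_measurable_divide borel_measurable_diff) simp_all

lemma eventually_step_in_interior:
  fixes y :: "'a::real_normed_vector"
  assumes "y \<in> interior S"
  shows "\<forall>\<^sub>F t in at_right 0. y + t *\<^sub>R d \<in> S"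
proof -
  have "((\<lambda>t. y + t *\<^sub>R d) \<longlongrightarrow> y + 0 *\<^sub>R d) (at_right (0::real))"
    by (intro tendsto_intros)
  then have "\<forall>\<^sub>F t in at_right 0. y + t *\<^sub>R d \<in> interior S"
    using assms by (intro topological_tendstoD) auto
  then show ?thesis by eventually_elim (use interior_subset in blast)
qed

lemma convex_difference_quotient_mono:
  fixes y :: "'a::real_vector"
  assumes S: "convex_on S \<phi>" and y: "y \<in> S" "y + t *\<^sub>R d \<in> S" and s: "0 < s" "s \<le> t"
  shows "(\<phi> (y + s *\<^sub>R d) - \<phi> y) / s \<le> (\<phi> (y + t *\<^sub>R d) - \<phi> y) / t"
proof -
  have "\<phi> ((1 - s / t) *\<^sub>R y + (s / t) *\<^sub>R (y + t *\<^sub>R d)) \<le> (1 - s / t) * \<phi> y + (s / t) * \<phi> (y + t *\<^sub>R d)"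
    using S y s by (intro convex_onD) auto
  moreover have "(1 - s / t) *\<^sub>R y + (s / t) *\<^sub>R (y + t *\<^sub>R d) = y + s *\<^sub>R d"
    using s by (simp add: algebra_simps)
  ultimately have "\<phi> (y + s *\<^sub>R d) - \<phi> y \<le> s * ((\<phi> (y + t *\<^sub>R d) - \<phi> y) / t)"
    using s by (simp add: algebra_simps diff_divide_distrib)
  then show ?thesis using s by (simp add: pos_divide_le_eq mult.commute)
qed

lemma convex_difference_quotient_lower:
  fixes y :: "'a::real_vector"
  assumes S: "convex_on S \<phi>" and y: "y + t *\<^sub>R d \<in> S" "y - s *\<^sub>R d \<in> S" and s: "0 < s" "0 < t"
  shows "- (\<phi> (y - s *\<^sub>R d) - \<phi> y) / s \<le> (\<phi> (y + t *\<^sub>R d) - \<phi> y) / t"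
proof -
  define a where "a = s / (s + t)"
  have a: "0 \<le> a" "a \<le> 1" "(s + t) * a = s" "(s + t) * (1 - a) = t"
    unfolding a_def using s by (auto simp: field_simps)
  have "\<phi> ((1 - a) *\<^sub>R (y - s *\<^sub>R d) + a *\<^sub>R (y + t *\<^sub>R d))
      \<le> (1 - a) * \<phi> (y - s *\<^sub>R d) + a * \<phi> (y + t *\<^sub>R d)"
    using S y a by (intro convex_onD) auto
  moreover have "(1 - a) *\<^sub>R (y - s *\<^sub>R d) + a *\<^sub>R (y + t *\<^sub>R d) = y + (a * t - (1 - a) * s) *\<^sub>R d"
    by (simp add: algebra_simps)
  moreover have "a * t - (1 - a) * s = 0" using a(3) by (simp add: algebra_simps)
  ultimately have "\<phi> y \<le> (1 - a) * \<phi> (y - s *\<^sub>R d) + a * \<phi> (y + t *\<^sub>R d)" by simp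
  then have "(s + t) * \<phi> y \<le> (s + t) * ((1 - a) * \<phi> (y - s *\<^sub>R d) + a * \<phi> (y + t *\<^sub>R d))"
    using s by (intro mult_left_mono) auto
  also have "\<dots> = t * \<phi> (y - s *\<^sub>R d) + s * \<phi> (y + t *\<^sub>R d)"
    using a(3,4) by (metis distrib_left mult.assoc)
  finally show ?thesis using s by (simp add: field_simps)
qed

lemma dirderiv_tendsto_convex:
  fixes y :: "'a::real_normed_vector"
  assumes S: "convex_on S \<phi>" and y: "y \<in> interior S"
  shows "((\<lambda>t. (\<phi> (y + t *\<^sub>R d) - \<phi> y) / t) \<longlongrightarrow> dirderiv \<phi> y d) (at_right 0)"
proof -
  define Q where "Q t = (\<phi> (y + t *\<^sub>R d) - \<phi> y) / t" for t
  have yS: "y \<in> S" using y interior_subset by blast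
  obtain b where b: "b > 0" "\<And>t. 0 < t \<Longrightarrow> t < b \<Longrightarrow> y + t *\<^sub>R d \<in> S"
    using eventually_step_in_interior[OF y, of d] unfolding eventually_at_right_field by auto
  obtain b' where b': "b' > 0" "\<And>t. 0 < t \<Longrightarrow> t < b' \<Longrightarrow> y + t *\<^sub>R (- d) \<in> S"
    using eventually_step_in_interior[OF y, of "- d"] unfolding eventually_at_right_field by auto
  define s where "s = b' / 2"
  have s: "s > 0" "y - s *\<^sub>R d \<in> S" using b' by (auto simp: s_def)
  define A where "A = Q ` {0<..<b}"
  have bdd: "bdd_below A"
    unfolding A_def Q_def
    using convex_difference_quotient_lower[OF S b(2) s(2) s(1)]
    by (intro bdd_belowI2[of _ "- (\<phi> (y - s *\<^sub>R d) - \<phi> y) / s"]) auto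
  have ne: "A \<noteq> {}" using b(1) unfolding A_def by auto
  have "(Q \<longlongrightarrow> Inf A) (at_right 0)"
  proof (rule order_tendstoI)
    fix a assume "a < Inf A"
    then have "a < Q t" if "0 < t" "t < b" for t
      using cInf_lower[OF _ bdd, of "Q t"] that by (force simp: A_def)
    then show "\<forall>\<^sub>F t in at_right 0. a < Q t"
      unfolding eventually_at_right_field using b(1) by blast
  next
    fix a assume "Inf A < a"
    then have "\<exists>q\<in>A. q < a" by (rule cInf_lessD[OF ne])
    then obtain u where u: "0 < u" "u < b" "Q u < a"
      unfolding A_def by auto
    have "Q t < a" if "0 < t" "t < u" for t
      using convex_difference_quotient_mono[OF S yS b(2), of u t] u that unfolding Q_def by fastforce
    then show "\<forall>\<^sub>F t in at_right 0. Q t < a"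
      unfolding eventually_at_right_field using u(1) by blast
  qed
  then show ?thesis using dirderiv_eqI unfolding Q_def by metis
qed

definition sublinear :: "('a::real_vector \<Rightarrow> real) \<Rightarrow> bool"
  where "sublinear p \<longleftrightarrow> (\<forall>c x. 0 \<le> c \<longrightarrow> p (c *\<^sub>R x) = c * p x) \<and> (\<forall>x y. p (x + y) \<le> p x + p y)"

lemma sublinear_scale: "sublinear p \<Longrightarrow> 0 \<le> c \<Longrightarrow> p (c *\<^sub>R x) = c * p x"
  and sublinear_add: "sublinear p \<Longrightarrow> p (x + y) \<le> p x + p y"
  by (auto simp: sublinear_def)

lemma sublinear_zero: "sublinear p \<Longrightarrow> p 0 = 0"
  using sublinear_scale[of p 0 0] by simp

lemma sublinear_convex: "sublinear p \<Longrightarrow> convex_on UNIV p"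
  by (intro convex_onI) (auto intro: order_trans[OF sublinear_add] simp: sublinear_scale)

lemma sublinear_dirderiv:
  fixes y :: "'a::real_normed_vector"
  assumes S: "convex_on S \<phi>" and y: "y \<in> interior S"
  shows "sublinear (dirderiv \<phi> y)"
  unfolding sublinear_def
proof (intro conjI allI impI)
  fix c :: real and d :: 'a assume "0 \<le> c"
  then consider "c = 0" | "c > 0" by linarith
  then show "dirderiv \<phi> y (c *\<^sub>R d) = c * dirderiv \<phi> y d"
  proof cases
    case 1
    then show ?thesis by (auto intro!: dirderiv_eqI)
  next
    case 2
    have "filterlim (\<lambda>t. c * t) (at_right 0) (at_right (0::real))"
      unfolding filterlim_at using 2
      by (auto simp: eventually_at_right_field intro!: tendsto_eq_intros exI[of _ 1])
    then have "((\<lambda>t. c * ((\<phi> (y + (c * t) *\<^sub>R d) - \<phi> y) / (c * t))) \<longlongrightarrow> c * dirderiv \<phi> y d) (at_right 0)"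
      by (intro tendsto_mult tendsto_const filterlim_compose[OF dirderiv_tendsto_convex[OF S y]])
    then show ?thesis using 2
      by (intro dirderiv_eqI) (simp add: mult.commute)
  qed
next
  fix a b :: 'a
  have two: "filterlim (\<lambda>t. 2 * t) (at_right 0) (at_right (0::real))"
    unfolding filterlim_at
    by (auto simp: eventually_at_right_field intro!: tendsto_eq_intros exI[of _ 1])
  have in_S: "\<forall>\<^sub>F t in at_right 0. y + (2 * t) *\<^sub>R e \<in> S" for e
    using eventually_step_in_interior[OF y, of e] two by (rule eventually_compose_filterlim)
  have lim: "((\<lambda>t. (\<phi> (y + (2 * t) *\<^sub>R e) - \<phi> y) / (2 * t)) \<longlongrightarrow> dirderiv \<phi> y e) (at_right 0)" for e
    by (rule filterlim_compose[OF dirderiv_tendsto_convex[OF S y] two])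
  show "dirderiv \<phi> y (a + b) \<le> dirderiv \<phi> y a + dirderiv \<phi> y b"
  proof (rule tendsto_le[OF _ tendsto_add[OF lim lim] dirderiv_tendsto_convex[OF S y]])
    show "\<forall>\<^sub>F t in at_right 0. (\<phi> (y + t *\<^sub>R (a + b)) - \<phi> y) / t
        \<le> (\<phi> (y + (2 * t) *\<^sub>R a) - \<phi> y) / (2 * t) + (\<phi> (y + (2 * t) *\<^sub>R b) - \<phi> y) / (2 * t)"
      using in_S[of a] in_S[of b] eventually_at_right_less
    proof eventually_elim
      fix t :: real assume t: "y + (2 * t) *\<^sub>R a \<in> S" "y + (2 * t) *\<^sub>R b \<in> S" "0 < t"
      have "(1 - 1/2) *\<^sub>R (y + (2 * t) *\<^sub>R a) + (1/2) *\<^sub>R (y + (2 * t) *\<^sub>R b) = y + t *\<^sub>R (a + b)"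
        by (simp add: scaleR_add_right scaleR_2[symmetric] flip: scaleR_add_left)
      then have "\<phi> (y + t *\<^sub>R (a + b)) = \<phi> ((1 - 1/2) *\<^sub>R (y + (2 * t) *\<^sub>R a) + (1/2) *\<^sub>R (y + (2 * t) *\<^sub>R b))"
        by (simp only:)
      also have "\<dots> \<le> (1 - 1/2) * \<phi> (y + (2 * t) *\<^sub>R a) + (1/2) * \<phi> (y + (2 * t) *\<^sub>R b)"
        using t by (intro convex_onD[OF S]) auto
      finally have "(\<phi> (y + t *\<^sub>R (a + b)) - \<phi> y) / t
          \<le> ((1 - 1/2) * \<phi> (y + (2 * t) *\<^sub>R a) + (1/2) * \<phi> (y + (2 * t) *\<^sub>R b) - \<phi> y) / t"
        using t(3) by (intro divide_right_mono) simp_all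
      also have "\<dots> = (\<phi> (y + (2 * t) *\<^sub>R a) - \<phi> y) / (2 * t) + (\<phi> (y + (2 * t) *\<^sub>R b) - \<phi> y) / (2 * t)"
        using t(3) by (simp add: field_simps)
      finally show "(\<phi> (y + t *\<^sub>R (a + b)) - \<phi> y) / t
        \<le> (\<phi> (y + (2 * t) *\<^sub>R a) - \<phi> y) / (2 * t) + (\<phi> (y + (2 * t) *\<^sub>R b) - \<phi> y) / (2 * t)" .
    qed
  qed simp
qed

lemma dirderiv_le:
  fixes y :: "'a::real_normed_vector"
  assumes S: "convex_on S \<phi>" and y: "y \<in> interior S" and d: "y + d \<in> S"
  shows "dirderiv \<phi> y d \<le> \<phi> (y + d) - \<phi> y"
proof (rule tendsto_upperbound[OF dirderiv_tendsto_convex[OF S y]])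
  have yS: "y \<in> S" using y interior_subset by blast
  have "(\<phi> (y + t *\<^sub>R d) - \<phi> y) / t \<le> \<phi> (y + d) - \<phi> y" if "0 < t" "t < 1" for t
    using convex_difference_quotient_mono[OF S yS, of 1 d t] d that by simp
  then show "\<forall>\<^sub>F t in at_right 0. (\<phi> (y + t *\<^sub>R d) - \<phi> y) / t \<le> \<phi> (y + d) - \<phi> y"
    unfolding eventually_at_right_field by (intro exI[of _ 1]) auto
qed simp

text \<open>Differentiating a sublinear function at \<open>e\<close> keeps it sublinear, decreases it and makes it
  linear on the line through \<open>e\<close>; lines on which it was linear already stay so.  After all basis
  vectors have been treated in this way a linear function is left.  This is a proof of the
  Hahn-Banach theorem in finite dimension that consists of countably many limits, and therefore
  yields a measurable dependence on parameters.\<close>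
lemma dirderiv_sublinear:
  fixes p :: "'a::real_normed_vector \<Rightarrow> real"
  assumes p: "sublinear p"
  shows "sublinear (dirderiv p e)"
    and "dirderiv p e d \<le> p d"
    and "dirderiv p e e = p e"
    and "dirderiv p e (- e) = - dirderiv p e e"
    and "p (- u) = - p u \<Longrightarrow>
      dirderiv p e u = p u \<and> dirderiv p e (- u) = - dirderiv p e u"
proof -
  show sub: "sublinear (dirderiv p e)"
    using sublinear_dirderiv[OF sublinear_convex[OF p]] by simp
  show le: "dirderiv p e d \<le> p d" for d
    using dirderiv_le[OF sublinear_convex[OF p], of e d] sublinear_add[OF p, of e d] by simp
  have "(p (e + t *\<^sub>R e) - p e) / t = p e" if "t > 0" for t
    using that sublinear_scale[OF p, of "1 + t" e] by (simp add: algebra_simps)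
  then have "((\<lambda>t. (p (e + t *\<^sub>R e) - p e) / t) \<longlongrightarrow> p e) (at_right 0)"
    by (intro tendsto_eventually) (auto simp: eventually_at_right_field intro: exI[of _ 1])
  then show same: "dirderiv p e e = p e" by (rule dirderiv_eqI)
  have "(p (e + t *\<^sub>R (- e)) - p e) / t = - p e" if "0 < t" "t < 1" for t
    using that sublinear_scale[OF p, of "1 - t" e] by (simp add: algebra_simps divide_eq_eq)
  then have "((\<lambda>t. (p (e + t *\<^sub>R (- e)) - p e) / t) \<longlongrightarrow> - p e) (at_right 0)"
    by (intro tendsto_eventually) (auto simp: eventually_at_right_field intro: exI[of _ 1])
  then show "dirderiv p e (- e) = - dirderiv p e e"
    unfolding same by (rule dirderiv_eqI)
  assume u: "p (- u) = - p u"
  have "0 \<le> dirderiv p e u + dirderiv p e (- u)"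
    using sublinear_add[OF sub, of u "- u"] sublinear_zero[OF sub] by simp
  then show "dirderiv p e u = p u \<and> dirderiv p e (- u) = - dirderiv p e u"
    using le[of u] le[of "- u"] u by linarith
qed

text \<open>If \<open>p\<close> is the support function of a compact convex set, this is the support function of a face
  of that set: of the points that maximise the inner products with the directions in \<open>bs\<close>
  lexicographically.\<close>
definition lexderiv :: "('a::real_normed_vector \<Rightarrow> real) \<Rightarrow> 'a list \<Rightarrow> 'a \<Rightarrow> real"
  where "lexderiv p bs = fold (\<lambda>e q. dirderiv q e) bs p"

lemma lexderiv_sublinear:
  fixes p :: "'a::real_normed_vector \<Rightarrow> real"
  assumes "sublinear p"
  shows "sublinear (lexderiv p bs) \<and> (\<forall>d. lexderiv p bs d \<le> p d) \<and>
    (\<forall>u. p (- u) = - p u \<longrightarrow> lexderiv p bs u = p u \<and> lexderiv p bs (- u) = - lexderiv p bs u) \<and>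
    (\<forall>b\<in>set bs. lexderiv p bs (- b) = - lexderiv p bs b)"
  using assms
proof (induction bs arbitrary: p)
  case Nil
  then show ?case by (simp add: lexderiv_def)
next
  case (Cons e bs)
  have eq: "lexderiv p (e # bs) = lexderiv (dirderiv p e) bs" by (simp add: lexderiv_def)
  note D = dirderiv_sublinear[OF Cons.prems, where e = e]
  note IH = Cons.IH[OF D(1)]
  show ?case unfolding eq
  proof (intro conjI allI impI ballI)
    show "lexderiv (dirderiv p e) bs d \<le> p d" for d
      using IH D(2)[of d] by (meson order_trans)
    show "lexderiv (dirderiv p e) bs u = p u" if "p (- u) = - p u" for u
      using IH D(5)[OF that] by simp
    show "lexderiv (dirderiv p e) bs (- u) = - lexderiv (dirderiv p e) bs u" if "p (- u) = - p u" for u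
      using IH D(5)[OF that] by blast
    show "lexderiv (dirderiv p e) bs (- b) = - lexderiv (dirderiv p e) bs b" if "b \<in> set (e # bs)" for b
      using that IH D(4) by auto
  qed (use IH in blast)
qed

lemma lexderiv_measurable:
  assumes "\<And>d. (\<lambda>w. p w d) \<in> borel_measurable N"
  shows "(\<lambda>w. lexderiv (p w) bs d) \<in> borel_measurable N"
  using assms
proof (induction bs arbitrary: p)
  case (Cons e bs)
  have "(\<lambda>w. lexderiv (dirderiv (p w) e) bs d) \<in> borel_measurable N"
    using Cons.prems by (intro Cons.IH dirderiv_measurable)
  then show ?case by (simp add: lexderiv_def)
qed (simp add: lexderiv_def)

lemma sublinear_linear:
  fixes q :: "'a::euclidean_space \<Rightarrow> real"
  assumes q: "sublinear q" and b: "\<And>b. b \<in> Basis \<Longrightarrow> q (- b) = - q b"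
  shows "q x = (\<Sum>b\<in>Basis. q b *\<^sub>R b) \<bullet> x"
proof -
  have sum: "q (sum h A) \<le> (\<Sum>b\<in>A. q (h b))" if "finite A" for h :: "'a \<Rightarrow> 'a" and A
    using that
  proof (induction A rule: finite_induct)
    case (insert a A)
    then show ?case using sublinear_add[OF q, of "h a" "sum h A"] by simp
  qed (simp add: sublinear_zero[OF q])
  have scale: "q (c *\<^sub>R b) = c * q b" if "b \<in> Basis" for c b
  proof (cases "c \<ge> 0")
    case False
    then have "q ((- c) *\<^sub>R (- b)) = (- c) * q (- b)" by (intro sublinear_scale[OF q]) auto
    then show ?thesis using assms(2)[OF that] by simp
  qed (simp add: sublinear_scale[OF q])
  have le: "q x \<le> (\<Sum>b\<in>Basis. q b *\<^sub>R b) \<bullet> x" for x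
  proof -
    have "q x = q (\<Sum>b\<in>Basis. (x \<bullet> b) *\<^sub>R b)" by (simp add: euclidean_representation)
    also have "\<dots> \<le> (\<Sum>b\<in>Basis. q ((x \<bullet> b) *\<^sub>R b))" by (intro sum) simp
    also have "\<dots> = (\<Sum>b\<in>Basis. q b *\<^sub>R b) \<bullet> x"
      by (simp add: scale inner_sum_left) (simp add: inner_commute mult.commute)
    finally show ?thesis .
  qed
  have "0 \<le> q x + q (- x)"
    using sublinear_add[OF q, of x "- x"] sublinear_zero[OF q] by simp
  then show ?thesis using le[of x] le[of "- x"] by simp
qed

definition basis_list :: "'a::euclidean_space list"
  where "basis_list = (SOME bs. set bs = Basis)"

lemma set_basis_list: "set (basis_list :: 'a::euclidean_space list) = Basis"
  unfolding basis_list_def using someI_ex[OF finite_list[OF finite_Basis]] .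

text \<open>Since the direction \<open>d\<close> is treated before the basis, this subgradient attains the directional
  derivative of \<open>\<phi>\<close> along \<open>d\<close>.\<close>
definition subgrad :: "('a::euclidean_space \<Rightarrow> real) \<Rightarrow> 'a \<Rightarrow> 'a \<Rightarrow> 'a"
  where "subgrad \<phi> y d = (\<Sum>b\<in>Basis. lexderiv (dirderiv (dirderiv \<phi> y) d) basis_list b *\<^sub>R b)"

lemma subgrad_measurable:
  assumes "\<And>d. (\<lambda>w. p w (y w + d)) \<in> borel_measurable N"
  shows "(\<lambda>w. subgrad (p w) (y w) d) \<in> borel_measurable N"
proof -
  have p0: "(\<lambda>w. dirderiv (p w) (y w) e) \<in> borel_measurable N" for e
    unfolding dirderiv_def using assms assms[of 0]
    by (intro borel_measurable_lim_metric borel_measurable_divide borel_measurable_diff) simp_all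
  show ?thesis unfolding subgrad_def
    by (intro borel_measurable_sum borel_measurable_scaleR borel_measurable_const
        lexderiv_measurable dirderiv_measurable p0)
qed

text \<open>The squared norm may be centred at any point, since this changes it by an affine function.
  Centred at \<open>y\<close> it has derivative zero there, so that \<open>\<phi>\<close> and its convexification have the same
  directional derivatives at \<open>y\<close>.\<close>
lemma weakly_convex_shift:
  fixes \<phi> :: "'a::real_inner \<Rightarrow> real"
  assumes "convex_on S (\<lambda>z. \<phi> z + c / 2 * (norm z)\<^sup>2)"
  shows "convex_on S (\<lambda>z. \<phi> z + c / 2 * (norm (z - y))\<^sup>2)"
proof (rule convex_onI)
  show "convex S" using assms by (simp add: convex_on_def)
  fix t a b assume t: "0 < t" "t < (1::real)" and ab: "a \<in> S" "b \<in> S"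
  have cv: "\<phi> ((1 - t) *\<^sub>R a + t *\<^sub>R b) + c / 2 * (norm ((1 - t) *\<^sub>R a + t *\<^sub>R b))\<^sup>2
      \<le> (1 - t) * (\<phi> a + c / 2 * (norm a)\<^sup>2) + t * (\<phi> b + c / 2 * (norm b)\<^sup>2)"
    using t ab by (intro convex_onD[OF assms]) auto
  have nn: "(norm ((1 - t) *\<^sub>R a + t *\<^sub>R b - y))\<^sup>2
      = (1 - t) * (norm (a - y))\<^sup>2 + t * (norm (b - y))\<^sup>2 - t * (1 - t) * (norm (a - b))\<^sup>2"
  proof -
    have "(1 - t) *\<^sub>R a + t *\<^sub>R b - y = (1 - t) *\<^sub>R (a - y) + t *\<^sub>R (b - y)"
      by (simp add: algebra_simps)
    then show ?thesis using norm_sq_convex_combination[of t "a - y" "b - y"] by simp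
  qed
  show "\<phi> ((1 - t) *\<^sub>R a + t *\<^sub>R b) + c / 2 * (norm ((1 - t) *\<^sub>R a + t *\<^sub>R b - y))\<^sup>2
      \<le> (1 - t) * (\<phi> a + c / 2 * (norm (a - y))\<^sup>2) + t * (\<phi> b + c / 2 * (norm (b - y))\<^sup>2)"
    using cv unfolding norm_sq_convex_combination nn
    by (simp add: algebra_simps add_divide_distrib diff_divide_distrib)
qed

context
  fixes \<phi> :: "'a::euclidean_space \<Rightarrow> real" and S :: "'a set" and c :: real and y :: 'a
  assumes wc: "convex_on S (\<lambda>z. \<phi> z + c / 2 * (norm z)\<^sup>2)" and y: "y \<in> interior S"
begin

lemma dirderiv_weakly_convex:
  "((\<lambda>t. (\<phi> (y + t *\<^sub>R d) - \<phi> y) / t) \<longlongrightarrow> dirderiv (\<lambda>z. \<phi> z + c / 2 * (norm (z - y))\<^sup>2) y d) (at_right 0)"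
proof -
  let ?\<phi> = "\<lambda>z. \<phi> z + c / 2 * (norm (z - y))\<^sup>2"
  have "((\<lambda>t. (?\<phi> (y + t *\<^sub>R d) - ?\<phi> y) / t - c / 2 * (t * (norm d)\<^sup>2)) \<longlongrightarrow>
      dirderiv ?\<phi> y d - c / 2 * (0 * (norm d)\<^sup>2)) (at_right 0)"
    by (intro tendsto_intros dirderiv_tendsto_convex[OF weakly_convex_shift[OF wc, of y] y])
  moreover have "(?\<phi> (y + t *\<^sub>R d) - ?\<phi> y) / t - c / 2 * (t * (norm d)\<^sup>2) = (\<phi> (y + t *\<^sub>R d) - \<phi> y) / t"
    if "t > 0" for t
    using that by (simp add: field_simps power2_eq_square)
  then have "\<forall>\<^sub>F t in at_right 0. (?\<phi> (y + t *\<^sub>R d) - ?\<phi> y) / t - c / 2 * (t * (norm d)\<^sup>2)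
      = (\<phi> (y + t *\<^sub>R d) - \<phi> y) / t"
    unfolding eventually_at_right_field by (intro exI[of _ 1]) auto
  ultimately show ?thesis
    using tendsto_cong by force
qed

lemma dirderiv_weakly_convex_eq: "dirderiv (\<lambda>z. \<phi> z + c / 2 * (norm (z - y))\<^sup>2) y = dirderiv \<phi> y"
  using dirderiv_eqI[OF dirderiv_weakly_convex] by (intro ext) simp

lemmas dirderiv_weakly_convex_tendsto = dirderiv_weakly_convex[unfolded dirderiv_weakly_convex_eq]

lemma sublinear_dirderiv_weakly_convex: "sublinear (dirderiv \<phi> y)"
  using sublinear_dirderiv[OF weakly_convex_shift[OF wc, of y] y] unfolding dirderiv_weakly_convex_eq .

lemma subgrad_inner_le: "subgrad \<phi> y d \<bullet> e \<le> dirderiv \<phi> y e"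
  and subgrad_inner_same: "subgrad \<phi> y d \<bullet> d = dirderiv \<phi> y d"
proof -
  let ?p = "dirderiv (dirderiv \<phi> y) d"
  note D = dirderiv_sublinear[OF sublinear_dirderiv_weakly_convex, where e = d]
  note l = lexderiv_sublinear[OF D(1), where bs = basis_list]
  have lin: "lexderiv ?p basis_list e = subgrad \<phi> y d \<bullet> e" for e
    unfolding subgrad_def
    by (intro sublinear_linear) (use l set_basis_list in auto)
  show "subgrad \<phi> y d \<bullet> e \<le> dirderiv \<phi> y e"
    unfolding lin[symmetric] using l D(2) by (meson order_trans)
  show "subgrad \<phi> y d \<bullet> d = dirderiv \<phi> y d"
    unfolding lin[symmetric] using l D(3,4) by metis
qed

lemma subgrad_inequality:
  assumes "z \<in> S"
  shows "subgrad \<phi> y d \<bullet> (z - y) \<le> \<phi> z - \<phi> y + c / 2 * (norm (z - y))\<^sup>2"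
  using order_trans[OF subgrad_inner_le[of d "z - y"] dirderiv_le[OF weakly_convex_shift[OF wc, of y] y, of "z - y",
      unfolded dirderiv_weakly_convex_eq]] assms
  by simp

end

section \<open>Stochastic weakly convex functions\<close>

definition dense_seq :: "nat \<Rightarrow> 'a::euclidean_space"
  where "dense_seq = (SOME e. \<forall>X. open X \<longrightarrow> X \<noteq> {} \<longrightarrow> (\<exists>i. e i \<in> X))"

lemma dense_seq:
  fixes X :: "'a::euclidean_space set"
  assumes "open X" "X \<noteq> {}"
  shows "\<exists>i. dense_seq i \<in> X"
proof -
  obtain D :: "'a set" where D: "countable D" "\<And>X. open X \<Longrightarrow> X \<noteq> {} \<Longrightarrow> \<exists>d \<in> D. d \<in> X"
    by (erule countable_dense_setE)
  have "D \<noteq> {}" using D(2)[of UNIV] by auto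
  then have "\<forall>X. open X \<longrightarrow> X \<noteq> {} \<longrightarrow> (\<exists>i. from_nat_into D i \<in> X)"
    using D by (metis from_nat_into_surj)
  then have "\<forall>X::'a set. open X \<longrightarrow> X \<noteq> {} \<longrightarrow> (\<exists>i. dense_seq i \<in> X)"
    unfolding dense_seq_def
    by (rule someI[where P = "\<lambda>e. \<forall>X. open X \<longrightarrow> X \<noteq> {} \<longrightarrow> (\<exists>i. e i \<in> X)"])
  then show ?thesis using assms by blast
qed

text \<open>A Caratheodory function is a pointwise limit of functions that are piecewise constant in the
  first variable, with values at the points of a dense sequence.\<close>
lemma caratheodory_measurable:
  fixes h :: "'a::euclidean_space \<Rightarrow> 's \<Rightarrow> real"
  assumes U: "open U" and S: "S \<in> sets N"
    and h: "\<And>y. h y \<in> borel_measurable N"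
    and cont: "\<And>s. s \<in> S \<Longrightarrow> continuous_on U (\<lambda>y. h y s)"
  shows "(\<lambda>w. if fst w \<in> U \<and> snd w \<in> S then h (fst w) (snd w) else 0) \<in> borel_measurable (borel \<Otimes>\<^sub>M N)"
proof -
  define P where "P n y i \<longleftrightarrow> dense_seq i \<in> U \<and> dist (dense_seq i) y < 1 / real (Suc n)"
    for n and y :: 'a and i
  define ix where "ix n y = (LEAST i. P n y i)" for n y
  have ix: "P n y (ix n y)" if "y \<in> U" for n y
  proof -
    have "\<exists>i. dense_seq i \<in> U \<inter> ball y (1 / real (Suc n))"
      using that U by (intro dense_seq) (auto simp: open_Int intro!: exI[of _ y])
    then have "\<exists>i. P n y i" unfolding P_def by (auto simp: dist_commute)
    then show ?thesis unfolding ix_def by (rule LeastI_ex)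
  qed
  have ix_meas: "(\<lambda>w. ix n (fst w)) \<in> measurable (borel \<Otimes>\<^sub>M N) (count_space UNIV)" for n
    unfolding ix_def P_def by measurable
  define H where "H n w = (if fst w \<in> U \<and> snd w \<in> S then h (dense_seq (ix n (fst w))) (snd w) else 0)" for n w
  have "(\<lambda>w. h (dense_seq (ix n (fst w))) (snd w)) \<in> borel_measurable (borel \<Otimes>\<^sub>M N)" for n
    by (rule measurable_compose_countable[where f = "\<lambda>i w. h (dense_seq i) (snd w)",
          OF measurable_compose[OF measurable_snd h] ix_meas])
  moreover have "{w \<in> space (borel \<Otimes>\<^sub>M N). fst w \<in> U \<and> snd w \<in> S} \<in> sets (borel \<Otimes>\<^sub>M N)"
    using borel_open[OF U] S
    by (intro predE pred_intros_logic pred_sets2[OF _ measurable_fst] pred_sets2[OF _ measurable_snd])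
  ultimately have "H n \<in> borel_measurable (borel \<Otimes>\<^sub>M N)" for n
    unfolding H_def by (intro measurable_If) auto
  then show ?thesis
  proof (rule borel_measurable_LIMSEQ_real[rotated])
    fix w assume "w \<in> space ((borel :: 'a measure) \<Otimes>\<^sub>M N)"
    show "(\<lambda>n. H n w) \<longlonglongrightarrow> (if fst w \<in> U \<and> snd w \<in> S then h (fst w) (snd w) else 0)"
    proof (cases "fst w \<in> U \<and> snd w \<in> S")
      case True
      have "(\<lambda>n. dense_seq (ix n (fst w))) \<longlonglongrightarrow> fst w"
      proof (rule LIM_zero_cancel, rule Lim_null_comparison)
        show "\<forall>\<^sub>F n in sequentially. norm (dense_seq (ix n (fst w)) - fst w) \<le> 1 / real (Suc n)"
          using ix True by (intro always_eventually allI) (auto simp: P_def dist_norm less_imp_le)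
        show "(\<lambda>n. 1 / real (Suc n)) \<longlonglongrightarrow> 0"
          using LIMSEQ_inverse_real_of_nat by (simp add: inverse_eq_divide)
      qed
      moreover have "\<forall>n. dense_seq (ix n (fst w)) \<in> U" using ix True by (auto simp: P_def)
      ultimately have "(\<lambda>n. h (dense_seq (ix n (fst w))) (snd w)) \<longlonglongrightarrow> h (fst w) (snd w)"
        using True by (intro continuous_on_tendsto_compose[OF cont]) auto
      then show ?thesis using True by (simp add: H_def)
    next
      case False
      then show ?thesis by (simp only: H_def if_not_P[OF False] if_False tendsto_const)
    qed
  qed
qed

text \<open>Subdividing a segment makes the quadratic error disappear.\<close>
lemma lipschitz_from_quadratic_error:
  fixes h :: "'a::real_normed_vector \<Rightarrow> real"
  assumes C: "convex C"
    and le: "\<And>y z. y \<in> C \<Longrightarrow> z \<in> C \<Longrightarrow> h y - h z \<le> L * norm (y - z) + c * (norm (y - z))\<^sup>2"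
    and y: "y \<in> C" and z: "z \<in> C"
  shows "h y - h z \<le> L * norm (y - z)"
proof -
  have step: "h y - h z \<le> L * norm (y - z) + c * (norm (y - z))\<^sup>2 * (1 / real (Suc n))" for n
  proof -
    define N where "N = real (Suc n)"
    have N: "N > 0" by (simp add: N_def)
    define u where "u i = (1 - real i / N) *\<^sub>R z + (real i / N) *\<^sub>R y" for i
    have uC: "u i \<in> C" if "i \<le> Suc n" for i
      unfolding u_def using C y z that N
      by (intro convexD_alt) (auto simp: N_def)
    have "h y - h z = h (u (Suc n)) - h (u 0)"
      by (simp add: u_def N_def)
    also have "\<dots> = (\<Sum>i<Suc n. h (u (Suc i)) - h (u i))"
      by (rule sum_lessThan_telescope[symmetric])
    also have "\<dots> \<le> (\<Sum>i<Suc n. L * (norm (y - z) / N) + c * (norm (y - z) / N)\<^sup>2)"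
    proof (rule sum_mono)
      fix i assume i: "i \<in> {..<Suc n}"
      have "u (Suc i) - u i = (1 / N) *\<^sub>R (y - z)"
        using N by (simp add: u_def algebra_simps add_divide_distrib)
      then have "norm (u (Suc i) - u i) = norm (y - z) / N" using N by simp
      then show "h (u (Suc i)) - h (u i) \<le> L * (norm (y - z) / N) + c * (norm (y - z) / N)\<^sup>2"
        using le[OF uC uC, of "Suc i" i] i by simp
    qed
    also have "\<dots> = L * norm (y - z) + c * (norm (y - z))\<^sup>2 * (1 / N)"
      using N by (simp add: N_def[symmetric] power_divide field_simps power2_eq_square
          del: of_nat_Suc)
    finally show ?thesis by (simp add: N_def)
  qed
  have "(\<lambda>n. L * norm (y - z) + c * (norm (y - z))\<^sup>2 * (1 / real (Suc n))) \<longlonglongrightarrow>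
      L * norm (y - z) + c * (norm (y - z))\<^sup>2 * 0"
    using LIMSEQ_inverse_real_of_nat by (intro tendsto_intros) (simp add: inverse_eq_divide)
  then show ?thesis using step by (intro LIMSEQ_le_const) auto
qed

locale stochastic_weakly_convex =
  fixes f :: "'a::euclidean_space \<Rightarrow> 's \<Rightarrow> ereal" and F :: "'a \<Rightarrow> ereal" and \<Xi> :: "'s measure"
    and C :: "'a set" and l L :: real
  assumes prob: "prob_space \<Xi>"
    and f_measurable: "\<And>y. f y \<in> borel_measurable \<Xi>"
    and f_continuous: "\<And>s. s \<in> space \<Xi> \<Longrightarrow> continuous_on (edom (\<lambda>y. f y s)) (\<lambda>y. f y s)"
    and F: "\<And>y. F y = expectation_ereal \<Xi> (f y)"
    and l_nonneg: "l \<ge> 0"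
    and f_weakly_convex: "\<And>s. s \<in> space \<Xi> \<Longrightarrow> weakly_convex l (\<lambda>y. f y s)"
    and C_subset: "C \<subseteq> interior (edom F)" and convex_C: "convex C"
    and L_nonneg: "L \<ge> 0"
    and subgradient_bound: "\<And>y h. y \<in> C \<Longrightarrow> h \<in> borel_measurable \<Xi> \<Longrightarrow>
          (AE s in \<Xi>. h s \<in> subdifferential (\<lambda>z. f z s) y) \<Longrightarrow>
          (\<integral>\<^sup>+s. ennreal ((norm (h s))\<^sup>2) \<partial>\<Xi>) \<le> ennreal (L\<^sup>2)"
begin

sublocale Xi: prob_space \<Xi> by (rule prob)

definition U :: "'a set" where "U = interior (edom F)"

abbreviation fr :: "'a \<Rightarrow> 's \<Rightarrow> real" where "fr y s \<equiv> real_of_ereal (f y s)"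

abbreviation Fr :: "'a \<Rightarrow> real" where "Fr y \<equiv> real_of_ereal (F y)"

text \<open>Samples for which \<open>f\<close> is finite on a countable dense subset of \<open>U\<close>; by convexity of the
  effective domains it is then finite on all of \<open>U\<close>.\<close>
definition S0 :: "'s set"
  where "S0 = {s \<in> space \<Xi>. \<forall>i. dense_seq i \<in> U \<longrightarrow> \<bar>f (dense_seq i) s\<bar> \<noteq> \<infinity>}"

lemma open_U: "open U" by (simp add: U_def)

lemma C_U: "C \<subseteq> U" using C_subset by (simp add: U_def)

lemma f_not_MInf: "s \<in> space \<Xi> \<Longrightarrow> f y s \<noteq> -\<infinity>"
  using f_weakly_convex by (simp add: weakly_convex_def)

lemma fr_weakly_convex:
  "s \<in> space \<Xi> \<Longrightarrow> convex_on (edom (\<lambda>y. f y s)) (\<lambda>y. fr y s + l / 2 * (norm y)\<^sup>2)"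
  using f_weakly_convex by (simp add: weakly_convex_def)

lemma convex_edom: "s \<in> space \<Xi> \<Longrightarrow> convex (edom (\<lambda>y. f y s))"
  using fr_weakly_convex by (auto simp: convex_on_def)

lemma finite_expectation:
  assumes y: "y \<in> edom F"
  shows finite_expectation_AE: "AE s in \<Xi>. \<bar>f y s\<bar> \<noteq> \<infinity>"
    and "integrable \<Xi> (fr y)"
    and "Fr y = (\<integral>s. fr y s \<partial>\<Xi>)"
proof -
  note [measurable] = f_measurable
  define p where "p = (\<integral>\<^sup>+s. e2ennreal (f y s) \<partial>\<Xi>)"
  define n where "n = (\<integral>\<^sup>+s. e2ennreal (- f y s) \<partial>\<Xi>)"
  have Fy: "F y = enn2ereal p - enn2ereal n"
    by (simp add: F expectation_ereal_def p_def n_def)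
  have y': "\<bar>enn2ereal p - enn2ereal n\<bar> \<noteq> \<infinity>"
    using y by (simp add: edom_def Fy)
  have fin: "p \<noteq> \<infinity>" "n \<noteq> \<infinity>"
  proof -
    show "p \<noteq> \<infinity>" using y' by (cases n) (auto simp: enn2ereal_ennreal)
    then show "n \<noteq> \<infinity>" using y' by (cases p) (auto simp: enn2ereal_ennreal)
  qed
  have "AE s in \<Xi>. e2ennreal (f y s) \<noteq> \<infinity>"
    using fin(1) unfolding p_def by (intro nn_integral_PInf_AE) auto
  then show AE: "AE s in \<Xi>. \<bar>f y s\<bar> \<noteq> \<infinity>"
    using AE_space
  proof eventually_elim
    case (elim s)
    then show ?case using f_not_MInf[of s y] by (cases "f y s") auto
  qed
  have p: "p = (\<integral>\<^sup>+s. ennreal (fr y s) \<partial>\<Xi>)" unfolding p_def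
    using AE by (intro nn_integral_cong_AE) (auto simp: ereal_real' simp flip: e2ennreal_ereal)
  have n: "n = (\<integral>\<^sup>+s. ennreal (- fr y s) \<partial>\<Xi>)" unfolding n_def
    using AE by (intro nn_integral_cong_AE)
      (auto simp: ereal_real' simp flip: e2ennreal_ereal uminus_ereal.simps(1))
  show "integrable \<Xi> (fr y)"
    using fin by (simp add: real_integrable_def p n)
  then have "(\<integral>s. fr y s \<partial>\<Xi>) = enn2real p - enn2real n"
    by (simp add: real_lebesgue_integral_def p n)
  then show "Fr y = (\<integral>s. fr y s \<partial>\<Xi>)"
    unfolding Fy using fin by (cases p; cases n) (simp_all add: enn2ereal_ennreal)
qed

lemma S0_subset: "S0 \<subseteq> space \<Xi>" by (auto simp: S0_def)

lemma S0_sets: "S0 \<in> sets \<Xi>"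
proof -
  note [measurable] = f_measurable
  show ?thesis unfolding S0_def by measurable
qed

lemma AE_S0: "AE s in \<Xi>. s \<in> S0"
proof -
  have "AE s in \<Xi>. \<forall>i. dense_seq i \<in> U \<longrightarrow> \<bar>f (dense_seq i) s\<bar> \<noteq> \<infinity>"
    unfolding AE_all_countable
  proof
    fix i
    show "AE s in \<Xi>. dense_seq i \<in> U \<longrightarrow> \<bar>f (dense_seq i) s\<bar> \<noteq> \<infinity>"
      using finite_expectation_AE[of "dense_seq i"] interior_subset[of "edom F"]
      by (cases "(dense_seq i :: 'a) \<in> U") (auto simp: U_def)
  qed
  then show ?thesis using AE_space by eventually_elim (simp add: S0_def)
qed

text \<open>A convex set and its closure have the same interior.\<close>
lemma U_subset:
  assumes s: "s \<in> S0"
  shows "U \<subseteq> interior (edom (\<lambda>y. f y s))"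
proof -
  have "U \<subseteq> closure (edom (\<lambda>y. f y s))"
  proof
    fix y assume y: "y \<in> U"
    show "y \<in> closure (edom (\<lambda>y. f y s))"
    proof (subst closure_approachable, intro allI impI)
      fix e :: real assume "e > 0"
      then have "\<exists>i. dense_seq i \<in> U \<inter> ball y e"
        using y open_U by (intro dense_seq) (auto simp: open_Int)
      then obtain i where "dense_seq i \<in> U" "dist (dense_seq i) y < e"
        by (auto simp: dist_commute)
      then show "\<exists>z\<in>edom (\<lambda>y. f y s). dist z y < e"
        using s by (intro bexI[of _ "dense_seq i"]) (auto simp: S0_def edom_def)
    qed
  qed
  then have "U \<subseteq> interior (closure (edom (\<lambda>y. f y s)))"
    using open_U by (rule interior_maximal)
  then show ?thesis
    using convex_interior_closure[OF convex_edom] s S0_subset by blast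
qed

lemma finite_on_U: "s \<in> S0 \<Longrightarrow> y \<in> U \<Longrightarrow> y \<in> edom (\<lambda>y. f y s)"
  using U_subset interior_subset by blast

text \<open>The value \<open>0\<close> outside \<open>U\<close> and \<open>S0\<close> makes \<open>f\<close> a real function that is jointly measurable on
  the whole product space.\<close>
definition fU :: "'a \<times> 's \<Rightarrow> real"
  where "fU w = (if fst w \<in> U \<and> snd w \<in> S0 then fr (fst w) (snd w) else 0)"

lemma fU_measurable: "fU \<in> borel_measurable (borel \<Otimes>\<^sub>M \<Xi>)"
  unfolding fU_def
proof (rule caratheodory_measurable[OF open_U S0_sets])
  show "fr y \<in> borel_measurable \<Xi>" for y using f_measurable[of y] by measurable
  show "continuous_on U (\<lambda>y. fr y s)" if s: "s \<in> S0" for s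
  proof -
    have "continuous_on (edom (\<lambda>y. f y s)) (\<lambda>y. f y s)"
      using f_continuous s S0_subset by blast
    then have "continuous_on (edom (\<lambda>y. f y s)) (\<lambda>y. fr y s)"
      unfolding continuous_on_def by (auto simp: edom_def ereal_real' intro!: lim_real_of_ereal)
    then show ?thesis using finite_on_U[OF s] by (meson continuous_on_subset subsetI)
  qed
qed

definition V :: "'a \<Rightarrow> 'a \<times> 's \<Rightarrow> 'a"
  where "V d w = subgrad (\<lambda>z. fU (z, snd w)) (fst w) d"

lemma V_measurable: "V d \<in> borel_measurable (borel \<Otimes>\<^sub>M \<Xi>)"
  unfolding V_def
proof (rule subgrad_measurable)
  fix d
  show "(\<lambda>w. fU (fst w + d, snd w)) \<in> borel_measurable (borel \<Otimes>\<^sub>M \<Xi>)"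
    by (rule measurable_compose[OF _ fU_measurable]) measurable
qed

lemma V_eq:
  assumes s: "s \<in> S0" and y: "y \<in> U"
  shows "V d (y, s) = subgrad (\<lambda>z. fr z s) y d"
proof -
  have "dirderiv (\<lambda>z. fU (z, s)) y e = dirderiv (\<lambda>z. fr z s) y e" for e
  proof (rule dirderiv_eqI)
    have "\<forall>\<^sub>F t in at_right 0. y + t *\<^sub>R e \<in> U"
      using y open_U by (intro eventually_step_in_interior) (simp add: interior_open)
    then have "\<forall>\<^sub>F t in at_right 0. (fr (y + t *\<^sub>R e) s - fr y s) / t = (fU (y + t *\<^sub>R e, s) - fU (y, s)) / t"
      by eventually_elim (use s y in \<open>simp add: fU_def\<close>)
    then show "((\<lambda>t. (fU (y + t *\<^sub>R e, s) - fU (y, s)) / t) \<longlongrightarrow> dirderiv (\<lambda>z. fr z s) y e) (at_right 0)"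
      using dirderiv_weakly_convex_tendsto[OF fr_weakly_convex, of s y e] s S0_subset U_subset[OF s] y
      by (blast intro: Lim_transform_eventually)
  qed
  then have "dirderiv (\<lambda>z. fU (z, s)) y = dirderiv (\<lambda>z. fr z s) y" by blast
  then show ?thesis by (simp add: V_def subgrad_def)
qed

context
  fixes y :: 'a and s :: 's
  assumes s: "s \<in> S0" and y: "y \<in> U"
begin

lemma V_inequality:
  assumes "z \<in> edom (\<lambda>y. f y s)"
  shows "V d (y, s) \<bullet> (z - y) \<le> fr z s - fr y s + l / 2 * (norm (z - y))\<^sup>2"
  unfolding V_eq[OF s y]
  using subgrad_inequality[OF fr_weakly_convex _ assms] s y S0_subset U_subset[OF s] by blast

lemma V_subdifferential: "V d (y, s) \<in> subdifferential (\<lambda>z. f z s) y"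
  unfolding subdifferential_def
proof (intro CollectI conjI exI)
  show "y \<in> edom (\<lambda>z. f z s)" using finite_on_U s y by blast
  show "(\<lambda>z. - l / 2 * (norm (y - z))\<^sup>2) \<in> o[at y](\<lambda>z. norm (y - z))"
  proof (rule smalloI_tendsto)
    have "((\<lambda>z. - l / 2 * norm (y - z)) \<longlongrightarrow> - l / 2 * norm (y - y)) (at y)"
      by (intro tendsto_intros)
    moreover have "\<forall>\<^sub>F z in at y. - l / 2 * norm (y - z) = - l / 2 * (norm (y - z))\<^sup>2 / norm (y - z)"
      by (auto simp: eventually_at_filter power2_eq_square)
    ultimately show "((\<lambda>z. - l / 2 * (norm (y - z))\<^sup>2 / norm (y - z)) \<longlongrightarrow> 0) (at y)"
      by (auto intro: Lim_transform_eventually)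
    show "\<forall>\<^sub>F z in at y. norm (y - z) \<noteq> 0" by (auto simp: eventually_at_filter)
  qed
  show "\<forall>\<^sub>F z in at y. f z s \<ge> f y s + ereal (V d (y, s) \<bullet> (z - y) + - l / 2 * (norm (y - z))\<^sup>2)"
  proof (intro always_eventually allI)
    fix z
    have fy: "f y s = ereal (fr y s)" using finite_on_U[OF s y] by (auto simp: edom_def ereal_real')
    show "f z s \<ge> f y s + ereal (V d (y, s) \<bullet> (z - y) + - l / 2 * (norm (y - z))\<^sup>2)"
    proof (cases "z \<in> edom (\<lambda>y. f y s)")
      case True
      then have fz: "f z s = ereal (fr z s)" by (auto simp: edom_def ereal_real')
      show ?thesis
        using V_inequality[OF True, of d] by (subst fy, subst fz) (simp add: norm_minus_commute)
    next
      case False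
      then have "f z s = \<infinity>" using f_not_MInf[of s z] s S0_subset by (auto simp: edom_def)
      then show ?thesis by simp
    qed
  qed
qed

text \<open>Along a ray the error term \<open>R\<close> of the subdifferential is small compared with the step size,
  so it disappears from the difference quotient in the limit.\<close>
lemma subdifferential_le_dirderiv:
  assumes v: "v \<in> subdifferential (\<lambda>z. f z s) y"
  shows "v \<bullet> d \<le> dirderiv (\<lambda>z. fr z s) y d"
proof (cases "d = 0")
  case True
  have "sublinear (dirderiv (\<lambda>z. fr z s) y)"
    using sublinear_dirderiv_weakly_convex[OF fr_weakly_convex] s y S0_subset U_subset[OF s] by blast
  then show ?thesis using True sublinear_zero by force
next
  case False
  obtain R where R: "R \<in> o[at y](\<lambda>z. norm (y - z))"
    and ev: "\<forall>\<^sub>F z in at y. f z s \<ge> f y s + ereal (v \<bullet> (z - y) + R z)"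
    using v by (auto simp: subdifferential_def)
  have fl: "filterlim (\<lambda>t. y + t *\<^sub>R d) (at y) (at_right (0::real))"
    unfolding filterlim_at using False
    by (auto simp: eventually_at_right_field intro!: tendsto_eq_intros exI[of _ 1])
  have "((\<lambda>t. R (y + t *\<^sub>R d) / norm (y - (y + t *\<^sub>R d)) * norm d) \<longlongrightarrow> 0 * norm d) (at_right 0)"
    by (intro tendsto_intros filterlim_compose[OF smalloD_tendsto[OF R] fl])
  moreover have "\<forall>\<^sub>F t in at_right 0. R (y + t *\<^sub>R d) / norm (y - (y + t *\<^sub>R d)) * norm d = R (y + t *\<^sub>R d) / t"
    using False by (auto simp: eventually_at_right_field intro!: exI[of _ 1])
  ultimately have R0: "((\<lambda>t. R (y + t *\<^sub>R d) / t) \<longlongrightarrow> 0) (at_right 0)"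
    by (auto intro: Lim_transform_eventually)
  have lim: "((\<lambda>t. (fr (y + t *\<^sub>R d) s - fr y s) / t) \<longlongrightarrow> dirderiv (\<lambda>z. fr z s) y d) (at_right 0)"
    using dirderiv_weakly_convex_tendsto[OF fr_weakly_convex, of s y d] s y S0_subset U_subset[OF s] by blast
  have "v \<bullet> d + 0 \<le> dirderiv (\<lambda>z. fr z s) y d"
  proof (rule tendsto_le[OF _ lim tendsto_add[OF tendsto_const R0]])
    have "\<forall>\<^sub>F t in at_right 0. y + t *\<^sub>R d \<in> U"
      using y open_U by (intro eventually_step_in_interior) (simp add: interior_open)
    then show "\<forall>\<^sub>F t in at_right 0. v \<bullet> d + R (y + t *\<^sub>R d) / t \<le> (fr (y + t *\<^sub>R d) s - fr y s) / t"
      using eventually_compose_filterlim[OF ev fl] eventually_at_right_less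
    proof eventually_elim
      case (elim t)
      have "f y s = ereal (fr y s)" "f (y + t *\<^sub>R d) s = ereal (fr (y + t *\<^sub>R d) s)"
        using finite_on_U[OF s] y elim(1) by (auto simp: edom_def ereal_real')
      then have "fr y s + (v \<bullet> (t *\<^sub>R d) + R (y + t *\<^sub>R d)) \<le> fr (y + t *\<^sub>R d) s"
        using elim(2) by (metis add_diff_cancel_left' ereal_less_eq(3) plus_ereal.simps(1))
      then have "(t * (v \<bullet> d) + R (y + t *\<^sub>R d)) / t \<le> (fr (y + t *\<^sub>R d) s - fr y s) / t"
        using elim(3) by (intro divide_right_mono) auto
      then show ?case using elim(3) by (simp add: add_divide_distrib)
    qed
  qed simp
  then show ?thesis by simp
qed

text \<open>Difference quotients of the convexified function increase with the step size; so the local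
  bound by the directional derivative extends to the whole effective domain.\<close>
lemma subdifferential_inequality:
  assumes v: "v \<in> subdifferential (\<lambda>z. f z s) y" and z: "z \<in> edom (\<lambda>y. f y s)"
  shows "v \<bullet> (z - y) \<le> fr z s - fr y s + l / 2 * (norm (z - y))\<^sup>2"
proof -
  have sS: "s \<in> space \<Xi>" using s S0_subset by blast
  have yi: "y \<in> interior (edom (\<lambda>y. f y s))" using U_subset[OF s] y by blast
  show ?thesis
    using order_trans[OF subdifferential_le_dirderiv[OF v, of "z - y"]
        dirderiv_le[OF weakly_convex_shift[OF fr_weakly_convex[OF sS], of y] yi, of "z - y",
          unfolded dirderiv_weakly_convex_eq[OF fr_weakly_convex[OF sS] yi]]] z
    by simp
qed

end

text \<open>Choosing the longest among finitely many measurable selections gives a measurable selection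
  again, to which the moment bound applies.\<close>
primrec hsel :: "nat \<Rightarrow> 'a \<times> 's \<Rightarrow> 'a" where
  "hsel 0 w = V (dense_seq 0) w"
| "hsel (Suc n) w = (if norm (hsel n w) < norm (V (dense_seq (Suc n)) w)
      then V (dense_seq (Suc n)) w else hsel n w)"

text \<open>The values of the selections \<open>V\<close> are enough to dominate all subgradients, see
  \<open>norm_subgradient_le_G2\<close>; being a monotone limit of selections, the bound inherits their second
  moment.\<close>
definition G2 :: "'a \<times> 's \<Rightarrow> ennreal"
  where "G2 w = (SUP n. ennreal ((norm (hsel n w))\<^sup>2))"

lemma hsel_measurable [measurable]: "hsel n \<in> borel_measurable (borel \<Otimes>\<^sub>M \<Xi>)"
proof (induction n)
  case 0
  show ?case using V_measurable by (simp add: measurable_cong[of _ "hsel 0"])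
next
  case (Suc n)
  note [measurable] = Suc V_measurable
  have "(\<lambda>w. if norm (hsel n w) < norm (V (dense_seq (Suc n)) w)
      then V (dense_seq (Suc n)) w else hsel n w) \<in> borel_measurable (borel \<Otimes>\<^sub>M \<Xi>)"
    by measurable
  then show ?case by simp
qed

lemma G2_measurable [measurable]: "G2 \<in> borel_measurable (borel \<Otimes>\<^sub>M \<Xi>)"
  unfolding G2_def by measurable

lemma hsel_subdifferential:
  "s \<in> S0 \<Longrightarrow> y \<in> U \<Longrightarrow> hsel n (y, s) \<in> subdifferential (\<lambda>z. f z s) y"
  by (induction n) (auto intro: V_subdifferential)

lemma hsel_mono: "incseq (\<lambda>n. norm (hsel n w))"
  by (rule incseq_SucI) auto

lemma norm_V_le_hsel: "norm (V (dense_seq n) w) \<le> norm (hsel n w)"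
  by (cases n) auto

lemma G2_bound:
  assumes y: "y \<in> C"
  shows "(\<integral>\<^sup>+s. G2 (y, s) \<partial>\<Xi>) \<le> ennreal (L\<^sup>2)"
proof -
  have meas: "(\<lambda>s. hsel n (y, s)) \<in> borel_measurable \<Xi>" for n by measurable
  have "(\<integral>\<^sup>+s. G2 (y, s) \<partial>\<Xi>) = (SUP n. \<integral>\<^sup>+s. ennreal ((norm (hsel n (y, s)))\<^sup>2) \<partial>\<Xi>)"
    unfolding G2_def
  proof (rule nn_integral_monotone_convergence_SUP)
    show "incseq (\<lambda>n s. ennreal ((norm (hsel n (y, s)))\<^sup>2))"
      using hsel_mono by (auto simp: incseq_def le_fun_def intro!: ennreal_leI power_mono)
  qed (use meas in measurable)
  also have "\<dots> \<le> ennreal (L\<^sup>2)"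
  proof (rule SUP_least)
    fix n
    show "(\<integral>\<^sup>+s. ennreal ((norm (hsel n (y, s)))\<^sup>2) \<partial>\<Xi>) \<le> ennreal (L\<^sup>2)"
    proof (rule subgradient_bound[OF y meas])
      show "AE s in \<Xi>. hsel n (y, s) \<in> subdifferential (\<lambda>z. f z s) y"
        using AE_S0 by eventually_elim (use hsel_subdifferential C_U y in blast)
    qed
  qed
  finally show ?thesis .
qed

text \<open>In each direction \<open>d\<close> every subgradient is dominated by the selection that starts with \<open>d\<close>,
  because this one attains the directional derivative.\<close>
lemma norm_subgradient_le_G2:
  assumes s: "s \<in> S0" and y: "y \<in> U" and v: "v \<in> subdifferential (\<lambda>z. f z s) y"
  shows "ennreal ((norm v)\<^sup>2) \<le> G2 (y, s)"
proof (cases "G2 (y, s)")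
  case (real b)
  have yi: "y \<in> interior (edom (\<lambda>y. f y s))" using U_subset[OF s] y by blast
  have sS: "s \<in> space \<Xi>" using s S0_subset by blast
  have V_le: "norm (V (dense_seq i) (y, s)) \<le> sqrt b" for i
  proof -
    have "ennreal ((norm (hsel i (y, s)))\<^sup>2) \<le> ennreal b"
      unfolding real(2)[symmetric] G2_def by (rule SUP_upper) simp
    then have "norm (hsel i (y, s)) \<le> sqrt b" using real(1) by (simp add: real_le_rsqrt)
    then show ?thesis using norm_V_le_hsel by (meson order_trans)
  qed
  have dense: "v \<bullet> d \<le> sqrt b * norm d" if "d \<in> range dense_seq" for d
  proof -
    obtain i where i: "d = dense_seq i" using \<open>d \<in> range dense_seq\<close> by blast
    have "v \<bullet> d \<le> V d (y, s) \<bullet> d"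
      unfolding V_eq[OF s y] subgrad_inner_same[OF fr_weakly_convex[OF sS] yi]
      by (rule subdifferential_le_dirderiv[OF s y v])
    also have "\<dots> \<le> norm (V d (y, s)) * norm d" by (rule norm_cauchy_schwarz)
    also have "\<dots> \<le> sqrt b * norm d" using V_le i by (intro mult_right_mono) auto
    finally show ?thesis .
  qed
  have "closed {d. v \<bullet> d \<le> sqrt b * norm d}"
    by (intro closed_Collect_le continuous_intros)
  then have "closure (range dense_seq) \<subseteq> {d. v \<bullet> d \<le> sqrt b * norm d}"
    using dense by (intro closure_minimal) auto
  moreover have "v \<in> closure (range dense_seq)"
    unfolding closure_approachable
  proof (intro allI impI)
    fix e :: real assume "0 < e"
    then have "\<exists>i. dense_seq i \<in> ball v e" by (intro dense_seq) auto
    then show "\<exists>z\<in>range dense_seq. dist z v < e" by (auto simp: dist_commute)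
  qed
  ultimately have "v \<bullet> v \<le> sqrt b * norm v" by blast
  then have "norm v * norm v \<le> sqrt b * norm v" by (simp add: norm_eq_square power2_norm_eq_inner[symmetric] power2_eq_square)
  then have "norm v \<le> sqrt b" using real(1) by (cases "v = 0") auto
  then have "(norm v)\<^sup>2 \<le> b" using real(1) by (metis norm_ge_zero power_mono real_sqrt_pow2)
  then show ?thesis using real by (simp add: ennreal_leI)
qed simp

lemma V_moments:
  assumes y: "y \<in> C"
  shows "integrable \<Xi> (\<lambda>s. norm (V d (y, s)))" and "(\<integral>s. norm (V d (y, s)) \<partial>\<Xi>) \<le> L"
proof -
  note [measurable] = V_measurable
  have meas[measurable]: "(\<lambda>s. V d (y, s)) \<in> borel_measurable \<Xi>" by measurable
  have le: "(\<integral>\<^sup>+s. ennreal ((norm (V d (y, s)))\<^sup>2) \<partial>\<Xi>) \<le> ennreal (L\<^sup>2)"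
  proof (rule subgradient_bound[OF y meas])
    show "AE s in \<Xi>. V d (y, s) \<in> subdifferential (\<lambda>z. f z s) y"
      using AE_S0 by eventually_elim (use V_subdifferential C_U y in blast)
  qed
  have sq: "integrable \<Xi> (\<lambda>s. (norm (V d (y, s)))\<^sup>2)"
    using le by (intro integrableI_bounded) (auto simp: order_le_less_trans)
  show int: "integrable \<Xi> (\<lambda>s. norm (V d (y, s)))"
    by (rule Xi.square_integrable_imp_integrable) (use sq in auto)
  have "ennreal (\<integral>s. (norm (V d (y, s)))\<^sup>2 \<partial>\<Xi>) \<le> ennreal (L\<^sup>2)"
    using le sq by (simp add: nn_integral_eq_integral)
  then have "(\<integral>s. (norm (V d (y, s)))\<^sup>2 \<partial>\<Xi>) \<le> L\<^sup>2" by simp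
  moreover have "(\<integral>s. norm (V d (y, s)) \<partial>\<Xi>)\<^sup>2 \<le> (\<integral>s. (norm (V d (y, s)))\<^sup>2 \<partial>\<Xi>)"
    using Xi.variance_eq[OF int sq] Xi.variance_positive[of "\<lambda>s. norm (V d (y, s))"] by simp
  ultimately have "(\<integral>s. norm (V d (y, s)) \<partial>\<Xi>)\<^sup>2 \<le> L\<^sup>2" by linarith
  then show "(\<integral>s. norm (V d (y, s)) \<partial>\<Xi>) \<le> L" using L_nonneg by (rule power2_le_imp_le)
qed

lemma fr_diff_le:
  assumes "s \<in> S0" "y \<in> C" "z \<in> C"
  shows "fr y s - fr z s \<le> norm (V 0 (y, s)) * norm (y - z) + l / 2 * (norm (y - z))\<^sup>2"
proof -
  have "V 0 (y, s) \<bullet> (z - y) \<le> fr z s - fr y s + l / 2 * (norm (z - y))\<^sup>2"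
    using assms C_U by (intro V_inequality) (auto intro: finite_on_U)
  moreover have "- (norm (V 0 (y, s)) * norm (z - y)) \<le> V 0 (y, s) \<bullet> (z - y)"
    using norm_cauchy_schwarz[of "V 0 (y, s)" "y - z"]
    by (simp add: inner_diff_right norm_minus_commute)
  ultimately show ?thesis by (simp add: norm_minus_commute)
qed

lemma Fr_integrable: "y \<in> C \<Longrightarrow> integrable \<Xi> (fr y)"
  and Fr_eq: "y \<in> C \<Longrightarrow> Fr y = (\<integral>s. fr y s \<partial>\<Xi>)"
  using finite_expectation[of y] C_subset interior_subset[of "edom F"] by blast+

text \<open>A subgradient at \<open>y\<close> bounds differences of values up to a quadratic error; taking
  expectations leaves the constant \<open>L\<close> and the same error, which subdivision removes.\<close>
lemma Fr_lipschitz: "L-lipschitz_on C Fr"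
proof (rule lipschitz_onI[OF _ L_nonneg])
  have *: "Fr y - Fr z \<le> L * norm (y - z)" if "y \<in> C" "z \<in> C" for y z
  proof (rule lipschitz_from_quadratic_error[OF convex_C _ that, where c = "l / 2"])
    fix y z assume C: "y \<in> C" "z \<in> C"
    have "Fr y - Fr z = (\<integral>s. fr y s - fr z s \<partial>\<Xi>)"
      using Fr_integrable C by (simp add: Fr_eq)
    also have "\<dots> \<le> (\<integral>s. norm (V 0 (y, s)) * norm (y - z) + l / 2 * (norm (y - z))\<^sup>2 \<partial>\<Xi>)"
      using Fr_integrable C V_moments(1) AE_S0
      by (intro integral_mono_AE) (auto elim!: eventually_mono intro: fr_diff_le[OF _ C, simplified])
    also have "\<dots> = (\<integral>s. norm (V 0 (y, s)) \<partial>\<Xi>) * norm (y - z) + l / 2 * (norm (y - z))\<^sup>2"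
      using V_moments(1)[OF C(1)] by (simp add: Xi.prob_space)
    also have "\<dots> \<le> L * norm (y - z) + l / 2 * (norm (y - z))\<^sup>2"
      using V_moments(2)[OF C(1)] by (intro add_right_mono mult_right_mono) auto
    finally show "Fr y - Fr z \<le> L * norm (y - z) + l / 2 * (norm (y - z))\<^sup>2" .
  qed
  show "dist (Fr y) (Fr z) \<le> L * dist y z" if "y \<in> C" "z \<in> C" for y z
    using *[OF that] *[OF that(2,1)] by (simp add: dist_norm norm_minus_commute abs_le_iff)
qed

lemma Fr_weakly_convex: "convex_on C (\<lambda>y. Fr y + l / 2 * (norm y)\<^sup>2)"
proof (rule convex_onI[OF _ convex_C])
  fix t a b assume t: "0 < t" "t < (1::real)" and ab: "a \<in> C" "b \<in> C"
  define c where "c = (1 - t) *\<^sub>R a + t *\<^sub>R b"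
  have c: "c \<in> C" unfolding c_def using convex_C ab t by (simp add: convex_alt)
  have "Fr c + l / 2 * (norm c)\<^sup>2 = (\<integral>s. fr c s + l / 2 * (norm c)\<^sup>2 \<partial>\<Xi>)"
    using Fr_integrable[OF c] by (simp add: Fr_eq c Xi.prob_space)
  also have "\<dots> \<le> (\<integral>s. (1 - t) * (fr a s + l / 2 * (norm a)\<^sup>2) + t * (fr b s + l / 2 * (norm b)\<^sup>2) \<partial>\<Xi>)"
  proof (rule integral_mono_AE)
    show "AE s in \<Xi>. fr c s + l / 2 * (norm c)\<^sup>2
        \<le> (1 - t) * (fr a s + l / 2 * (norm a)\<^sup>2) + t * (fr b s + l / 2 * (norm b)\<^sup>2)"
      using AE_S0
    proof eventually_elim
      case (elim s)
      then show ?case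
        unfolding c_def using ab t C_U S0_subset
        by (intro convex_onD[OF fr_weakly_convex]) (auto intro: finite_on_U)
    qed
  qed (use Fr_integrable ab c in auto)
  also have "\<dots> = (1 - t) * (Fr a + l / 2 * (norm a)\<^sup>2) + t * (Fr b + l / 2 * (norm b)\<^sup>2)"
    using Fr_integrable ab by (simp add: Fr_eq Xi.prob_space)
  finally show "Fr ((1 - t) *\<^sub>R a + t *\<^sub>R b) + l / 2 * (norm ((1 - t) *\<^sub>R a + t *\<^sub>R b))\<^sup>2
      \<le> (1 - t) * (Fr a + l / 2 * (norm a)\<^sup>2) + t * (Fr b + l / 2 * (norm b)\<^sup>2)"
    unfolding c_def .
qed

end

section \<open>Independence, square integrability, delays\<close>

lemma (in prob_space) independent_rvs_compose:
  assumes ind: "independent_rvs M A X B Y" and h: "h \<in> measurable B B'"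
  shows "independent_rvs M A X B' (\<lambda>w. h (Y w))"
proof -
  have X: "X \<in> measurable M A" and Y: "Y \<in> measurable M B"
    and I: "indep_set (sets (vimage_algebra (space M) X A)) (sets (vimage_algebra (space M) Y B))"
    using ind by (auto simp: independent_rvs_def)
  have "sets (vimage_algebra (space M) (\<lambda>w. h (Y w)) B') \<subseteq> sets (vimage_algebra (space M) Y B)"
  proof
    fix E assume "E \<in> sets (vimage_algebra (space M) (\<lambda>w. h (Y w)) B')"
    then obtain b where b: "b \<in> sets B'" "E = (\<lambda>w. h (Y w)) -` b \<inter> space M"
      using measurable_space[OF measurable_compose[OF Y h]] by (subst (asm) sets_vimage_algebra2) auto
    have "E = Y -` (h -` b \<inter> space B) \<inter> space M"
      using b(2) measurable_space[OF Y] by auto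
    then show "E \<in> sets (vimage_algebra (space M) Y B)"
      using in_vimage_algebra[OF measurable_sets[OF h b(1)]] by simp
  qed
  note sub = this
  have "indep_set (sets (vimage_algebra (space M) X A)) (sets (vimage_algebra (space M) (\<lambda>w. h (Y w)) B'))"
    unfolding indep_set_def
    by (rule indep_sets_mono_sets[OF I[unfolded indep_set_def]]) (use sub in \<open>simp split: bool.split\<close>)
  then show ?thesis using X measurable_compose[OF Y h] by (auto simp: independent_rvs_def)
qed

lemma (in prob_space) independent_rvs_pair_distr:
  assumes ind: "independent_rvs M A X B Y"
  shows "distr M (A \<Otimes>\<^sub>M B) (\<lambda>w. (X w, Y w)) = distr M A X \<Otimes>\<^sub>M distr M B Y"
proof (rule sym, rule pair_measure_eqI)
  have X[measurable]: "X \<in> measurable M A" and Y[measurable]: "Y \<in> measurable M B"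
    and I: "indep_set (sets (vimage_algebra (space M) X A)) (sets (vimage_algebra (space M) Y B))"
    using ind by (auto simp: independent_rvs_def)
  show "sigma_finite_measure (distr M A X)" "sigma_finite_measure (distr M B Y)"
    using prob_space_distr[OF X] prob_space_distr[OF Y] by (auto intro: prob_space_imp_sigma_finite)
  show "sets (distr M A X \<Otimes>\<^sub>M distr M B Y) = sets (distr M (A \<Otimes>\<^sub>M B) (\<lambda>w. (X w, Y w)))"
    by simp
  fix a b assume ab: "a \<in> sets (distr M A X)" "b \<in> sets (distr M B Y)"
  have "prob ((X -` a \<inter> space M) \<inter> (Y -` b \<inter> space M)) = prob (X -` a \<inter> space M) * prob (Y -` b \<inter> space M)"
    using ab by (intro indep_setD[OF I] in_vimage_algebra) auto
  moreover have "(\<lambda>w. (X w, Y w)) -` (a \<times> b) \<inter> space M = (X -` a \<inter> space M) \<inter> (Y -` b \<inter> space M)"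
    by auto
  ultimately show "emeasure (distr M A X) a * emeasure (distr M B Y) b
      = emeasure (distr M (A \<Otimes>\<^sub>M B) (\<lambda>w. (X w, Y w))) (a \<times> b)"
    using ab by (simp add: emeasure_distr emeasure_eq_measure ennreal_mult measure_nonneg)
qed

context prob_space
begin

lemma independent_nn_integral:
  assumes ind: "independent_rvs M A X B Y" and dist: "distr M A X = A" and A: "prob_space A"
    and H: "H \<in> borel_measurable (A \<Otimes>\<^sub>M B)"
  shows "(\<integral>\<^sup>+w. H (X w, Y w) \<partial>M) = (\<integral>\<^sup>+w. (\<integral>\<^sup>+s. H (s, Y w) \<partial>A) \<partial>M)"
proof -
  have X[measurable]: "X \<in> measurable M A" and Y[measurable]: "Y \<in> measurable M B"
    using ind by (auto simp: independent_rvs_def)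
  note [measurable] = H
  interpret A: prob_space A by (rule A)
  interpret B: prob_space "distr M B Y" by (rule prob_space_distr[OF Y])
  interpret P: pair_prob_space A "distr M B Y" ..
  have H': "H \<in> borel_measurable (A \<Otimes>\<^sub>M distr M B Y)" using H by simp
  have "(\<integral>\<^sup>+w. H (X w, Y w) \<partial>M) = (\<integral>\<^sup>+v. H v \<partial>distr M (A \<Otimes>\<^sub>M B) (\<lambda>w. (X w, Y w)))"
    using H by (simp add: nn_integral_distr)
  also have "\<dots> = (\<integral>\<^sup>+v. H v \<partial>(A \<Otimes>\<^sub>M distr M B Y))"
    unfolding independent_rvs_pair_distr[OF ind] dist ..
  also have "\<dots> = (\<integral>\<^sup>+y. (\<integral>\<^sup>+s. H (s, y) \<partial>A) \<partial>distr M B Y)"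
    using P.nn_integral_snd[OF H'] by simp
  also have "\<dots> = (\<integral>\<^sup>+w. (\<integral>\<^sup>+s. H (s, Y w) \<partial>A) \<partial>M)"
    by (intro nn_integral_distr) measurable
  finally show ?thesis .
qed

lemma independent_integral:
  fixes H :: "_ \<Rightarrow> real"
  assumes ind: "independent_rvs M A X B Y" and dist: "distr M A X = A" and A: "prob_space A"
    and H: "H \<in> borel_measurable (A \<Otimes>\<^sub>M B)" and int: "integrable M (\<lambda>w. H (X w, Y w))"
  shows "(\<integral>w. H (X w, Y w) \<partial>M) = (\<integral>w. (\<integral>s. H (s, Y w) \<partial>A) \<partial>M)"
proof -
  have X[measurable]: "X \<in> measurable M A" and Y[measurable]: "Y \<in> measurable M B"
    using ind by (auto simp: independent_rvs_def)
  note [measurable] = H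
  interpret A: prob_space A by (rule A)
  interpret B: prob_space "distr M B Y" by (rule prob_space_distr[OF Y])
  interpret P: pair_prob_space A "distr M B Y" ..
  have eq: "distr M (A \<Otimes>\<^sub>M B) (\<lambda>w. (X w, Y w)) = A \<Otimes>\<^sub>M distr M B Y"
    unfolding independent_rvs_pair_distr[OF ind] dist ..
  have "integrable (distr M (A \<Otimes>\<^sub>M B) (\<lambda>w. (X w, Y w))) H"
    using H int by (simp add: integrable_distr_eq)
  then have int': "integrable (A \<Otimes>\<^sub>M distr M B Y) (case_prod (\<lambda>s y. H (s, y)))"
    unfolding eq by simp
  have "(\<integral>w. H (X w, Y w) \<partial>M) = (\<integral>v. H v \<partial>distr M (A \<Otimes>\<^sub>M B) (\<lambda>w. (X w, Y w)))"
    using H by (simp add: integral_distr)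
  also have "\<dots> = (\<integral>y. (\<integral>s. H (s, y) \<partial>A) \<partial>distr M B Y)"
    unfolding eq using P.integral_snd[OF int'] by simp
  also have "\<dots> = (\<integral>w. (\<integral>s. H (s, Y w) \<partial>A) \<partial>M)"
    by (intro integral_distr) measurable
  finally show ?thesis .
qed

definition sqint :: "('a \<Rightarrow> 'b::euclidean_space) \<Rightarrow> bool"
  where "sqint X \<longleftrightarrow> X \<in> borel_measurable M \<and> integrable M (\<lambda>w. (norm (X w))\<^sup>2)"

lemma sqint_integrable: "sqint X \<Longrightarrow> integrable M (\<lambda>w. (norm (X w))\<^sup>2)"
  by (auto simp: sqint_def)

lemma sqint_const: "sqint (\<lambda>_. c)"
  by (simp add: sqint_def)

lemma sqint_bound:
  fixes Y :: "'a \<Rightarrow> 'b::euclidean_space"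
  assumes Y: "Y \<in> borel_measurable M" and X: "sqint X"
    and le: "AE w in M. norm (Y w) \<le> a + b * norm (X w)"
  shows "sqint Y"
  unfolding sqint_def
proof
  show "integrable M (\<lambda>w. (norm (Y w))\<^sup>2)"
  proof (rule Bochner_Integration.integrable_bound)
    show "integrable M (\<lambda>w. 2 * a\<^sup>2 + 2 * b\<^sup>2 * (norm (X w))\<^sup>2)"
      using sqint_integrable[OF X] by simp
    show "AE w in M. norm ((norm (Y w))\<^sup>2) \<le> norm (2 * a\<^sup>2 + 2 * b\<^sup>2 * (norm (X w))\<^sup>2)"
      using le
    proof eventually_elim
      case (elim w)
      have "(norm (Y w))\<^sup>2 \<le> (a + b * norm (X w))\<^sup>2" using elim by (intro power_mono) auto
      also have "\<dots> \<le> 2 * a\<^sup>2 + 2 * (b * norm (X w))\<^sup>2"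
        using sum_squares_bound[of a "b * norm (X w)"] by (simp add: power2_sum)
      finally show ?case by (simp add: power_mult_distrib)
    qed
  qed (use Y in measurable)
qed (rule Y)

lemma sqint_norm: "sqint X \<Longrightarrow> sqint (\<lambda>w. norm (X w))"
  by (auto simp: sqint_def)

lemma sqint_add:
  assumes "sqint X" "sqint Y"
  shows "sqint (\<lambda>w. X w + Y w)"
  unfolding sqint_def
proof
  show meas: "(\<lambda>w. X w + Y w) \<in> borel_measurable M"
    using assms by (auto simp: sqint_def)
  show "integrable M (\<lambda>w. (norm (X w + Y w))\<^sup>2)"
  proof (rule Bochner_Integration.integrable_bound)
    show "integrable M (\<lambda>w. 2 * (norm (X w))\<^sup>2 + 2 * (norm (Y w))\<^sup>2)"
      using assms by (simp add: sqint_integrable)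
    have "(norm (X w + Y w))\<^sup>2 \<le> 2 * (norm (X w))\<^sup>2 + 2 * (norm (Y w))\<^sup>2" for w
    proof -
      have "(norm (X w + Y w))\<^sup>2 \<le> (norm (X w) + norm (Y w))\<^sup>2"
        by (intro power_mono norm_triangle_ineq) auto
      then show ?thesis
        using sum_squares_bound[of "norm (X w)" "norm (Y w)"] by (simp add: power2_sum)
    qed
    then show "AE w in M. norm ((norm (X w + Y w))\<^sup>2) \<le> norm (2 * (norm (X w))\<^sup>2 + 2 * (norm (Y w))\<^sup>2)"
      by simp
  qed (use meas in measurable)
qed

lemma sqint_diff: "sqint X \<Longrightarrow> sqint Y \<Longrightarrow> sqint (\<lambda>w. X w - Y w)"
  using sqint_add[of X "\<lambda>w. - Y w"] by (simp add: sqint_def)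

lemma sqint_integrable_mult:
  fixes X Y :: "'a \<Rightarrow> real"
  assumes "sqint X" "sqint Y"
  shows "integrable M (\<lambda>w. X w * Y w)"
proof (rule Bochner_Integration.integrable_bound)
  show "integrable M (\<lambda>w. (norm (X w))\<^sup>2 + (norm (Y w))\<^sup>2)"
    using assms by (simp add: sqint_def)
  show "(\<lambda>w. X w * Y w) \<in> borel_measurable M" using assms by (auto simp: sqint_def)
  have "\<bar>X w * Y w\<bar> \<le> (X w)\<^sup>2 + (Y w)\<^sup>2" for w
  proof -
    have "0 \<le> \<bar>X w\<bar> * \<bar>Y w\<bar>" by simp
    then show ?thesis
      using sum_squares_bound[of "\<bar>X w\<bar>" "\<bar>Y w\<bar>"] unfolding abs_mult power2_abs by linarith
  qed
  then show "AE w in M. norm (X w * Y w) \<le> norm ((norm (X w))\<^sup>2 + (norm (Y w))\<^sup>2)" by simp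
qed

lemma sqint_integrable_real: "sqint X \<Longrightarrow> integrable M (X :: 'a \<Rightarrow> real)"
  using sqint_integrable_mult[of X "\<lambda>_. 1"] sqint_const by auto

lemma integral_square_le: "sqint X \<Longrightarrow> (\<integral>w. X w \<partial>M)\<^sup>2 \<le> (\<integral>w. (X w)\<^sup>2 \<partial>M)" for X :: "'a \<Rightarrow> real"
proof -
  assume X: "sqint X"
  have "variance X = (\<integral>w. (X w)\<^sup>2 \<partial>M) - (\<integral>w. X w \<partial>M)\<^sup>2"
    using sqint_integrable_real[OF X] sqint_integrable[OF X] by (intro variance_eq) auto
  moreover have "0 \<le> variance X" by (rule variance_positive)
  ultimately show ?thesis by linarith
qed

end

lemma delay_counter_le: "delay_counter sched n j \<le> n"
  by (induction n) auto

lemma delay_less: "k \<ge> 1 \<Longrightarrow> delay sched k < k"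
  using delay_counter_le[of sched "k - 1" "sched k"] unfolding delay_def by linarith

text \<open>Each iteration raises every counter by one and then discards the counter of the worker in
  use, which is the delay of this iteration; so all delays together are paid for by the
  \<open>m\<close> increments per iteration.\<close>
lemma sum_delay_le:
  assumes "\<And>k. k \<in> {1..n} \<Longrightarrow> sched k \<in> {1..m}"
  shows "(\<Sum>k=1..n. delay sched k) + (\<Sum>j=1..m. delay_counter sched n j) \<le> m * n"
  using assms
proof (induction n)
  case (Suc n)
  let ?s = "sched (Suc n)"
  have s: "?s \<in> {1..m}" using Suc.prems by simp
  have "(\<Sum>j=1..m. delay_counter sched (Suc n) j)
      = (\<Sum>j\<in>{1..m} - {?s}. delay_counter sched n j + 1)"
    using s by (subst sum.remove[of _ ?s]) (auto intro!: sum.cong)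
  moreover have "(\<Sum>j=1..m. delay_counter sched n j + 1)
      = delay_counter sched n ?s + 1 + (\<Sum>j\<in>{1..m} - {?s}. delay_counter sched n j + 1)"
    using s by (subst sum.remove[of _ ?s]) auto
  moreover have "(\<Sum>j=1..m. delay_counter sched n j + 1) = (\<Sum>j=1..m. delay_counter sched n j) + m"
    by (simp only: sum.distrib) simp
  moreover have "(\<Sum>k=1..n. delay sched k) + (\<Sum>j=1..m. delay_counter sched n j) \<le> m * n"
    using Suc by simp
  moreover have "delay sched (Suc n) = delay_counter sched n ?s" by (simp add: delay_def)
  ultimately show ?case by simp
qed simp

section \<open>The delayed method\<close>

text \<open>The setting in terms of real-valued functions on \<open>C\<close>, the effective domain of the regulariser
  \<open>\<omega>r\<close>.  The set \<open>used\<close> contains the iterations with a delay below the threshold.  The constant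
  \<open>c\<close> is what remains of the step parameter \<open>\<gamma>\<close> after the curvature constants; steps have length
  of order \<open>1 / c\<close>.\<close>
locale delayed_sgd = stochastic_weakly_convex f F \<Xi> C l L\<^sub>f + M: prob_space M
  for f :: "'a::euclidean_space \<Rightarrow> 's \<Rightarrow> ereal" and F :: "'a \<Rightarrow> ereal" and \<Xi> :: "'s measure"
    and C :: "'a set" and l L\<^sub>f :: real and M :: "'w measure" +
  fixes \<omega>r :: "'a \<Rightarrow> real" and L\<^sub>\<omega> \<kappa> \<rho> \<gamma> c :: real
    and K :: nat and used :: "nat set" and \<tau> :: "nat \<Rightarrow> nat"
    and \<xi> :: "nat \<Rightarrow> 'w \<Rightarrow> 's" and g x :: "nat \<Rightarrow> 'w \<Rightarrow> 'a" and x1 :: 'a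
  assumes closed_C: "closed C" and \<omega>_lipschitz: "L\<^sub>\<omega>-lipschitz_on C \<omega>r"
    and \<omega>_weakly_convex: "convex_on C (\<lambda>y. \<omega>r y + \<kappa> / 2 * (norm y)\<^sup>2)"
    and \<kappa>_nonneg: "0 \<le> \<kappa>" and \<rho>: "2 * l + \<kappa> < \<rho>" and \<gamma>: "\<gamma> = c + \<rho> + \<kappa> + 4 * l" and c_pos: "0 < c"
    and K: "1 \<le> K" and used: "used \<subseteq> {1..K}"
    and x1: "x1 \<in> C" and x_1: "\<And>w. w \<in> space M \<Longrightarrow> x 1 w = x1"
    and delay: "\<And>k. k \<in> {1..K} \<Longrightarrow> \<tau> k < k"
    and g_measurable: "\<And>k. k \<in> used \<Longrightarrow> g k \<in> borel_measurable M"
    and g_subgradient: "\<And>k. k \<in> used \<Longrightarrow>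
      AE w in M. g k w \<in> subdifferential (\<lambda>y. f y (\<xi> k w)) (x (k - \<tau> k) w)"
    and step: "\<And>k w. k \<in> used \<Longrightarrow> w \<in> space M \<Longrightarrow>
      weakly_convex_lipschitz.is_prox C \<omega>r \<gamma> (x k w - (1 / \<gamma>) *\<^sub>R g k w) (x (k + 1) w)"
    and skip: "\<And>k w. k \<in> {1..K} \<Longrightarrow> k \<notin> used \<Longrightarrow> w \<in> space M \<Longrightarrow> x (k + 1) w = x k w"
    and sample_distr: "\<And>k. k \<in> {1..K} \<Longrightarrow> distr M \<Xi> (\<xi> k) = \<Xi>"
    and sample_indep: "\<And>k. k \<in> {1..K} \<Longrightarrow>
      independent_rvs M \<Xi> (\<xi> k) (\<Pi>\<^sub>M i\<in>{1..k}. borel) (\<lambda>w. \<lambda>i\<in>{1..k}. x i w)"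
begin

abbreviation \<phi> :: "'a \<Rightarrow> real" where "\<phi> y \<equiv> Fr y + \<omega>r y"

abbreviation Lg :: real where "Lg \<equiv> L\<^sub>f + L\<^sub>\<omega>"

lemma L\<^sub>\<omega>_nonneg: "0 \<le> L\<^sub>\<omega>"
  using \<omega>_lipschitz lipschitz_on_nonneg by blast

sublocale psi: weakly_convex_lipschitz C \<phi> Lg "l + \<kappa>" \<rho>
proof
  show "Lg-lipschitz_on C \<phi>"
    using lipschitz_on_add[OF Fr_lipschitz \<omega>_lipschitz] by simp
  have "convex_on C (\<lambda>y. (Fr y + l / 2 * (norm y)\<^sup>2) + (\<omega>r y + \<kappa> / 2 * (norm y)\<^sup>2))"
    by (rule convex_on_add[OF Fr_weakly_convex \<omega>_weakly_convex])
  then show "convex_on C (\<lambda>y. \<phi> y + (l + \<kappa>) / 2 * (norm y)\<^sup>2)"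
    by (simp add: algebra_simps add_divide_distrib)
qed (use closed_C x1 \<kappa>_nonneg l_nonneg \<rho> in auto)

sublocale om: weakly_convex_lipschitz C \<omega>r L\<^sub>\<omega> \<kappa> \<gamma>
  by standard (use closed_C x1 \<kappa>_nonneg l_nonneg \<rho> \<gamma> c_pos \<omega>_lipschitz \<omega>_weakly_convex in auto)

lemma \<gamma>_pos: "0 < \<gamma>" using \<gamma> c_pos \<rho> \<kappa>_nonneg l_nonneg by linarith

lemma x_in_C: "k \<in> {1..K + 1} \<Longrightarrow> w \<in> space M \<Longrightarrow> x k w \<in> C"
proof (induction k)
  case (Suc k)
  show ?case
  proof (cases "k = 0")
    case True
    then show ?thesis using x_1 x1 Suc.prems by simp
  next
    case False
    then have k: "k \<in> {1..K}" using Suc.prems by auto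
    show ?thesis
    proof (cases "k \<in> used")
      case True
      then show ?thesis using step[of k w] Suc.prems om.is_prox_def by simp
    next
      case False
      then show ?thesis using skip[of k w] k Suc by simp
    qed
  qed
qed simp

lemma past_measurable:
  assumes "k \<in> {1..K}" "i \<in> {1..k}"
  shows "x i \<in> borel_measurable M"
proof -
  have "(\<lambda>w. \<lambda>i\<in>{1..k}. x i w) \<in> measurable M (\<Pi>\<^sub>M i\<in>{1..k}. borel)"
    using sample_indep[OF assms(1)] by (simp add: independent_rvs_def)
  then have "(\<lambda>w. (\<lambda>i\<in>{1..k}. x i w) i) \<in> borel_measurable M"
    using assms(2) by (rule measurable_compose[OF _ measurable_component_singleton])
  then show ?thesis using assms(2) by simp
qed

text \<open>The last iterate is not part of the past of any sample; it is measurable because the proximal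
  map of the regulariser is continuous.\<close>
lemma x_measurable:
  assumes "k \<in> {1..K + 1}"
  shows "x k \<in> borel_measurable M"
proof (cases "k \<le> K")
  case True
  then show ?thesis using past_measurable[of k k] assms by simp
next
  case False
  then have k: "k = K + 1" using assms by simp
  have K': "K \<in> {1..K}" using K by simp
  note xK = past_measurable[OF K' K']
  show ?thesis
  proof (cases "K \<in> used")
    case True
    have [measurable]: "om.prox \<in> borel_measurable borel"
      by (rule borel_measurable_continuous_onI[OF om.continuous_on_prox])
    note [measurable] = xK g_measurable[OF True]
    have "(\<lambda>w. om.prox (x K w - (1 / \<gamma>) *\<^sub>R g K w)) \<in> borel_measurable M" by measurable
    moreover have "x k w = om.prox (x K w - (1 / \<gamma>) *\<^sub>R g K w)" if "w \<in> space M" for w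
      using om.is_prox_unique[OF step[OF True that]] k by simp
    ultimately show ?thesis by (simp cong: measurable_cong)
  next
    case False
    then have "x k w = x K w" if "w \<in> space M" for w using skip[OF K' False that] k by simp
    then show ?thesis using xK by (simp cong: measurable_cong)
  qed
qed

lemma sample_measurable: "k \<in> {1..K} \<Longrightarrow> \<xi> k \<in> measurable M \<Xi>"
  using sample_indep by (simp add: independent_rvs_def)

lemma AE_sample_S0:
  assumes "k \<in> {1..K}"
  shows "AE w in M. \<xi> k w \<in> S0"
proof -
  have "AE s in distr M \<Xi> (\<xi> k). s \<in> S0" unfolding sample_distr[OF assms] by (rule AE_S0)
  then show ?thesis using S0_sets by (simp add: AE_distr_iff[OF sample_measurable[OF assms]])
qed

definition x' :: "nat \<Rightarrow> 'w \<Rightarrow> 'a" where "x' k = x (k - \<tau> k)"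

definition \<Delta> :: "nat \<Rightarrow> 'w \<Rightarrow> real" where "\<Delta> k w = norm (x k w - x' k w)"

definition d :: "nat \<Rightarrow> 'w \<Rightarrow> 'a" where "d k w = x (k + 1) w - x k w"

definition xh :: "nat \<Rightarrow> 'w \<Rightarrow> 'a" where "xh k w = psi.prox (x k w)"

lemma delayed_index: "k \<in> {1..K} \<Longrightarrow> k - \<tau> k \<in> {1..k}"
  using delay[of k] by auto

lemma x'_in_C: "k \<in> {1..K} \<Longrightarrow> w \<in> space M \<Longrightarrow> x' k w \<in> C"
  unfolding x'_def using delayed_index[of k] by (intro x_in_C) auto

lemma sample_indep_pair:
  assumes k: "k \<in> {1..K}"
  shows "independent_rvs M \<Xi> (\<xi> k) (borel \<Otimes>\<^sub>M borel) (\<lambda>w. (x k w, x' k w))"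
proof -
  let ?h = "\<lambda>v :: nat \<Rightarrow> 'a. (v k, v (k - \<tau> k))"
  have i: "k \<in> {1..k}" "k - \<tau> k \<in> {1..k}" using k delayed_index[OF k] by auto
  have "?h \<in> measurable (\<Pi>\<^sub>M i\<in>{1..k}. borel) (borel \<Otimes>\<^sub>M borel)"
    using i by (intro measurable_Pair measurable_component_singleton)
  from M.independent_rvs_compose[OF sample_indep[OF k] this]
  show ?thesis using i by (simp add: x'_def)
qed

lemma x'_measurable: "k \<in> {1..K} \<Longrightarrow> x' k \<in> borel_measurable M"
  unfolding x'_def using delayed_index by (intro past_measurable)

lemma prox_measurable [measurable]: "psi.prox \<in> borel_measurable borel"
  by (rule borel_measurable_continuous_onI[OF psi.continuous_on_prox])

lemma xh_measurable: "k \<in> {1..K} \<Longrightarrow> xh k \<in> borel_measurable M"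
  unfolding xh_def by (rule measurable_compose[OF x_measurable prox_measurable]) simp

lemma prox_step:
  assumes k: "k \<in> used" and w: "w \<in> space M" and y: "y \<in> C"
  shows "\<omega>r (x (k + 1) w) + g k w \<bullet> d k w + \<gamma> / 2 * (norm (d k w))\<^sup>2
      + (\<gamma> - \<kappa>) / 2 * (norm (y - x (k + 1) w))\<^sup>2
    \<le> \<omega>r y + g k w \<bullet> (y - x k w) + \<gamma> / 2 * (norm (y - x k w))\<^sup>2"
proof -
  note ex = complete_square_linear_term[OF \<gamma>_pos, of "x k w" "g k w"]
  show ?thesis
    using om.is_prox_growth[OF step[OF k w] y] unfolding ex d_def by simp
qed

text \<open>Test the subproblem at the current iterate: the quadratic decrease is paid for by the linear
  term and by the variation of the regulariser.\<close>
lemma norm_d_le: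
  assumes k: "k \<in> used" and w: "w \<in> space M"
  shows "norm (d k w) \<le> (norm (g k w) + L\<^sub>\<omega>) / c"
proof -
  have kK: "k \<in> {1..K}" using k used by blast
  have C: "x k w \<in> C" "x (k + 1) w \<in> C" using x_in_C kK w by auto
  have "\<omega>r (x k w) \<le> \<omega>r (x (k + 1) w) + L\<^sub>\<omega> * norm (d k w)"
    using om.phi_le[OF C] by (simp add: d_def norm_minus_commute)
  moreover have "\<omega>r (x (k + 1) w) + g k w \<bullet> d k w + \<gamma> / 2 * (norm (d k w))\<^sup>2
      + (\<gamma> - \<kappa>) / 2 * (norm (d k w))\<^sup>2 \<le> \<omega>r (x k w)"
    using prox_step[OF k w C(1)] by (simp add: d_def norm_minus_commute)
  moreover have "- (g k w \<bullet> d k w) \<le> norm (g k w) * norm (d k w)"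
    using norm_cauchy_schwarz[of "- g k w" "d k w"] by simp
  moreover have "\<gamma> / 2 * (norm (d k w))\<^sup>2 + (\<gamma> - \<kappa>) / 2 * (norm (d k w))\<^sup>2
      = (\<gamma> - \<kappa> / 2) * (norm (d k w))\<^sup>2" by (simp add: field_simps)
  ultimately have "(\<gamma> - \<kappa> / 2) * (norm (d k w))\<^sup>2 \<le> (norm (g k w) + L\<^sub>\<omega>) * norm (d k w)"
    by (simp add: algebra_simps)
  moreover have "c * (norm (d k w))\<^sup>2 \<le> (\<gamma> - \<kappa> / 2) * (norm (d k w))\<^sup>2"
    using \<gamma> \<kappa>_nonneg l_nonneg \<rho> by (intro mult_right_mono) auto
  ultimately have "norm (d k w) * (c * norm (d k w)) \<le> norm (d k w) * (norm (g k w) + L\<^sub>\<omega>)"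
    by (simp add: algebra_simps power2_eq_square)
  then have "c * norm (d k w) \<le> norm (g k w) + L\<^sub>\<omega>"
  proof (cases "d k w = 0")
    case True
    then show ?thesis using L\<^sub>\<omega>_nonneg by simp
  next
    case False
    then show ?thesis
      using mult_left_le_imp_le[of "norm (d k w)"] \<open>norm (d k w) * _ \<le> _\<close> by simp
  qed
  then show ?thesis
    using c_pos by (simp add: pos_le_divide_eq mult.commute)
qed

lemma d_skip: "k \<in> {1..K} \<Longrightarrow> k \<notin> used \<Longrightarrow> w \<in> space M \<Longrightarrow> d k w = 0"
  using skip by (simp add: d_def)

text \<open>The sampling error.  On \<open>S0\<close> the function \<open>fU\<close> agrees with \<open>f\<close>; using it makes the error
  measurable.\<close>
definition \<delta> :: "nat \<Rightarrow> 'w \<Rightarrow> real"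
  where "\<delta> k w = (fU (xh k w, \<xi> k w) - fU (x' k w, \<xi> k w)) - (Fr (xh k w) - Fr (x' k w))"

text \<open>Twice the factor of the squared distance from the new iterate to the proximal point of the old
  one, after the two strong convexity inequalities have been added.\<close>
definition A :: real where "A = \<gamma> + \<rho> - l - 2 * \<kappa>"

text \<open>Apart from the sampling error \<open>\<delta>\<close>, which has mean zero, everything that separates the
  stochastic proximal step from a proximal step on \<open>\<psi>\<close> is at most of the order of the
  displacements \<open>d\<close> and \<open>\<Delta>\<close>.  The subgradient inequality is applied at the delayed iterate, and
  the values of \<open>F\<close> there and at the new iterate are compared by Lipschitz continuity of \<open>F\<close>
  alone: comparing at the new iterate instead of the current one keeps \<open>L\<^sub>\<omega>\<close> out of the factor
  in front of \<open>norm d\<close>.\<close>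
lemma descent:
  assumes k: "k \<in> used" and w: "w \<in> space M" and s: "\<xi> k w \<in> S0"
    and g: "g k w \<in> subdifferential (\<lambda>y. f y (\<xi> k w)) (x' k w)"
  shows "(\<rho> - 2 * l - \<kappa>) * \<rho> * (norm (x k w - xh k w))\<^sup>2
    \<le> A * (psi.env (x k w) - psi.env (x (k + 1) w))
      + \<rho> * (\<delta> k w + (norm (g k w) + L\<^sub>f) * norm (d k w) + (norm (g k w) + L\<^sub>f) * \<Delta> k w + l * (\<Delta> k w)\<^sup>2)"
proof -
  have kK: "k \<in> {1..K}" using k used by blast
  have C: "x k w \<in> C" "x (k + 1) w \<in> C" "x' k w \<in> C" "xh k w \<in> C"
    using x_in_C kK w x'_in_C psi.prox_in by (auto simp: xh_def)
  define a b where "a = (norm (x k w - xh k w))\<^sup>2" and "b = (norm (x (k + 1) w - xh k w))\<^sup>2"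
  define R where "R = \<delta> k w + (norm (g k w) + L\<^sub>f) * norm (d k w) + (norm (g k w) + L\<^sub>f) * \<Delta> k w + l * (\<Delta> k w)\<^sup>2"
  have 1: "\<omega>r (x (k + 1) w) + g k w \<bullet> d k w + \<gamma> / 2 * (norm (d k w))\<^sup>2 + (\<gamma> - \<kappa>) / 2 * b
      \<le> \<omega>r (xh k w) + g k w \<bullet> (xh k w - x k w) + \<gamma> / 2 * a"
    using prox_step[OF k w C(4)] unfolding a_def b_def by (simp add: norm_minus_commute)
  have 2: "g k w \<bullet> (xh k w - x' k w) \<le> fr (xh k w) (\<xi> k w) - fr (x' k w) (\<xi> k w) + l / 2 * (norm (xh k w - x' k w))\<^sup>2"
    using C C_U by (intro subdifferential_inequality[OF s _ g] finite_on_U[OF s]) auto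
  have 3: "g k w \<bullet> (xh k w - x k w) = g k w \<bullet> (xh k w - x' k w) + g k w \<bullet> (x' k w - x k w)"
    by (simp add: inner_diff_right)
  have 4: "g k w \<bullet> (x' k w - x k w) \<le> norm (g k w) * \<Delta> k w"
    using norm_cauchy_schwarz[of "g k w" "x' k w - x k w"] by (simp add: \<Delta>_def norm_minus_commute)
  have 5: "l / 2 * (norm (xh k w - x' k w))\<^sup>2 \<le> l * a + l * (\<Delta> k w)\<^sup>2"
  proof -
    have "norm (xh k w - x' k w) \<le> norm (x k w - xh k w) + \<Delta> k w"
      unfolding \<Delta>_def using norm_triangle_ineq[of "xh k w - x k w" "x k w - x' k w"]
      by (simp add: norm_minus_commute)
    then have "(norm (xh k w - x' k w))\<^sup>2 \<le> (norm (x k w - xh k w) + \<Delta> k w)\<^sup>2"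
      by (intro power_mono) auto
    also have "\<dots> \<le> 2 * a + 2 * (\<Delta> k w)\<^sup>2"
      using sum_squares_bound[of "norm (x k w - xh k w)" "\<Delta> k w"] unfolding a_def
      by (simp add: power2_sum)
    finally have "l / 2 * (norm (xh k w - x' k w))\<^sup>2 \<le> l / 2 * (2 * a + 2 * (\<Delta> k w)\<^sup>2)"
      using l_nonneg by (intro mult_left_mono) auto
    then show ?thesis by (simp add: algebra_simps)
  qed
  have 6: "Fr (x (k + 1) w) - Fr (x' k w) \<le> L\<^sub>f * norm (d k w) + L\<^sub>f * \<Delta> k w"
  proof -
    have "Fr (x (k + 1) w) - Fr (x' k w) \<le> L\<^sub>f * norm (x (k + 1) w - x' k w)"
      using lipschitz_onD[OF Fr_lipschitz C(2,3)] by (simp add: dist_norm dist_real_def)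
    also have "\<dots> \<le> L\<^sub>f * (norm (d k w) + \<Delta> k w)"
      unfolding \<Delta>_def d_def
      using norm_triangle_ineq[of "x (k + 1) w - x k w" "x k w - x' k w"] L_nonneg
      by (intro mult_left_mono) auto
    finally show ?thesis by (simp add: distrib_left)
  qed
  have 7: "\<phi> (xh k w) + \<rho> / 2 * a + (\<rho> - (l + \<kappa>)) / 2 * b \<le> \<phi> (x (k + 1) w) + \<rho> / 2 * (norm (d k w))\<^sup>2"
    using psi.prox_growth[OF C(2), of "x k w"] unfolding a_def b_def xh_def d_def
    by (simp add: norm_minus_commute)
  have 8: "- (g k w \<bullet> d k w) \<le> norm (g k w) * norm (d k w)"
    using norm_cauchy_schwarz[of "- g k w" "d k w"] by simp
  have 9: "\<rho> / 2 * (norm (d k w))\<^sup>2 \<le> \<gamma> / 2 * (norm (d k w))\<^sup>2"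
    using \<gamma> c_pos \<kappa>_nonneg l_nonneg by (intro mult_right_mono) auto
  have 10: "\<delta> k w = (fr (xh k w) (\<xi> k w) - fr (x' k w) (\<xi> k w)) - (Fr (xh k w) - Fr (x' k w))"
    using C(3,4) C_U s unfolding \<delta>_def fU_def by auto
  have main: "A / 2 * b \<le> (\<gamma> + 2 * l - \<rho>) / 2 * a + R"
  proof -
    have "(\<gamma> - \<kappa>) / 2 * b + (\<rho> - (l + \<kappa>)) / 2 * b \<le> \<gamma> / 2 * a + l * a - \<rho> / 2 * a + R"
      unfolding R_def 10 distrib_right
      using 1 2 3 4 5 6 7 8 9 by linarith
    moreover have "(\<gamma> - \<kappa>) / 2 * b + (\<rho> - (l + \<kappa>)) / 2 * b = A / 2 * b"
      by (simp add: A_def field_simps)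
    moreover have "\<gamma> / 2 * a + l * a - \<rho> / 2 * a = (\<gamma> + 2 * l - \<rho>) / 2 * a" by (simp add: field_simps)
    ultimately show ?thesis by simp
  qed
  have rho: "\<rho> > 0" using \<rho> \<kappa>_nonneg l_nonneg by linarith
  have A: "A \<ge> 0" unfolding A_def using \<gamma> \<rho> \<kappa>_nonneg l_nonneg c_pos by linarith
  have "A * (psi.env (x (k + 1) w) - psi.env (x k w)) \<le> A * (\<rho> / 2 * (b - a))"
    using psi.env_diff_le[of "x (k + 1) w" "x k w"] A
    unfolding a_def b_def xh_def by (intro mult_left_mono) auto
  moreover have "\<rho> * (A / 2 * b) \<le> \<rho> * ((\<gamma> + 2 * l - \<rho>) / 2 * a + R)"
    using main rho by (intro mult_left_mono) auto
  moreover have "0 \<le> l / 2 * \<rho> * a" using l_nonneg rho by (simp add: a_def)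
  moreover have "A * (\<rho> / 2 * (b - a)) = \<rho> * (A / 2 * b) - \<rho> * (A / 2 * a)"
    by (simp add: algebra_simps diff_divide_distrib)
  moreover have "\<rho> * (A / 2 * a) - \<rho> * ((\<gamma> + 2 * l - \<rho>) / 2 * a) = (\<rho> - 2 * l - \<kappa>) * \<rho> * a + l / 2 * \<rho> * a"
    by (simp add: A_def field_simps)
  ultimately have "(\<rho> - 2 * l - \<kappa>) * \<rho> * a \<le> A * (psi.env (x k w) - psi.env (x (k + 1) w)) + \<rho> * R"
    by (simp add: distrib_left right_diff_distrib)
  then show ?thesis unfolding a_def R_def .
qed


section \<open>Moments along the run\<close>

lemma subgradient_AE:
  assumes k: "k \<in> used"
  shows "AE w in M. ennreal ((norm (g k w))\<^sup>2) \<le> G2 (x' k w, \<xi> k w)"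
proof -
  have kK: "k \<in> {1..K}" using k used by blast
  show ?thesis
    using AE_sample_S0[OF kK] g_subgradient[OF k] AE_space
  proof eventually_elim
    case (elim w)
    then show ?case
      using x'_in_C[OF kK] C_U by (intro norm_subgradient_le_G2) (auto simp: x'_def)
  qed
qed

lemma G2_pair_measurable:
  "(\<lambda>v. G2 (snd (snd v), fst v)) \<in> borel_measurable (\<Xi> \<Otimes>\<^sub>M (borel \<Otimes>\<^sub>M borel))"
  by (rule measurable_compose[OF _ G2_measurable]) measurable

text \<open>The envelope \<open>G2\<close> may be integrated over the sample first, because the delayed iterate belongs
  to the past.\<close>
lemma g_second_moment:
  assumes k: "k \<in> used"
  shows g_sqint: "M.sqint (g k)" and g_square: "(\<integral>w. (norm (g k w))\<^sup>2 \<partial>M) \<le> L\<^sub>f\<^sup>2"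
proof -
  have kK: "k \<in> {1..K}" using k used by blast
  note [measurable] = g_measurable[OF k]
  have "(\<integral>\<^sup>+w. ennreal ((norm (g k w))\<^sup>2) \<partial>M) \<le> (\<integral>\<^sup>+w. G2 (x' k w, \<xi> k w) \<partial>M)"
    using subgradient_AE[OF k] by (rule nn_integral_mono_AE)
  also have "\<dots> = (\<integral>\<^sup>+w. (\<integral>\<^sup>+s. G2 (x' k w, s) \<partial>\<Xi>) \<partial>M)"
    using M.independent_nn_integral[OF sample_indep_pair[OF kK] sample_distr[OF kK] prob G2_pair_measurable]
    by simp
  also have "\<dots> \<le> (\<integral>\<^sup>+w. ennreal (L\<^sub>f\<^sup>2) \<partial>M)"
    using x'_in_C[OF kK] by (intro nn_integral_mono G2_bound)
  also have "\<dots> = ennreal (L\<^sub>f\<^sup>2)" by (simp add: M.emeasure_space_1)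
  finally have le: "(\<integral>\<^sup>+w. ennreal ((norm (g k w))\<^sup>2) \<partial>M) \<le> ennreal (L\<^sub>f\<^sup>2)" .
  then have int: "integrable M (\<lambda>w. (norm (g k w))\<^sup>2)"
    by (intro integrableI_bounded) (auto simp: order_le_less_trans)
  then show "M.sqint (g k)" by (simp add: M.sqint_def)
  have "ennreal (\<integral>w. (norm (g k w))\<^sup>2 \<partial>M) \<le> ennreal (L\<^sub>f\<^sup>2)"
    using le int by (simp add: nn_integral_eq_integral)
  then show "(\<integral>w. (norm (g k w))\<^sup>2 \<partial>M) \<le> L\<^sub>f\<^sup>2" by simp
qed

lemma g_first_moment:
  assumes k: "k \<in> used"
  shows "(\<integral>w. norm (g k w) \<partial>M) \<le> L\<^sub>f"
proof (rule power2_le_imp_le[OF _ L_nonneg])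
  show "(\<integral>w. norm (g k w) \<partial>M)\<^sup>2 \<le> L\<^sub>f\<^sup>2"
    using M.integral_square_le[OF M.sqint_norm[OF g_sqint[OF k]]] g_square[OF k] by linarith
qed

lemma d_measurable: "k \<in> {1..K} \<Longrightarrow> d k \<in> borel_measurable M"
  unfolding d_def using x_measurable[of k] x_measurable[of "k + 1"] by simp

lemma d_sqint:
  assumes k: "k \<in> {1..K}"
  shows "M.sqint (d k)"
proof (cases "k \<in> used")
  case True
  show ?thesis
  proof (rule M.sqint_bound[OF d_measurable[OF k] g_sqint[OF True]])
    show "AE w in M. norm (d k w) \<le> L\<^sub>\<omega> / c + 1 / c * norm (g k w)"
      using AE_space
    proof eventually_elim
      case (elim w)
      then show ?case using norm_d_le[OF True elim] by (simp add: add_divide_distrib add.commute)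
    qed
  qed
next
  case False
  show ?thesis
    using d_skip[OF k False]
    by (intro M.sqint_bound[OF d_measurable[OF k] M.sqint_const[of "0::real"], of 0 0]) auto
qed

lemma d_moments:
  assumes k: "k \<in> {1..K}"
  shows d_first_moment: "(\<integral>w. norm (d k w) \<partial>M) \<le> Lg / c"
    and d_second_moment: "(\<integral>w. (norm (d k w))\<^sup>2 \<partial>M) \<le> (Lg / c)\<^sup>2"
proof -
  have "(\<integral>w. (norm (d k w))\<^sup>2 \<partial>M) \<le> (Lg / c)\<^sup>2"
  proof (cases "k \<in> used")
    case True
    note int = M.sqint_integrable[OF g_sqint[OF True]] M.sqint_integrable_real[OF M.sqint_norm[OF g_sqint[OF True]]]
    have "(\<integral>w. (norm (d k w))\<^sup>2 \<partial>M) \<le> (\<integral>w. ((norm (g k w))\<^sup>2 + 2 * L\<^sub>\<omega> * norm (g k w) + L\<^sub>\<omega>\<^sup>2) / c\<^sup>2 \<partial>M)"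
    proof (rule integral_mono[OF M.sqint_integrable[OF d_sqint[OF k]]])
      fix w assume w: "w \<in> space M"
      have "(norm (d k w))\<^sup>2 \<le> ((norm (g k w) + L\<^sub>\<omega>) / c)\<^sup>2"
        using norm_d_le[OF True w] by (intro power_mono) auto
      then show "(norm (d k w))\<^sup>2 \<le> ((norm (g k w))\<^sup>2 + 2 * L\<^sub>\<omega> * norm (g k w) + L\<^sub>\<omega>\<^sup>2) / c\<^sup>2"
        by (simp add: power_divide power2_sum algebra_simps)
    qed (use int in simp)
    also have "\<dots> = ((\<integral>w. (norm (g k w))\<^sup>2 \<partial>M) + 2 * L\<^sub>\<omega> * (\<integral>w. norm (g k w) \<partial>M) + L\<^sub>\<omega>\<^sup>2) / c\<^sup>2"
      using int by (simp add: M.prob_space)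
    also have "\<dots> \<le> (L\<^sub>f\<^sup>2 + 2 * L\<^sub>\<omega> * L\<^sub>f + L\<^sub>\<omega>\<^sup>2) / c\<^sup>2"
      using g_square[OF True] g_first_moment[OF True] L\<^sub>\<omega>_nonneg
      by (intro divide_right_mono add_mono mult_left_mono) auto
    also have "\<dots> = (Lg / c)\<^sup>2" by (simp add: power_divide power2_sum algebra_simps)
    finally show ?thesis .
  next
    case False
    then have "(\<integral>w. (norm (d k w))\<^sup>2 \<partial>M) = (\<integral>w. 0 \<partial>M)"
      using d_skip[OF k] by (intro Bochner_Integration.integral_cong) auto
    then show ?thesis by simp
  qed
  then show "(\<integral>w. (norm (d k w))\<^sup>2 \<partial>M) \<le> (Lg / c)\<^sup>2" .
  then have "(\<integral>w. norm (d k w) \<partial>M)\<^sup>2 \<le> (Lg / c)\<^sup>2"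
    using M.integral_square_le[OF M.sqint_norm[OF d_sqint[OF k]]] by linarith
  then show "(\<integral>w. norm (d k w) \<partial>M) \<le> Lg / c"
    by (rule power2_le_imp_le) (use L_nonneg L\<^sub>\<omega>_nonneg c_pos in simp)
qed

lemma x_sqint: "k \<in> {1..K + 1} \<Longrightarrow> M.sqint (x k)"
proof (induction k)
  case (Suc k)
  show ?case
  proof (cases "k = 0")
    case True
    have "M.sqint (x 1)"
      using x_1 x_measurable[of 1]
      by (intro M.sqint_bound[OF _ M.sqint_const[of "0::real"], of _ "norm x1" 0]) auto
    then show ?thesis using True by simp
  next
    case False
    then have "M.sqint (\<lambda>w. x k w + d k w)"
      using Suc by (intro M.sqint_add d_sqint) auto
    then show ?thesis by (simp add: d_def)
  qed
qed simp

lemma x'_sqint: "k \<in> {1..K} \<Longrightarrow> M.sqint (x' k)"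
  unfolding x'_def using delayed_index[of k] by (intro x_sqint) auto

lemma xh_sqint:
  assumes k: "k \<in> {1..K}"
  shows "M.sqint (xh k)"
proof (rule M.sqint_bound[OF xh_measurable[OF k] x_sqint])
  have "norm (xh k w) \<le> norm (psi.prox 0) + \<rho> / (\<rho> - (l + \<kappa>)) * norm (x k w)" for w
    using psi.prox_lipschitz[of "x k w" 0] norm_triangle_ineq2[of "xh k w" "psi.prox 0"]
    by (simp add: xh_def)
  then show "AE w in M. norm (xh k w) \<le> norm (psi.prox 0) + \<rho> / (\<rho> - (l + \<kappa>)) * norm (x k w)" by simp
qed (use k in simp)

lemma \<Delta>_sqint: "k \<in> {1..K} \<Longrightarrow> M.sqint (\<Delta> k)"
  unfolding \<Delta>_def using x_sqint[of k] by (intro M.sqint_norm M.sqint_diff x'_sqint) auto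

lemma \<Delta>_le:
  assumes k: "k \<in> {1..K}"
  shows "\<Delta> k w \<le> (\<Sum>j\<in>{k - \<tau> k..<k}. norm (d j w))"
proof -
  have "x k w - x' k w = (\<Sum>j\<in>{k - \<tau> k..<k}. d j w)"
    unfolding x'_def d_def using sum_Suc_diff'[of "k - \<tau> k" k "\<lambda>j. x j w"] by simp
  then show ?thesis unfolding \<Delta>_def using norm_sum by metis
qed

lemma \<Delta>_moments:
  assumes k: "k \<in> {1..K}"
  shows \<Delta>_first_moment: "(\<integral>w. \<Delta> k w \<partial>M) \<le> real (\<tau> k) * (Lg / c)"
    and \<Delta>_second_moment: "(\<integral>w. (\<Delta> k w)\<^sup>2 \<partial>M) \<le> (real (\<tau> k))\<^sup>2 * (Lg / c)\<^sup>2"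
proof -
  let ?J = "{k - \<tau> k..<k}"
  have J: "j \<in> {1..K}" if "j \<in> ?J" for j using that delay[OF k] k by auto
  have card: "card ?J = \<tau> k" using delay[OF k] by simp
  have int: "integrable M (\<lambda>w. norm (d j w))" "integrable M (\<lambda>w. (norm (d j w))\<^sup>2)" if "j \<in> ?J" for j
    using M.sqint_integrable_real[OF M.sqint_norm[OF d_sqint[OF J[OF that]]]]
      M.sqint_integrable[OF d_sqint[OF J[OF that]]] by auto
  have "(\<integral>w. \<Delta> k w \<partial>M) \<le> (\<integral>w. (\<Sum>j\<in>?J. norm (d j w)) \<partial>M)"
    using \<Delta>_le[OF k] int(1) by (intro integral_mono[OF M.sqint_integrable_real[OF \<Delta>_sqint[OF k]]]) auto
  also have "\<dots> = (\<Sum>j\<in>?J. \<integral>w. norm (d j w) \<partial>M)" using int(1) by simp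
  also have "\<dots> \<le> (\<Sum>j\<in>?J. Lg / c)" using d_first_moment J by (intro sum_mono) blast
  also have "\<dots> = real (\<tau> k) * (Lg / c)" using card by simp
  finally show "(\<integral>w. \<Delta> k w \<partial>M) \<le> real (\<tau> k) * (Lg / c)" .
  have sq: "(\<Delta> k w)\<^sup>2 \<le> real (\<tau> k) * (\<Sum>j\<in>?J. (norm (d j w))\<^sup>2)" for w
  proof -
    have "(\<Delta> k w)\<^sup>2 \<le> (\<Sum>j\<in>?J. norm (d j w))\<^sup>2"
      using \<Delta>_le[OF k] by (intro power_mono) (auto simp: \<Delta>_def)
    also have "\<dots> \<le> (\<Sum>j\<in>?J. (norm (d j w))\<^sup>2) * real (card ?J)"
      by (rule sum_squared_le_sum_of_squares)
    finally show ?thesis using card by (simp add: mult.commute)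
  qed
  have "(\<integral>w. (\<Delta> k w)\<^sup>2 \<partial>M) \<le> (\<integral>w. real (\<tau> k) * (\<Sum>j\<in>?J. (norm (d j w))\<^sup>2) \<partial>M)"
    using sq int(2) M.sqint_integrable[OF \<Delta>_sqint[OF k]] by (intro integral_mono) auto
  also have "\<dots> = real (\<tau> k) * (\<Sum>j\<in>?J. \<integral>w. (norm (d j w))\<^sup>2 \<partial>M)" using int(2) by simp
  also have "\<dots> \<le> real (\<tau> k) * (\<Sum>j\<in>?J. (Lg / c)\<^sup>2)"
    using d_second_moment J by (intro mult_left_mono sum_mono) auto
  also have "\<dots> = (real (\<tau> k))\<^sup>2 * (Lg / c)\<^sup>2" using card by (simp add: power2_eq_square)
  finally show "(\<integral>w. (\<Delta> k w)\<^sup>2 \<partial>M) \<le> (real (\<tau> k))\<^sup>2 * (Lg / c)\<^sup>2" .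
qed

text \<open>\<open>\<Delta>\<close> depends on the past only, hence is independent of the sample.  Conditionally on the past
  the weighted inequality \<open>2 * norm g \<le> (norm g)\<^sup>2 / a + a\<close> with \<open>a\<close> close to \<open>L\<^sub>f\<close> replaces
  the Cauchy-Schwarz inequality and remains valid for \<open>L\<^sub>f = 0\<close>.\<close>
lemma g_\<Delta>_moment:
  assumes k: "k \<in> used"
  shows "(\<integral>w. norm (g k w) * \<Delta> k w \<partial>M) \<le> L\<^sub>f * (\<integral>w. \<Delta> k w \<partial>M)"
proof -
  have kK: "k \<in> {1..K}" using k used by blast
  note \<Delta>_int = M.sqint_integrable_real[OF \<Delta>_sqint[OF kK]]
  note g\<Delta>_int = M.sqint_integrable_mult[OF M.sqint_norm[OF g_sqint[OF k]] \<Delta>_sqint[OF kK]]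
  have \<Delta>_nonneg: "0 \<le> \<Delta> k w" for w by (simp add: \<Delta>_def)
  have le: "(\<integral>w. norm (g k w) * \<Delta> k w \<partial>M) \<le> a * (\<integral>w. \<Delta> k w \<partial>M)" if a: "L\<^sub>f < a" for a
  proof -
    have a0: "0 < a" using a L_nonneg by linarith
    define p q where "p = 1 / (2 * a)" and "q = a / 2"
    have pq: "0 \<le> p" "0 \<le> q" using a0 by (auto simp: p_def q_def)
    let ?H = "\<lambda>v. (ennreal p * G2 (snd (snd v), fst v) + ennreal q)
      * ennreal (norm (fst (snd v) - snd (snd v)))"
    have H: "?H \<in> borel_measurable (\<Xi> \<Otimes>\<^sub>M (borel \<Otimes>\<^sub>M borel))"
      using G2_pair_measurable by measurable
    have "(\<integral>\<^sup>+w. ennreal (norm (g k w) * \<Delta> k w) \<partial>M)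
        \<le> (\<integral>\<^sup>+w. ?H (\<xi> k w, (x k w, x' k w)) \<partial>M)"
    proof (rule nn_integral_mono_AE)
      show "AE w in M. ennreal (norm (g k w) * \<Delta> k w) \<le> ?H (\<xi> k w, (x k w, x' k w))"
        using subgradient_AE[OF k]
      proof eventually_elim
        case (elim w)
        have "2 * norm (g k w) * a \<le> (norm (g k w))\<^sup>2 + a\<^sup>2" by (rule sum_squares_bound)
        then have "norm (g k w) \<le> p * (norm (g k w))\<^sup>2 + q"
          using a0 by (simp add: p_def q_def field_simps power2_eq_square)
        then have "ennreal (norm (g k w)) \<le> ennreal (p * (norm (g k w))\<^sup>2 + q)"
          by (rule ennreal_leI)
        also have "\<dots> = ennreal p * ennreal ((norm (g k w))\<^sup>2) + ennreal q"
          using pq by (simp add: ennreal_mult)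
        also have "\<dots> \<le> ennreal p * G2 (x' k w, \<xi> k w) + ennreal q"
          by (rule add_right_mono[OF mult_left_mono[OF elim]]) simp
        finally have "ennreal (norm (g k w)) * ennreal (\<Delta> k w)
            \<le> (ennreal p * G2 (x' k w, \<xi> k w) + ennreal q) * ennreal (\<Delta> k w)"
          by (rule mult_right_mono) simp
        then show ?case
          using \<Delta>_nonneg by (simp only: ennreal_mult norm_ge_zero fst_conv snd_conv flip: \<Delta>_def)
      qed
    qed
    also have "\<dots> = (\<integral>\<^sup>+w. (\<integral>\<^sup>+s. ?H (s, (x k w, x' k w)) \<partial>\<Xi>) \<partial>M)"
      by (rule M.independent_nn_integral[OF sample_indep_pair[OF kK] sample_distr[OF kK] prob H])
    also have "\<dots> \<le> (\<integral>\<^sup>+w. ennreal (a * \<Delta> k w) \<partial>M)"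
    proof (rule nn_integral_mono)
      fix w assume w: "w \<in> space M"
      have meas: "(\<lambda>s. G2 (x' k w, s)) \<in> borel_measurable \<Xi>" by measurable
      have "(\<integral>\<^sup>+s. ?H (s, (x k w, x' k w)) \<partial>\<Xi>)
          = (\<integral>\<^sup>+s. (ennreal p * G2 (x' k w, s) + ennreal q) * ennreal (\<Delta> k w) \<partial>\<Xi>)"
        by (simp only: fst_conv snd_conv flip: \<Delta>_def)
      also have "\<dots> = (\<integral>\<^sup>+s. ennreal p * G2 (x' k w, s) + ennreal q \<partial>\<Xi>) * ennreal (\<Delta> k w)"
        using meas by (intro nn_integral_multc) measurable
      also have "(\<integral>\<^sup>+s. ennreal p * G2 (x' k w, s) + ennreal q \<partial>\<Xi>)
          = ennreal p * (\<integral>\<^sup>+s. G2 (x' k w, s) \<partial>\<Xi>) + ennreal q"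
        using meas by (simp add: nn_integral_add nn_integral_cmult Xi.emeasure_space_1)
      also have "(ennreal p * (\<integral>\<^sup>+s. G2 (x' k w, s) \<partial>\<Xi>) + ennreal q) * ennreal (\<Delta> k w)
          \<le> (ennreal p * ennreal (L\<^sub>f\<^sup>2) + ennreal q) * ennreal (\<Delta> k w)"
        by (rule mult_right_mono[OF add_right_mono[OF mult_left_mono[OF G2_bound[OF x'_in_C[OF kK w]]]]]) simp_all
      also have "\<dots> = ennreal ((p * L\<^sub>f\<^sup>2 + q) * \<Delta> k w)"
        using pq \<Delta>_nonneg by (simp add: ennreal_mult)
      also have "\<dots> \<le> ennreal (a * \<Delta> k w)"
      proof (intro ennreal_leI mult_right_mono)
        have "L\<^sub>f\<^sup>2 \<le> a\<^sup>2" using a L_nonneg by (intro power_mono) auto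
        then show "p * L\<^sub>f\<^sup>2 + q \<le> a" using a0 by (simp add: p_def q_def field_simps power2_eq_square)
      qed (rule \<Delta>_nonneg)
      finally show "(\<integral>\<^sup>+s. ?H (s, (x k w, x' k w)) \<partial>\<Xi>) \<le> ennreal (a * \<Delta> k w)" .
    qed
    finally have "ennreal (\<integral>w. norm (g k w) * \<Delta> k w \<partial>M) \<le> ennreal (\<integral>w. a * \<Delta> k w \<partial>M)"
      using g\<Delta>_int \<Delta>_int a0 \<Delta>_nonneg by (simp add: nn_integral_eq_integral)
    moreover have "0 \<le> (\<integral>w. a * \<Delta> k w \<partial>M)" using a0 \<Delta>_nonneg by (intro integral_nonneg_AE) auto
    ultimately show ?thesis by simp
  qed
  define E where "E = (\<integral>w. \<Delta> k w \<partial>M)"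
  have E: "0 \<le> E" unfolding E_def using \<Delta>_nonneg by (intro integral_nonneg_AE) auto
  show ?thesis
  proof (rule field_le_epsilon)
    fix e :: real assume e: "0 < e"
    have "(\<integral>w. norm (g k w) * \<Delta> k w \<partial>M) \<le> (L\<^sub>f + e / (E + 1)) * E"
      unfolding E_def by (rule le) (use e E in \<open>simp add: E_def\<close>)
    also have "\<dots> \<le> L\<^sub>f * E + e" using e E by (simp add: field_simps)
    finally show "(\<integral>w. norm (g k w) * \<Delta> k w \<partial>M) \<le> L\<^sub>f * (\<integral>w. \<Delta> k w \<partial>M) + e" by (simp add: E_def)
  qed
qed

text \<open>The proximal point and the delayed iterate are functions of the past, so the sample may be
  integrated out first.  Only differences of values of \<open>f\<close> are integrated, since \<open>f\<close> itself
  need not be integrable along the random iterates.\<close>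
lemma \<delta>_mean_zero:
  assumes k: "k \<in> {1..K}"
  shows \<delta>_integrable: "integrable M (\<delta> k)" and \<delta>_integral: "(\<integral>w. \<delta> k w \<partial>M) = 0"
proof -
  define H where "H v = fU (psi.prox (fst (snd v)), fst v) - fU (snd (snd v), fst v)" for v
  note [measurable] = fU_measurable V_measurable sample_measurable[OF k] x'_measurable[OF k]
  have xm[measurable]: "x k \<in> borel_measurable M" using x_measurable k by simp
  have H[measurable]: "H \<in> borel_measurable (\<Xi> \<Otimes>\<^sub>M (borel \<Otimes>\<^sub>M borel))"
    unfolding H_def by measurable
  have fU_eq: "fU (y, s) = fr y s" if "y \<in> C" "s \<in> S0" for y s
    using that C_U by (auto simp: fU_def)
  define b where "b w = 2 * L\<^sub>f * norm (xh k w - x' k w) + l / 2 * (norm (xh k w - x' k w))\<^sup>2" for w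
  have diff: "M.sqint (\<lambda>w. xh k w - x' k w)" by (intro M.sqint_diff xh_sqint x'_sqint k)
  have b_int: "integrable M b" unfolding b_def
    using M.sqint_integrable_real[OF M.sqint_norm[OF diff]] M.sqint_integrable[OF diff] by simp
  have b_nonneg: "0 \<le> b w" for w unfolding b_def using l_nonneg L_nonneg by simp
  have inner: "(\<integral>\<^sup>+s. ennreal \<bar>H (s, (x k w, x' k w))\<bar> \<partial>\<Xi>) \<le> ennreal (b w)" if w: "w \<in> space M" for w
  proof -
    let ?y = "xh k w" and ?z = "x' k w"
    have C: "?y \<in> C" "?z \<in> C" using psi.prox_in x'_in_C[OF k w] by (auto simp: xh_def)
    let ?B = "\<lambda>s. (norm (V 0 (?y, s)) + norm (V 0 (?z, s))) * norm (?y - ?z) + l / 2 * (norm (?y - ?z))\<^sup>2"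
    have B_int: "integrable \<Xi> ?B" using V_moments(1)[OF C(1)] V_moments(1)[OF C(2)] by simp
    have "(\<integral>\<^sup>+s. ennreal \<bar>H (s, (x k w, x' k w))\<bar> \<partial>\<Xi>) \<le> (\<integral>\<^sup>+s. ennreal (?B s) \<partial>\<Xi>)"
    proof (rule nn_integral_mono_AE)
      show "AE s in \<Xi>. ennreal \<bar>H (s, (x k w, x' k w))\<bar> \<le> ennreal (?B s)"
        using AE_S0
      proof eventually_elim
        case (elim s)
        have "0 \<le> norm (V 0 (?y, s)) * norm (?y - ?z)" "0 \<le> norm (V 0 (?z, s)) * norm (?y - ?z)" by simp_all
        then have "\<bar>fr ?y s - fr ?z s\<bar> \<le> ?B s"
          using fr_diff_le[OF elim C] fr_diff_le[OF elim C(2,1)]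
          unfolding distrib_right norm_minus_commute[of ?z ?y] by linarith
        then show ?case
          using C elim by (intro ennreal_leI) (simp add: H_def fU_eq flip: xh_def)
      qed
    qed
    also have "\<dots> = ennreal (\<integral>s. ?B s \<partial>\<Xi>)"
      using B_int l_nonneg by (intro nn_integral_eq_integral) auto
    also have "\<dots> \<le> ennreal (b w)"
    proof (rule ennreal_leI)
      have "(\<integral>s. ?B s \<partial>\<Xi>) = ((\<integral>s. norm (V 0 (?y, s)) \<partial>\<Xi>) + (\<integral>s. norm (V 0 (?z, s)) \<partial>\<Xi>)) * norm (?y - ?z)
          + l / 2 * (norm (?y - ?z))\<^sup>2"
        using V_moments(1)[OF C(1)] V_moments(1)[OF C(2)] by (simp add: Xi.prob_space)
      also have "\<dots> \<le> (L\<^sub>f + L\<^sub>f) * norm (?y - ?z) + l / 2 * (norm (?y - ?z))\<^sup>2"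
        using V_moments(2)[OF C(1)] V_moments(2)[OF C(2)]
        by (intro add_right_mono mult_right_mono add_mono) auto
      finally show "(\<integral>s. ?B s \<partial>\<Xi>) \<le> b w" by (simp add: b_def)
    qed
    finally show ?thesis .
  qed
  have H_int: "integrable M (\<lambda>w. H (\<xi> k w, (x k w, x' k w)))"
  proof (rule integrableI_bounded)
    have "(\<integral>\<^sup>+w. ennreal \<bar>H (\<xi> k w, (x k w, x' k w))\<bar> \<partial>M)
        = (\<integral>\<^sup>+w. (\<integral>\<^sup>+s. ennreal \<bar>H (s, (x k w, x' k w))\<bar> \<partial>\<Xi>) \<partial>M)"
      by (rule M.independent_nn_integral[where H = "\<lambda>v. ennreal \<bar>H v\<bar>",
            OF sample_indep_pair[OF k] sample_distr[OF k] prob]) measurable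
    also have "\<dots> \<le> (\<integral>\<^sup>+w. ennreal (b w) \<partial>M)" using inner by (intro nn_integral_mono)
    also have "\<dots> < \<infinity>"
      by (subst nn_integral_eq_integral[OF b_int]) (simp_all add: b_nonneg)
    finally show "(\<integral>\<^sup>+w. ennreal (norm (H (\<xi> k w, (x k w, x' k w)))) \<partial>M) < \<infinity>" by simp
  qed measurable
  have inner_eq: "(\<integral>s. H (s, (x k w, x' k w)) \<partial>\<Xi>) = Fr (xh k w) - Fr (x' k w)" if w: "w \<in> space M" for w
  proof -
    have C: "xh k w \<in> C" "x' k w \<in> C" using psi.prox_in x'_in_C[OF k w] by (auto simp: xh_def)
    have "(\<integral>s. H (s, (x k w, x' k w)) \<partial>\<Xi>) = (\<integral>s. fr (xh k w) s - fr (x' k w) s \<partial>\<Xi>)"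
    proof (rule integral_cong_AE)
      show "AE s in \<Xi>. H (s, (x k w, x' k w)) = fr (xh k w) s - fr (x' k w) s"
        using AE_S0 by eventually_elim (use C in \<open>simp add: H_def fU_eq flip: xh_def\<close>)
    next
      show "(\<lambda>s. fr (xh k w) s - fr (x' k w) s) \<in> borel_measurable \<Xi>"
        using Fr_integrable[OF C(1)] Fr_integrable[OF C(2)] by simp
    qed measurable
    then show ?thesis using Fr_integrable C by (simp add: Fr_eq)
  qed
  have F_meas: "(\<lambda>w. Fr (xh k w) - Fr (x' k w)) \<in> borel_measurable M"
  proof -
    have "(\<lambda>w. \<integral>s. H (s, (x k w, x' k w)) \<partial>\<Xi>) \<in> borel_measurable M" by measurable
    then show ?thesis using inner_eq by (simp cong: measurable_cong)
  qed
  have F_int: "integrable M (\<lambda>w. Fr (xh k w) - Fr (x' k w))"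
  proof (rule Bochner_Integration.integrable_bound[OF _ F_meas])
    show "integrable M (\<lambda>w. L\<^sub>f * norm (xh k w - x' k w))"
      using M.sqint_integrable_real[OF M.sqint_norm[OF diff]] by simp
    show "AE w in M. norm (Fr (xh k w) - Fr (x' k w)) \<le> norm (L\<^sub>f * norm (xh k w - x' k w))"
      using AE_space
    proof eventually_elim
      case (elim w)
      then have "xh k w \<in> C" "x' k w \<in> C" using psi.prox_in x'_in_C[OF k] by (auto simp: xh_def)
      then show ?case using lipschitz_onD[OF Fr_lipschitz] L_nonneg by (simp add: dist_norm)
    qed
  qed
  have \<delta>_eq: "\<delta> k = (\<lambda>w. H (\<xi> k w, (x k w, x' k w)) - (Fr (xh k w) - Fr (x' k w)))"
    by (simp add: \<delta>_def H_def xh_def fun_eq_iff)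
  show "integrable M (\<delta> k)" unfolding \<delta>_eq using H_int F_int by simp
  have "(\<integral>w. H (\<xi> k w, (x k w, x' k w)) \<partial>M) = (\<integral>w. (\<integral>s. H (s, (x k w, x' k w)) \<partial>\<Xi>) \<partial>M)"
    by (rule M.independent_integral[OF sample_indep_pair[OF k] sample_distr[OF k] prob H H_int])
  also have "\<dots> = (\<integral>w. Fr (xh k w) - Fr (x' k w) \<partial>M)"
    using inner_eq by (intro Bochner_Integration.integral_cong) auto
  finally show "(\<integral>w. \<delta> k w \<partial>M) = 0"
    unfolding \<delta>_eq using H_int F_int by simp
qed


section \<open>Expected decrease of the Moreau envelope\<close>

definition e :: "nat \<Rightarrow> real" where "e k = (\<integral>w. psi.env (x k w) \<partial>M)"

context
  fixes v :: real
  assumes v: "\<And>y. y \<in> C \<Longrightarrow> v \<le> \<phi> y"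
begin

lemma env_ge: "v \<le> psi.env y"
proof -
  have "0 \<le> \<rho> / 2 * (norm (y - psi.prox y))\<^sup>2" using psi.mu_nonneg psi.mu_less_rho by simp
  then show ?thesis using v[OF psi.prox_in, of y] unfolding psi.env_def by linarith
qed

lemma env_integrable:
  assumes k: "k \<in> {1..K + 1}"
  shows "integrable M (\<lambda>w. psi.env (x k w))"
proof (rule Bochner_Integration.integrable_bound)
  have sq: "M.sqint (\<lambda>w. x k w - x1)" by (intro M.sqint_diff x_sqint k M.sqint_const)
  show "integrable M (\<lambda>w. \<bar>v\<bar> + \<bar>\<phi> x1\<bar> + Lg * norm (x k w - x1))"
    using M.sqint_integrable_real[OF M.sqint_norm[OF sq]] by simp
  have "psi.env \<in> borel_measurable borel"
    by (rule borel_measurable_continuous_onI[OF psi.continuous_on_env])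
  then show "(\<lambda>w. psi.env (x k w)) \<in> borel_measurable M"
    by (rule measurable_compose[OF x_measurable[OF k]])
  show "AE w in M. norm (psi.env (x k w)) \<le> norm (\<bar>v\<bar> + \<bar>\<phi> x1\<bar> + Lg * norm (x k w - x1))"
    using AE_space
  proof eventually_elim
    case (elim w)
    have C: "x k w \<in> C" by (rule x_in_C[OF k elim])
    have "psi.env (x k w) \<le> \<phi> (x k w)" using psi.env_le[OF C, of "x k w"] by simp
    also have "\<dots> \<le> \<phi> x1 + Lg * norm (x k w - x1)" by (rule psi.phi_le[OF C x1])
    finally have "psi.env (x k w) \<le> \<phi> x1 + Lg * norm (x k w - x1)" .
    moreover have "0 \<le> Lg * norm (x k w - x1)" using L_nonneg L\<^sub>\<omega>_nonneg by simp
    ultimately show ?case using env_ge[of "x k w"] by simp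
  qed
qed

text \<open>Expectation of \<open>descent\<close>: the sampling error disappears, and the displacements contribute
  through their first and second moments.\<close>
lemma expected_descent:
  assumes k: "k \<in> used"
  shows "(\<rho> - 2 * l - \<kappa>) * \<rho> * (\<integral>w. (norm (x k w - xh k w))\<^sup>2 \<partial>M)
    \<le> A * (e k - e (k + 1))
      + \<rho> * (2 * L\<^sub>f * Lg / c + 2 * L\<^sub>f * (Lg / c) * real (\<tau> k) + l * (Lg / c)\<^sup>2 * (real (\<tau> k))\<^sup>2)"
proof -
  have kK: "k \<in> {1..K}" and k1: "k \<in> {1..K + 1}" "k + 1 \<in> {1..K + 1}" using k used by auto
  note gs = g_sqint[OF k] and ds = d_sqint[OF kK] and \<Delta>s = \<Delta>_sqint[OF kK]
  have rho: "\<rho> > 0" using \<rho> \<kappa>_nonneg l_nonneg by linarith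
  have int: "integrable M (\<lambda>w. (norm (x k w - xh k w))\<^sup>2)"
    "integrable M (\<lambda>w. psi.env (x k w))" "integrable M (\<lambda>w. psi.env (x (k + 1) w))"
    "integrable M (\<delta> k)"
    "integrable M (\<lambda>w. (norm (g k w) + L\<^sub>f) * norm (d k w))"
    "integrable M (\<lambda>w. norm (g k w) * \<Delta> k w)" "integrable M (\<Delta> k)" "integrable M (\<lambda>w. (\<Delta> k w)\<^sup>2)"
    "integrable M (\<lambda>w. norm (g k w))" "integrable M (\<lambda>w. (norm (g k w))\<^sup>2)"
  proof -
    show "integrable M (\<lambda>w. (norm (x k w - xh k w))\<^sup>2)"
      by (intro M.sqint_integrable M.sqint_diff x_sqint xh_sqint kK k1)
    show "integrable M (\<lambda>w. psi.env (x k w))" "integrable M (\<lambda>w. psi.env (x (k + 1) w))"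
      by (rule env_integrable[OF k1(1)], rule env_integrable[OF k1(2)])
    show "integrable M (\<delta> k)" by (rule \<delta>_integrable[OF kK])
    show "integrable M (\<lambda>w. (norm (g k w) + L\<^sub>f) * norm (d k w))"
      by (intro M.sqint_integrable_mult M.sqint_add M.sqint_norm M.sqint_const gs ds)
    show "integrable M (\<lambda>w. norm (g k w) * \<Delta> k w)"
      by (intro M.sqint_integrable_mult M.sqint_norm gs \<Delta>s)
    show "integrable M (\<Delta> k)" by (rule M.sqint_integrable_real[OF \<Delta>s])
    show "integrable M (\<lambda>w. (\<Delta> k w)\<^sup>2)" using M.sqint_integrable[OF \<Delta>s] by simp
    show "integrable M (\<lambda>w. norm (g k w))" by (rule M.sqint_integrable_real[OF M.sqint_norm[OF gs]])
    show "integrable M (\<lambda>w. (norm (g k w))\<^sup>2)" by (rule M.sqint_integrable[OF gs])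
  qed
  have int_g\<Delta>: "integrable M (\<lambda>w. (norm (g k w) + L\<^sub>f) * \<Delta> k w)"
    using int(6,7) by (simp add: distrib_right)
  have gd: "(\<integral>w. (norm (g k w) + L\<^sub>f) * norm (d k w) \<partial>M) \<le> 2 * L\<^sub>f * Lg / c"
  proof -
    have "(\<integral>w. (norm (g k w) + L\<^sub>f) * norm (d k w) \<partial>M)
        \<le> (\<integral>w. ((norm (g k w))\<^sup>2 + Lg * norm (g k w) + L\<^sub>f * L\<^sub>\<omega>) / c \<partial>M)"
    proof (rule integral_mono[OF int(5)])
      fix w assume w: "w \<in> space M"
      have "(norm (g k w) + L\<^sub>f) * norm (d k w) \<le> (norm (g k w) + L\<^sub>f) * ((norm (g k w) + L\<^sub>\<omega>) / c)"
        using norm_d_le[OF k w] L_nonneg by (intro mult_left_mono) auto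
      also have "\<dots> = ((norm (g k w))\<^sup>2 + Lg * norm (g k w) + L\<^sub>f * L\<^sub>\<omega>) / c"
        by (simp add: algebra_simps power2_eq_square)
      finally show "(norm (g k w) + L\<^sub>f) * norm (d k w) \<le> ((norm (g k w))\<^sup>2 + Lg * norm (g k w) + L\<^sub>f * L\<^sub>\<omega>) / c" .
    qed (use int(9,10) in simp)
    also have "\<dots> = ((\<integral>w. (norm (g k w))\<^sup>2 \<partial>M) + Lg * (\<integral>w. norm (g k w) \<partial>M) + L\<^sub>f * L\<^sub>\<omega>) / c"
      using int(9,10) by (simp add: M.prob_space)
    also have "\<dots> \<le> (L\<^sub>f\<^sup>2 + Lg * L\<^sub>f + L\<^sub>f * L\<^sub>\<omega>) / c"
      using g_square[OF k] g_first_moment[OF k] L_nonneg L\<^sub>\<omega>_nonneg c_pos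
      by (intro divide_right_mono add_right_mono add_mono mult_left_mono) auto
    also have "\<dots> = 2 * L\<^sub>f * Lg / c" by (simp add: algebra_simps power2_eq_square)
    finally show ?thesis .
  qed
  have g\<Delta>: "(\<integral>w. (norm (g k w) + L\<^sub>f) * \<Delta> k w \<partial>M) \<le> 2 * L\<^sub>f * (Lg / c) * real (\<tau> k)"
  proof -
    have "(\<integral>w. (norm (g k w) + L\<^sub>f) * \<Delta> k w \<partial>M) = (\<integral>w. norm (g k w) * \<Delta> k w \<partial>M) + L\<^sub>f * (\<integral>w. \<Delta> k w \<partial>M)"
      using int(6,7) by (simp add: distrib_right)
    also have "\<dots> \<le> 2 * (L\<^sub>f * (\<integral>w. \<Delta> k w \<partial>M))" using g_\<Delta>_moment[OF k] by simp
    also have "\<dots> \<le> 2 * (L\<^sub>f * (real (\<tau> k) * (Lg / c)))"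
      using \<Delta>_first_moment[OF kK] L_nonneg by (intro mult_left_mono) auto
    also have "\<dots> = 2 * L\<^sub>f * (Lg / c) * real (\<tau> k)" by (simp only: mult_ac)
    finally show ?thesis .
  qed
  have \<Delta>2: "l * (\<integral>w. (\<Delta> k w)\<^sup>2 \<partial>M) \<le> l * (Lg / c)\<^sup>2 * (real (\<tau> k))\<^sup>2"
    using mult_left_mono[OF \<Delta>_second_moment[OF kK] l_nonneg] by (simp add: mult_ac)
  let ?rhs = "\<lambda>w. A * (psi.env (x k w) - psi.env (x (k + 1) w))
      + \<rho> * (\<delta> k w + (norm (g k w) + L\<^sub>f) * norm (d k w) + (norm (g k w) + L\<^sub>f) * \<Delta> k w + l * (\<Delta> k w)\<^sup>2)"
  have "(\<rho> - 2 * l - \<kappa>) * \<rho> * (\<integral>w. (norm (x k w - xh k w))\<^sup>2 \<partial>M)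
      = (\<integral>w. (\<rho> - 2 * l - \<kappa>) * \<rho> * (norm (x k w - xh k w))\<^sup>2 \<partial>M)" by simp
  also have "\<dots> \<le> (\<integral>w. ?rhs w \<partial>M)"
  proof (rule integral_mono_AE)
    show "AE w in M. (\<rho> - 2 * l - \<kappa>) * \<rho> * (norm (x k w - xh k w))\<^sup>2 \<le> ?rhs w"
      using AE_sample_S0[OF kK] g_subgradient[OF k] AE_space
      by eventually_elim (use descent[OF k] in \<open>auto simp: x'_def\<close>)
  qed (use int int_g\<Delta> in auto)
  also have "\<dots> = A * (e k - e (k + 1)) + \<rho> * ((\<integral>w. \<delta> k w \<partial>M) + (\<integral>w. (norm (g k w) + L\<^sub>f) * norm (d k w) \<partial>M)
      + (\<integral>w. (norm (g k w) + L\<^sub>f) * \<Delta> k w \<partial>M) + l * (\<integral>w. (\<Delta> k w)\<^sup>2 \<partial>M))"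
    unfolding e_def using int(2-5,8) int_g\<Delta> by simp
  also have "\<dots> \<le> A * (e k - e (k + 1)) + \<rho> * (2 * L\<^sub>f * Lg / c + 2 * L\<^sub>f * (Lg / c) * real (\<tau> k) + l * (Lg / c)\<^sup>2 * (real (\<tau> k))\<^sup>2)"
    using gd g\<Delta> \<Delta>2 \<delta>_integral[OF kK] rho by (intro add_left_mono mult_left_mono) auto
  finally show ?thesis .
qed

lemma summed_descent:
  "(\<rho> - 2 * l - \<kappa>) * \<rho> * (\<Sum>k\<in>used. \<integral>w. (norm (x k w - xh k w))\<^sup>2 \<partial>M)
    \<le> A * (psi.env x1 - v)
      + \<rho> * (2 * L\<^sub>f * Lg / c * real (card used) + 2 * L\<^sub>f * (Lg / c) * (\<Sum>k\<in>used. real (\<tau> k))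
          + l * (Lg / c)\<^sup>2 * (\<Sum>k\<in>used. (real (\<tau> k))\<^sup>2))"
proof -
  have fin: "finite used" using used finite_subset by blast
  have A: "A \<ge> 0" unfolding A_def using \<gamma> \<rho> \<kappa>_nonneg l_nonneg c_pos by linarith
  have "e k - e (k + 1) = 0" if "k \<in> {1..K} - used" for k
    unfolding e_def using skip[of k] that
    by (simp cong: Bochner_Integration.integral_cong)
  then have "(\<Sum>k\<in>used. e k - e (k + 1)) = (\<Sum>k\<in>{1..K}. e k - e (k + 1))"
    using used by (intro sum.mono_neutral_left) auto
  also have "\<dots> = e 1 - e (K + 1)"
    using sum_Suc_diff[of 1 K "\<lambda>k. - e k"] K by simp
  also have "e 1 = psi.env x1"
    unfolding e_def using x_1 by (simp cong: Bochner_Integration.integral_cong add: M.prob_space)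
  also have "psi.env x1 - e (K + 1) \<le> psi.env x1 - v"
  proof -
    have "(\<integral>w. v \<partial>M) \<le> e (K + 1)"
      unfolding e_def using env_integrable[of "K + 1"] env_ge by (intro integral_mono) auto
    then show ?thesis by (simp add: M.prob_space)
  qed
  finally have tele: "(\<Sum>k\<in>used. e k - e (k + 1)) \<le> psi.env x1 - v" .
  have "(\<rho> - 2 * l - \<kappa>) * \<rho> * (\<Sum>k\<in>used. \<integral>w. (norm (x k w - xh k w))\<^sup>2 \<partial>M)
      = (\<Sum>k\<in>used. (\<rho> - 2 * l - \<kappa>) * \<rho> * (\<integral>w. (norm (x k w - xh k w))\<^sup>2 \<partial>M))"
    by (rule sum_distrib_left)
  also have "\<dots> \<le> (\<Sum>k\<in>used. A * (e k - e (k + 1))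
      + \<rho> * (2 * L\<^sub>f * Lg / c + 2 * L\<^sub>f * (Lg / c) * real (\<tau> k) + l * (Lg / c)\<^sup>2 * (real (\<tau> k))\<^sup>2))"
    by (intro sum_mono expected_descent)
  also have "\<dots> = A * (\<Sum>k\<in>used. e k - e (k + 1))
      + \<rho> * (2 * L\<^sub>f * Lg / c * real (card used) + 2 * L\<^sub>f * (Lg / c) * (\<Sum>k\<in>used. real (\<tau> k))
          + l * (Lg / c)\<^sup>2 * (\<Sum>k\<in>used. (real (\<tau> k))\<^sup>2))"
    by (simp only: sum.distrib sum_distrib_left[symmetric] sum_constant) (simp add: mult_ac)
  finally show ?thesis using mult_left_mono[OF tele A] by linarith
qed

end

lemma gradient_norm: "(norm (gradient psi.env (x k w)))\<^sup>2 = \<rho>\<^sup>2 * (norm (x k w - xh k w))\<^sup>2"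
  by (simp add: psi.gradient_env xh_def power_mult_distrib)

end

section \<open>The convergence rate\<close>

text \<open>Along a sequence that converges from inside the domain a Lipschitz function stays bounded, so
  lower semicontinuity forces a finite value at the limit.\<close>
lemma closed_edom:
  fixes h :: "'a::euclidean_space \<Rightarrow> ereal"
  assumes lsc: "lower_semicontinuous h" and not_MInf: "\<And>y. h y \<noteq> -\<infinity>"
    and lip: "L-lipschitz_on (edom h) (\<lambda>y. real_of_ereal (h y))"
  shows "closed (edom h)"
  unfolding closed_limpt
proof (intro allI impI)
  fix y assume y: "y islimpt edom h"
  show "y \<in> edom h"
  proof (rule ccontr)
    assume "y \<notin> edom h"
    then have "h y = \<infinity>" using not_MInf[of y] by (auto simp: edom_def)
    then have Li: "Liminf (at y) h = \<infinity>"
      using lsc unfolding lower_semicontinuous_def by (metis ereal_infty_less_eq(1))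
    obtain z where z: "z \<in> edom h" using y islimptE[OF y, of UNIV] by auto
    define b where "b = real_of_ereal (h z) + L * (dist y z + 1)"
    have L: "0 \<le> L" using lip lipschitz_on_nonneg by blast
    have "\<forall>\<^sub>F u in at y. ereal b < h u"
      using Li le_Liminf_iff[of \<infinity> "at y" h] by simp
    then obtain e where e: "e > 0" "\<And>u. u \<noteq> y \<Longrightarrow> dist u y < e \<Longrightarrow> ereal b < h u"
      unfolding eventually_at by auto
    obtain u where u: "u \<in> edom h" "u \<noteq> y" "dist u y < min e 1"
      using y e(1) unfolding islimpt_approachable by (metis min_less_iff_conj zero_less_one)
    have "h u = ereal (real_of_ereal (h u))" using u(1) by (auto simp: edom_def ereal_real')
    then have "b < real_of_ereal (h u)" using e(2)[OF u(2)] u(3) by (metis less_ereal.simps(1) min_less_iff_conj)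
    also have "\<dots> \<le> real_of_ereal (h z) + L * dist u z"
      using lipschitz_onD[OF lip u(1) z] by (simp add: dist_real_def)
    also have "\<dots> \<le> b"
      unfolding b_def using u(3) dist_triangle[of u z y] L
      by (intro add_left_mono mult_left_mono) auto
    finally show False by simp
  qed
qed

text \<open>Completing the square turns the linearised subproblem into a proximal step from the point
  reached by a subgradient step.\<close>
lemma linearised_argmin_is_prox:
  fixes h :: "'a::euclidean_space \<Rightarrow> ereal"
  assumes not_MInf: "\<And>y. h y \<noteq> -\<infinity>" and ne: "edom h \<noteq> {}" and c: "c > 0"
    and min: "is_arg_min (\<lambda>y. ereal (v \<bullet> (y - x)) + h y + ereal (c / 2 * (norm (y - x))\<^sup>2)) (\<lambda>_. True) p"
  shows "p \<in> edom h \<and> (\<forall>y\<in>edom h.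
      real_of_ereal (h p) + c / 2 * (norm (x - (1 / c) *\<^sub>R v - p))\<^sup>2
      \<le> real_of_ereal (h y) + c / 2 * (norm (x - (1 / c) *\<^sub>R v - y))\<^sup>2)"
proof -
  let ?J = "\<lambda>y. ereal (v \<bullet> (y - x)) + h y + ereal (c / 2 * (norm (y - x))\<^sup>2)"
  have le: "?J p \<le> ?J y" for y
    using min by (auto simp: is_arg_min_def not_less)
  have fin: "h y = ereal (real_of_ereal (h y))" if "y \<in> edom h" for y
    using that by (auto simp: edom_def ereal_real')
  obtain z where z: "z \<in> edom h" using ne by blast
  have "h p \<noteq> \<infinity>"
  proof
    assume "h p = \<infinity>"
    then have "?J z = \<infinity>" using le[of z] by simp
    then show False using fin[OF z] by (cases "h z") auto
  qed
  then have p: "p \<in> edom h" using not_MInf[of p] by (auto simp: edom_def)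
  note ex = complete_square_linear_term[OF c, of x v]
  have "real_of_ereal (h p) + c / 2 * (norm (x - (1 / c) *\<^sub>R v - p))\<^sup>2
      \<le> real_of_ereal (h y) + c / 2 * (norm (x - (1 / c) *\<^sub>R v - y))\<^sup>2" if y: "y \<in> edom h" for y
  proof -
    have "v \<bullet> (p - x) + real_of_ereal (h p) + c / 2 * (norm (p - x))\<^sup>2
        \<le> v \<bullet> (y - x) + real_of_ereal (h y) + c / 2 * (norm (y - x))\<^sup>2"
      using le[of y] by (subst (asm) fin[OF p], subst (asm) fin[OF y]) simp
    then show ?thesis unfolding ex by linarith
  qed
  then show ?thesis using p by blast
qed

lemma (in prob_space) nn_integral_uniform_index:
  fixes x :: "nat \<Rightarrow> 'a \<Rightarrow> 'b::euclidean_space" and h :: "'b \<Rightarrow> ennreal"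
  assumes S: "S \<subseteq> {1..K}" "S \<noteq> {}"
    and unif: "distr M (count_space UNIV) J = measure_pmf (pmf_of_set S)"
    and ind: "independent_rvs M (count_space UNIV) J (\<Pi>\<^sub>M i\<in>{1..K}. borel) (\<lambda>w. \<lambda>i\<in>{1..K}. x i w)"
    and h: "h \<in> borel_measurable borel"
  shows "(\<integral>\<^sup>+w. h (x (J w) w) \<partial>M) = (\<Sum>k\<in>S. \<integral>\<^sup>+w. h (x k w) \<partial>M) / of_nat (card S)"
proof -
  let ?P = "\<Pi>\<^sub>M i\<in>{1..K}. (borel :: 'b measure)" and ?p = "measure_pmf (pmf_of_set S)"
  let ?X = "\<lambda>w. \<lambda>i\<in>{1..K}. x i w"
  have fin: "finite S" using S(1) finite_subset by blast
  have J: "J \<in> measurable M (count_space UNIV)" and X: "?X \<in> measurable M ?P"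
    using ind by (auto simp: independent_rvs_def)
  have ind': "independent_rvs M ?p J ?P ?X"
    using ind unfolding independent_rvs_def
    by (simp add: vimage_algebra_def cong: measurable_cong_sets)
  have distr': "distr M ?p J = ?p"
    unfolding unif[symmetric] by (rule distr_cong) auto
  \<comment> \<open>Almost surely \<open>J\<close> lies in \<open>S\<close>, so the default \<open>0\<close> is taken on a null set.\<close>
  define H where "H kv = (if fst kv \<in> {1..K} then h (snd kv (fst kv)) else 0)" for kv :: "nat \<times> (nat \<Rightarrow> 'b)"
  have H: "H \<in> borel_measurable (?p \<Otimes>\<^sub>M ?P)"
  proof -
    have "(\<lambda>kv. if k \<in> {1..K} then h (snd kv k) else 0) \<in> borel_measurable (?p \<Otimes>\<^sub>M ?P)" for k
      by (cases "k \<in> {1..K}")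
        (auto intro!: measurable_compose[OF _ h] measurable_compose[OF measurable_snd measurable_component_singleton])
    moreover have "fst \<in> measurable (?p \<Otimes>\<^sub>M ?P) (count_space UNIV)"
      using measurable_fst[of ?p ?P] by simp
    ultimately show ?thesis unfolding H_def
      by (rule measurable_compose_countable[where f = "\<lambda>k kv. if k \<in> {1..K} then h (snd kv k) else 0"])
  qed
  have meas: "(\<lambda>w. h (x k w)) \<in> borel_measurable M" if "k \<in> S" for k
  proof -
    have k: "k \<in> {1..K}" using that S(1) by blast
    have "(\<lambda>w. ?X w k) \<in> borel_measurable M"
      by (rule measurable_compose[OF X measurable_component_singleton[OF k]])
    then have "x k \<in> borel_measurable M" using k by simp
    then show ?thesis by (rule measurable_compose[OF _ h])
  qed
  have "AE k in distr M (count_space UNIV) J. k \<in> S"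
    unfolding unif using fin S(2) by (simp add: AE_measure_pmf_iff)
  then have "AE w in M. J w \<in> S" using J by (simp add: AE_distr_iff)
  then have "(\<integral>\<^sup>+w. h (x (J w) w) \<partial>M) = (\<integral>\<^sup>+w. H (J w, ?X w) \<partial>M)"
    using S(1) by (intro nn_integral_cong_AE) (auto elim!: eventually_mono simp: H_def)
  also have "\<dots> = (\<integral>\<^sup>+w. (\<integral>\<^sup>+k. H (k, ?X w) \<partial>?p) \<partial>M)"
    by (rule independent_nn_integral[OF ind' distr' prob_space_measure_pmf H])
  also have "\<dots> = (\<integral>\<^sup>+w. (\<Sum>k\<in>S. h (x k w)) / of_nat (card S) \<partial>M)"
  proof (rule nn_integral_cong)
    fix w
    have "(\<integral>\<^sup>+k. H (k, ?X w) \<partial>?p) = (\<Sum>k\<in>S. H (k, ?X w)) / of_nat (card S)"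
      using fin S(2) by (simp add: nn_integral_pmf_of_set)
    also have "(\<Sum>k\<in>S. H (k, ?X w)) = (\<Sum>k\<in>S. h (x k w))"
      using S(1) by (intro sum.cong) (auto simp: H_def)
    finally show "(\<integral>\<^sup>+k. H (k, ?X w) \<partial>?p) = (\<Sum>k\<in>S. h (x k w)) / of_nat (card S)" .
  qed
  also have "\<dots> = (\<Sum>k\<in>S. \<integral>\<^sup>+w. h (x k w) \<partial>M) / of_nat (card S)"
    using meas by (simp add: nn_integral_divide nn_integral_sum)
  finally show ?thesis .
qed

text \<open>A delay above the threshold uses up more than \<open>T\<close> of the total delay budget \<open>m * K\<close>, which
  leaves at least the fraction \<open>(P - r) / P\<close> of the iterations below the threshold.\<close>
lemma card_small_delays:
  fixes \<tau> :: "nat \<Rightarrow> nat" and P r :: real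
  assumes total: "(\<Sum>k=1..K. \<tau> k) \<le> m * K" and m: "m \<ge> 1" and r: "0 < r" "r < P"
    and T: "T = inverse r * real m * P"
  shows "real K * (P - r) \<le> real (card {k \<in> {1..K}. real (\<tau> k) \<le> T}) * P"
proof -
  let ?G = "{k \<in> {1..K}. real (\<tau> k) \<le> T}" and ?B = "{k \<in> {1..K}. \<not> real (\<tau> k) \<le> T}"
  have "card ?G + card ?B = card (?G \<union> ?B)" by (subst card_Un_disjoint) auto
  also have "?G \<union> ?B = {1..K}" by auto
  finally have card: "real (card ?G) + real (card ?B) = real K" by (simp flip: of_nat_add)
  have "T * real (card ?B) = (\<Sum>k\<in>?B. T)" by simp
  also have "\<dots> \<le> (\<Sum>k\<in>?B. real (\<tau> k))" by (intro sum_mono) auto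
  also have "\<dots> \<le> (\<Sum>k=1..K. real (\<tau> k))" by (intro sum_mono2) auto
  also have "\<dots> \<le> real m * real K" using total by (simp flip: of_nat_sum of_nat_mult)
  finally have "real m * (P * real (card ?B)) \<le> real m * (r * real K)"
    using r unfolding T by (simp add: field_simps)
  then have "P * real (card ?B) \<le> r * real K" using m by simp
  moreover have "real (card ?B) = real K - real (card ?G)" using card by linarith
  ultimately have "P * (real K - real (card ?G)) \<le> r * real K" by (simp only:)
  then show ?thesis by (simp only: right_diff_distrib) (simp add: mult.commute)
qed

text \<open>Here \<open>s\<close> and \<open>h\<close> stand for \<open>sqrt K\<close> and \<open>sqrt \<eta>\<close>, \<open>N\<close> for the number of
  iterations that are not skipped, and \<open>S1\<close>, \<open>S2\<close> for the sums of their delays and squared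
  delays.\<close>
lemma rate_from_summed_descent:
  fixes s h \<alpha> \<rho> l \<mu> Lf Lg D A c N S1 S2 Q m P r :: real
  assumes pos: "0 < s" "1 \<le> h" "0 < \<alpha>" "0 < \<rho>" "0 \<le> l" "0 < \<mu>" "0 \<le> Lf" "0 \<le> Lg" "0 \<le> D" "0 < N"
      "1 \<le> m" "0 < P" "0 < r"
    and c: "c = s / (\<alpha> * h)" and A: "A \<le> 2 * c + 2 * (\<rho> + 2 * l)"
    and N: "s\<^sup>2 \<le> N * h\<^sup>2" and S1: "S1 \<le> m * s\<^sup>2" and S2: "S2 \<le> (m * P / r) * (m * s\<^sup>2)"
    and descent: "\<mu> * \<rho> * Q \<le> A * D + \<rho> * (2 * Lf * Lg / c * N + 2 * Lf * (Lg / c) * S1 + l * (Lg / c)\<^sup>2 * S2)"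
  shows "\<rho>\<^sup>2 * Q / N \<le> 2 * \<rho> / \<mu> * (h\<^sup>2 * (\<rho> + 2 * l) / s\<^sup>2 * D + h / (s * \<alpha>) * D
      + 4 * h ^ 3 * \<rho> * Lf * Lg * m * \<alpha> / s + 8 * h ^ 4 * \<rho> * l * Lg\<^sup>2 * m\<^sup>2 * \<alpha>\<^sup>2 * P / (r * s\<^sup>2))"
proof -
  define u where "u = Lf * Lg * m * \<alpha> / s"
  define q where "q = l * Lg\<^sup>2 * m\<^sup>2 * \<alpha>\<^sup>2 * P / (r * s\<^sup>2)"
  define b where "b = h\<^sup>2 * (\<rho> + 2 * l) / s\<^sup>2 * D + h / (s * \<alpha>) * D"
  have h0: "0 < h" using pos by linarith
  have uq: "0 \<le> u" "0 \<le> q" using pos by (auto simp: u_def q_def)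
  have iN: "X / N \<le> X * (h\<^sup>2 / s\<^sup>2)" if "0 \<le> X" for X
  proof -
    have "1 / N \<le> h\<^sup>2 / s\<^sup>2" using N pos by (simp add: field_simps)
    from mult_left_mono[OF this that] show ?thesis by simp
  qed
  have c0: "0 < c" using pos h0 by (simp add: c)
  have Lc: "Lg / c = Lg * \<alpha> * h / s" using pos h0 by (simp add: c)
  have t1: "A * D / N \<le> 2 * b"
  proof -
    have "A * D \<le> (2 * c + 2 * (\<rho> + 2 * l)) * D" using A pos by (intro mult_right_mono) auto
    then have "A * D / N \<le> (2 * c + 2 * (\<rho> + 2 * l)) * D / N" using pos by (intro divide_right_mono) auto
    also have "\<dots> \<le> (2 * c + 2 * (\<rho> + 2 * l)) * D * (h\<^sup>2 / s\<^sup>2)"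
      using pos c0 by (intro iN mult_nonneg_nonneg) auto
    also have "\<dots> = 2 * b"
      using pos h0 unfolding b_def c by (simp add: field_simps power2_eq_square)
    finally show ?thesis .
  qed
  have t2: "2 * Lf * Lg / c * N / N \<le> 2 * (h ^ 3 * u)"
  proof -
    have "2 * Lf * Lg / c * N / N = 2 * (Lf * (Lg / c))" using pos by simp
    also have "\<dots> = 2 * (h * (Lf * Lg * \<alpha> / s))" by (simp add: Lc mult_ac)
    also have "\<dots> \<le> 2 * (h ^ 3 * u)"
    proof -
      have "h * 1 \<le> h ^ 3" using pos power_increasing[of 1 3 h] by simp
      moreover have "Lf * Lg * \<alpha> / s \<le> u"
      proof -
        have "Lf * Lg * \<alpha> / s * 1 \<le> Lf * Lg * \<alpha> / s * m" using pos by (intro mult_left_mono) auto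
        then show ?thesis by (simp add: u_def mult_ac)
      qed
      ultimately show ?thesis using pos h0 by (intro mult_left_mono mult_mono) auto
    qed
    finally show ?thesis .
  qed
  have t3: "2 * Lf * (Lg / c) * S1 / N \<le> 2 * (h ^ 3 * u)"
  proof -
    have "2 * Lf * (Lg / c) * S1 \<le> 2 * Lf * (Lg / c) * (m * s\<^sup>2)"
      using S1 pos c0 by (intro mult_left_mono) auto
    then have "2 * Lf * (Lg / c) * S1 / N \<le> 2 * Lf * (Lg / c) * (m * s\<^sup>2) / N"
      using pos by (intro divide_right_mono) auto
    also have "\<dots> \<le> 2 * Lf * (Lg / c) * (m * s\<^sup>2) * (h\<^sup>2 / s\<^sup>2)"
      using pos c0 by (intro iN mult_nonneg_nonneg) auto
    also have "\<dots> = 2 * (h ^ 3 * u)"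
      using pos h0 unfolding Lc u_def by (simp add: field_simps power2_eq_square power3_eq_cube)
    finally show ?thesis .
  qed
  have t4: "l * (Lg / c)\<^sup>2 * S2 / N \<le> h ^ 4 * q"
  proof -
    have "l * (Lg / c)\<^sup>2 * S2 \<le> l * (Lg / c)\<^sup>2 * ((m * P / r) * (m * s\<^sup>2))"
      using S2 pos by (intro mult_left_mono) auto
    then have "l * (Lg / c)\<^sup>2 * S2 / N \<le> l * (Lg / c)\<^sup>2 * ((m * P / r) * (m * s\<^sup>2)) / N"
      using pos by (intro divide_right_mono) auto
    also have "\<dots> \<le> l * (Lg / c)\<^sup>2 * ((m * P / r) * (m * s\<^sup>2)) * (h\<^sup>2 / s\<^sup>2)"
      using pos by (intro iN mult_nonneg_nonneg) auto
    also have "\<dots> = h ^ 4 * q"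
      using pos h0 unfolding Lc q_def by (simp add: field_simps power2_eq_square power4_eq_xxxx)
    finally show ?thesis .
  qed
  have "\<mu> * \<rho> * Q / N \<le> (A * D + \<rho> * (2 * Lf * Lg / c * N + 2 * Lf * (Lg / c) * S1 + l * (Lg / c)\<^sup>2 * S2)) / N"
    using descent pos by (intro divide_right_mono) auto
  also have "\<dots> = A * D / N + \<rho> * (2 * Lf * Lg / c * N / N + 2 * Lf * (Lg / c) * S1 / N + l * (Lg / c)\<^sup>2 * S2 / N)"
    by (simp add: add_divide_distrib distrib_left)
  also have "\<dots> \<le> 2 * b + \<rho> * (2 * (h ^ 3 * u) + 2 * (h ^ 3 * u) + h ^ 4 * q)"
    using t1 t2 t3 t4 pos by (intro add_mono mult_left_mono) auto
  also have "\<dots> \<le> 2 * (b + 4 * (\<rho> * (h ^ 3 * u)) + 8 * (\<rho> * (h ^ 4 * q)))"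
  proof -
    have "0 \<le> \<rho> * (h ^ 3 * u)" "0 \<le> \<rho> * (h ^ 4 * q)" using pos h0 uq by auto
    then show ?thesis by (simp add: algebra_simps)
  qed
  finally have "\<mu> * \<rho> * Q / N \<le> 2 * (b + 4 * (\<rho> * (h ^ 3 * u)) + 8 * (\<rho> * (h ^ 4 * q)))" .
  then have "\<rho> / \<mu> * (\<mu> * \<rho> * Q / N) \<le> \<rho> / \<mu> * (2 * (b + 4 * (\<rho> * (h ^ 3 * u)) + 8 * (\<rho> * (h ^ 4 * q))))"
    using pos by (intro mult_left_mono) auto
  moreover have "\<rho> / \<mu> * (\<mu> * \<rho> * Q / N) = \<rho>\<^sup>2 * Q / N"
    using pos by (simp add: power2_eq_square)
  ultimately have "\<rho>\<^sup>2 * Q / N \<le> \<rho> / \<mu> * (2 * (b + 4 * (\<rho> * (h ^ 3 * u)) + 8 * (\<rho> * (h ^ 4 * q))))"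
    by (simp only:)
  also have "\<dots> = 2 * \<rho> / \<mu> * (b + 4 * (\<rho> * (h ^ 3 * u)) + 8 * (\<rho> * (h ^ 4 * q)))" by simp
  also have "4 * (\<rho> * (h ^ 3 * u)) = 4 * h ^ 3 * \<rho> * Lf * Lg * m * \<alpha> / s" by (simp add: u_def mult_ac)
  also have "8 * (\<rho> * (h ^ 4 * q)) = 8 * h ^ 4 * \<rho> * l * Lg\<^sup>2 * m\<^sup>2 * \<alpha>\<^sup>2 * P / (r * s\<^sup>2)"
    by (simp add: q_def mult_ac)
  finally show ?thesis unfolding b_def by (simp only: add.assoc)
qed

theorem theorem4:
  fixes f :: "'a::euclidean_space \<Rightarrow> 's \<Rightarrow> ereal"
    and \<omega> F \<psi> :: "'a \<Rightarrow> ereal"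
    and \<Xi> :: "'s measure" and M :: "'w measure"
    and \<xi> :: "nat \<Rightarrow> 'w \<Rightarrow> 's"
    and g x :: "nat \<Rightarrow> 'w \<Rightarrow> 'a" and x1 :: 'a
    and kstar :: "'w \<Rightarrow> nat"
    and sched \<tau> :: "nat \<Rightarrow> nat" and m K :: nat
    and \<kappa> l \<rho> r \<beta> \<alpha> \<gamma> \<eta> T L\<^sub>f L\<^sub>\<omega> :: real
    and D :: ereal
  assumes prob: "prob_space M"
    and f_measurable: "\<And>y. f y \<in> borel_measurable \<Xi>"
    and f_continuous: "\<And>s. s \<in> space \<Xi> \<Longrightarrow> continuous_on (edom (\<lambda>y. f y s)) (\<lambda>y. f y s)"
    and F: "\<And>y. F y = expectation_ereal \<Xi> (f y)"
    and \<psi>: "\<And>y. \<psi> y = F y + \<omega> y"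
    and \<omega>_lsc: "lower_semicontinuous \<omega>"
    and samples_indep: "prob_space.indep_vars M (\<lambda>_. \<Xi>) \<xi> {1..K}"
    and samples_distr: "\<And>k. k \<in> {1..K} \<Longrightarrow> distr M \<Xi> (\<xi> k) = \<Xi>"
    and \<omega>_lipschitz: "L\<^sub>\<omega>-lipschitz_on (edom \<omega>) (\<lambda>y. real_of_ereal (\<omega> y))"
    and \<kappa>_nonneg: "\<kappa> \<ge> 0" and \<omega>_weakly_convex: "weakly_convex \<kappa> \<omega>"
    and l_nonneg: "l \<ge> 0"
    and f_weakly_convex: "\<And>s. s \<in> space \<Xi> \<Longrightarrow> weakly_convex l (\<lambda>y. f y s)"
    and dom: "edom \<omega> \<subseteq> interior (edom F)"
    and L\<^sub>f_nonneg: "L\<^sub>f \<ge> 0"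
    and subgradient_bound: "\<And>y h. y \<in> edom \<omega> \<Longrightarrow> h \<in> borel_measurable \<Xi> \<Longrightarrow>
          (AE s in \<Xi>. h s \<in> subdifferential (\<lambda>z. f z s) y) \<Longrightarrow>
          (\<integral>\<^sup>+s. ennreal ((norm (h s))\<^sup>2) \<partial>\<Xi>) \<le> ennreal (L\<^sub>f\<^sup>2)"
    and workers: "\<And>k. k \<in> {1..K} \<Longrightarrow> sched k \<in> {1..m}"
    and delays: "\<And>k. k \<in> {1..K} \<Longrightarrow> \<tau> k = delay sched k"
    and \<rho>: "\<rho> > 2 * l + \<kappa>"
    and r: "r > 0"
    and \<alpha>: "\<alpha> > 0"
    and K: "K \<ge> 1"
    and \<beta>: "\<beta> > 0 \<and> real K > r powr (1 / \<beta>) \<or> \<beta> = 0 \<and> r < 1"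
    and T: "T = inverse r * real m * real K powr \<beta>"
    and \<eta>: "\<eta> = 1 + r / (real K powr \<beta> - r)"
    and \<gamma>: "\<gamma> = sqrt (real K) / (\<alpha> * sqrt \<eta>) + \<rho> + \<kappa> + 4 * l"
    and x1: "x1 \<in> edom \<omega>"
    and run: "safeguarded_dsgd M f \<omega> K \<tau> T (\<lambda>_. \<gamma>) x1 \<xi> g x"
    and sample_indep_past: "\<And>k. k \<in> {1..K} \<Longrightarrow>
          independent_rvs M \<Xi> (\<xi> k) (\<Pi>\<^sub>M i\<in>{1..k}. borel) (\<lambda>w. \<lambda>i\<in>{1..k}. x i w)"
    and kstar_uniform: "distr M (count_space UNIV) kstar =
          measure_pmf (pmf_of_set {k \<in> {1..K}. real (\<tau> k) \<le> T})"
    and kstar_indep: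
          "independent_rvs M (count_space UNIV) kstar (\<Pi>\<^sub>M i\<in>{1..K}. borel) (\<lambda>w. \<lambda>i\<in>{1..K}. x i w)"
    and D: "D = moreau_envelope \<psi> \<rho> x1 - (INF y. \<psi> y)"
  shows "enn2ereal (\<integral>\<^sup>+w. ennreal ((norm (gradient (\<lambda>y. real_of_ereal (moreau_envelope \<psi> \<rho> y))
            (x (kstar w) w)))\<^sup>2) \<partial>M)
    \<le> ereal (2 * \<rho> / (\<rho> - 2 * l - \<kappa>)) *
       (ereal (\<eta> * (\<rho> + 2 * l) / real K) * D
        + ereal (sqrt \<eta> / (sqrt (real K) * \<alpha>)) * D
        + ereal (4 * \<eta> powr (3 / 2) * \<rho> * L\<^sub>f * (L\<^sub>f + L\<^sub>\<omega>) * real m * \<alpha> / sqrt (real K))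
        + ereal (8 * \<eta>\<^sup>2 * \<rho> * l * (L\<^sub>f + L\<^sub>\<omega>)\<^sup>2 * (real m)\<^sup>2 * \<alpha>\<^sup>2 / (r * real K powr (1 - \<beta>))))"
proof -
  interpret M: prob_space M by (rule prob)
  define C where "C = edom \<omega>"
  define \<omega>r where "\<omega>r y = real_of_ereal (\<omega> y)" for y
  define \<phi> where "\<phi> y = real_of_ereal (F y) + \<omega>r y" for y
  define used where "used = {k \<in> {1..K}. real (\<tau> k) \<le> T}"
  define P where "P = real K powr \<beta>"
  define c where "c = sqrt (real K) / (\<alpha> * sqrt \<eta>)"
  define \<mu> where "\<mu> = \<rho> - 2 * l - \<kappa>"
  have \<mu>: "0 < \<mu>" and rho: "0 < \<rho>" using \<rho> \<kappa>_nonneg l_nonneg by (auto simp: \<mu>_def)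
  have L\<omega>: "0 \<le> L\<^sub>\<omega>" using \<omega>_lipschitz lipschitz_on_nonneg by blast

  have rP: "r < P"
    using \<beta>
  proof
    assume b: "0 < \<beta> \<and> r powr (1 / \<beta>) < real K"
    then have "(r powr (1 / \<beta>)) powr \<beta> < real K powr \<beta>" using r by (intro powr_less_mono2) auto
    then show ?thesis using b r by (simp add: P_def powr_powr)
  next
    assume "\<beta> = 0 \<and> r < 1"
    then show ?thesis using K by (simp add: P_def)
  qed
  have P: "0 < P" using rP r by linarith
  have \<eta>P: "\<eta> = P / (P - r)" using rP by (simp add: \<eta> field_simps flip: P_def)
  have \<eta>1: "1 \<le> \<eta>" using rP r by (simp add: \<eta>P)
  have c_pos: "0 < c" using K \<alpha> \<eta>1 by (simp add: c_def)
  have m: "1 \<le> m" using workers[of 1] K by auto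

  have delay_lt: "\<tau> k < k" if "k \<in> {1..K}" for k
    using that delays[OF that] delay_less[of k sched] by simp
  have total_delay: "(\<Sum>k=1..K. \<tau> k) \<le> m * K"
    using sum_delay_le[of K sched m] workers delays by simp
  have card_used: "real K \<le> real (card used) * \<eta>"
  proof -
    have "real K * (P - r) \<le> real (card used) * P"
      unfolding used_def using card_small_delays[OF total_delay m r rP] T by (simp add: P_def)
    then show ?thesis using rP by (simp add: \<eta>P field_simps)
  qed
  have used_fin: "finite used" and used_sub: "used \<subseteq> {1..K}" by (auto simp: used_def)
  have card_pos: "0 < card used"
    using card_used K by (cases "card used = 0") auto
  then have used_ne: "used \<noteq> {}" by auto

  have not_MInf: "\<omega> y \<noteq> -\<infinity>" for y using \<omega>_weakly_convex by (simp add: weakly_convex_def)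
  have closed_C: "closed C"
    unfolding C_def by (rule closed_edom[OF \<omega>_lsc not_MInf \<omega>_lipschitz])
  have \<omega>r_wc: "convex_on C (\<lambda>y. \<omega>r y + \<kappa> / 2 * (norm y)\<^sup>2)"
    using \<omega>_weakly_convex by (simp add: weakly_convex_def C_def \<omega>r_def)
  have \<omega>r_lip: "L\<^sub>\<omega>-lipschitz_on C \<omega>r"
    using \<omega>_lipschitz by (simp add: C_def \<omega>r_def[abs_def])
  have \<omega>_eq: "\<omega> y = (if y \<in> C then ereal (\<omega>r y) else \<infinity>)" for y
    using not_MInf[of y] by (auto simp: C_def edom_def \<omega>r_def ereal_real')
  have prob_\<Xi>: "prob_space \<Xi>"
  proof -
    have one: "1 \<in> {1..K}" using K by simp
    have "\<xi> 1 \<in> measurable M \<Xi>"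
      using sample_indep_past[OF one] by (simp add: independent_rvs_def)
    then show ?thesis using M.prob_space_distr[of "\<xi> 1" \<Xi>] samples_distr[OF one] by simp
  qed
  interpret S: stochastic_weakly_convex f F \<Xi> C l L\<^sub>f
  proof (rule stochastic_weakly_convex.intro)
    show "C \<subseteq> interior (edom F)" "convex C"
      using dom \<omega>r_wc by (auto simp: C_def convex_on_def)
    show "(\<integral>\<^sup>+s. ennreal ((norm (h s))\<^sup>2) \<partial>\<Xi>) \<le> ennreal (L\<^sub>f\<^sup>2)"
      if "y \<in> C" "h \<in> borel_measurable \<Xi>" "AE s in \<Xi>. h s \<in> subdifferential (\<lambda>z. f z s) y" for y h
      using that by (intro subgradient_bound) (simp_all add: C_def)
  qed (fact prob_\<Xi> f_measurable f_continuous F l_nonneg f_weakly_convex L\<^sub>f_nonneg)+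
  have \<gamma>c: "\<gamma> = c + \<rho> + \<kappa> + 4 * l" by (simp add: \<gamma> c_def)
  have \<gamma>_pos: "0 < \<gamma>" using \<gamma>c c_pos rho \<kappa>_nonneg l_nonneg by linarith
  have run': "if real (\<tau> k) \<le> T then
       g k \<in> borel_measurable M \<and>
       (AE w in M. g k w \<in> subdifferential (\<lambda>y. f y (\<xi> k w)) (x (max 1 (k - \<tau> k)) w)) \<and>
       (\<forall>w\<in>space M. is_arg_min
          (\<lambda>y. ereal (g k w \<bullet> (y - x k w)) + \<omega> y + ereal (\<gamma> / 2 * (norm (y - x k w))\<^sup>2))
          (\<lambda>_. True) (x (k + 1) w))
     else (\<forall>w\<in>space M. x (k + 1) w = x k w)" if "k \<in> {1..K}" for k
    using run that unfolding safeguarded_dsgd_def by blast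
  interpret om: weakly_convex_lipschitz C \<omega>r L\<^sub>\<omega> \<kappa> \<gamma>
    by standard
      (use closed_C x1 \<omega>r_lip \<omega>r_wc \<kappa>_nonneg \<gamma>c c_pos rho l_nonneg in \<open>auto simp: C_def\<close>)
  interpret R: delayed_sgd f F \<Xi> C l L\<^sub>f M \<omega>r L\<^sub>\<omega> \<kappa> \<rho> \<gamma> c K used \<tau> \<xi> g x x1
  proof
    fix k assume k: "k \<in> used"
    then have kK: "k \<in> {1..K}" and kT: "real (\<tau> k) \<le> T" by (auto simp: used_def)
    \<comment> \<open>Counters start at zero, so a delay cannot exceed \<open>k - 1\<close>.\<close>
    have idx: "max 1 (k - \<tau> k) = k - \<tau> k" using delay_lt[OF kK] by simp
    show "g k \<in> borel_measurable M" using run'[OF kK] kT by simp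
    show "AE w in M. g k w \<in> subdifferential (\<lambda>y. f y (\<xi> k w)) (x (k - \<tau> k) w)"
      using run'[OF kK] kT unfolding idx by simp
    fix w assume w: "w \<in> space M"
    have amin: "is_arg_min (\<lambda>y. ereal (g k w \<bullet> (y - x k w)) + \<omega> y + ereal (\<gamma> / 2 * (norm (y - x k w))\<^sup>2))
          (\<lambda>_. True) (x (k + 1) w)"
      using run'[OF kK] kT w by simp
    have ne: "edom \<omega> \<noteq> {}" using x1 by blast
    show "om.is_prox (x k w - (1 / \<gamma>) *\<^sub>R g k w) (x (k + 1) w)"
      using linearised_argmin_is_prox[where h = \<omega>, OF not_MInf ne \<gamma>_pos amin]
      unfolding om.is_prox_def unfolding C_def \<omega>r_def .
  next
    fix k w assume k: "k \<in> {1..K}" "k \<notin> used" and w: "w \<in> space M"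
    then show "x (k + 1) w = x k w" using run'[OF k(1)] by (simp add: used_def)
  next
    show "x 1 w = x1" if "w \<in> space M" for w using run that by (simp add: safeguarded_dsgd_def)
    show "x1 \<in> C" using x1 by (simp add: C_def)
  qed (fact closed_C \<omega>r_lip \<omega>r_wc \<kappa>_nonneg \<rho> \<gamma>c c_pos K used_sub delay_lt samples_distr sample_indep_past)+

  have \<psi>_eq: "\<psi> y = (if y \<in> C then ereal (\<phi> y) else \<infinity>)" for y
  proof (cases "y \<in> C")
    case True
    then have "y \<in> edom F" using dom interior_subset unfolding C_def by blast
    then have "F y = ereal (real_of_ereal (F y))" by (auto simp: edom_def ereal_real')
    then show ?thesis using True by (simp add: \<psi> \<omega>_eq \<phi>_def) (metis plus_ereal.simps(1))
  next
    case False
    then show ?thesis by (simp add: \<psi> \<omega>_eq)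
  qed
  have \<psi>_eq': "\<psi> y = (if y \<in> C then ereal (real_of_ereal (F y) + \<omega>r y) else \<infinity>)" for y
    using \<psi>_eq by (simp add: \<phi>_def)
  have env: "moreau_envelope \<psi> \<rho> y = ereal (R.psi.env y)" for y
    by (rule R.psi.moreau_envelope_eq_env[OF \<psi>_eq'])
  define a where "a k = (\<integral>w. (norm (x k w - R.xh k w))\<^sup>2 \<partial>M)" for k
  have a_nonneg: "0 \<le> a k" for k by (simp add: a_def)

  have lhs: "(\<integral>\<^sup>+w. ennreal ((norm (gradient (\<lambda>y. real_of_ereal (moreau_envelope \<psi> \<rho> y))
            (x (kstar w) w)))\<^sup>2) \<partial>M) = ennreal (\<rho>\<^sup>2 * (\<Sum>k\<in>used. a k) / real (card used))"
  proof -
    have meas: "(\<lambda>y. ennreal ((norm (gradient R.psi.env y))\<^sup>2)) \<in> borel_measurable borel"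
      unfolding R.psi.gradient_env by measurable
    have sq: "integrable M (\<lambda>w. (norm (x k w - R.xh k w))\<^sup>2)" if "k \<in> used" for k
      using that used_sub by (intro M.sqint_integrable M.sqint_diff R.x_sqint R.xh_sqint) auto
    have "(\<integral>\<^sup>+w. ennreal ((norm (gradient (\<lambda>y. real_of_ereal (moreau_envelope \<psi> \<rho> y))
            (x (kstar w) w)))\<^sup>2) \<partial>M)
        = (\<integral>\<^sup>+w. ennreal ((norm (gradient R.psi.env (x (kstar w) w)))\<^sup>2) \<partial>M)"
      by (simp add: env)
    also have "\<dots> = (\<Sum>k\<in>used. \<integral>\<^sup>+w. ennreal ((norm (gradient R.psi.env (x k w)))\<^sup>2) \<partial>M) / of_nat (card used)"
      by (rule M.nn_integral_uniform_index[OF used_sub used_ne kstar_uniform[folded used_def] kstar_indep meas])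
    also have "(\<Sum>k\<in>used. \<integral>\<^sup>+w. ennreal ((norm (gradient R.psi.env (x k w)))\<^sup>2) \<partial>M)
        = (\<Sum>k\<in>used. ennreal (\<rho>\<^sup>2 * a k))"
    proof (rule sum.cong[OF refl])
      fix k assume k: "k \<in> used"
      show "(\<integral>\<^sup>+w. ennreal ((norm (gradient R.psi.env (x k w)))\<^sup>2) \<partial>M) = ennreal (\<rho>\<^sup>2 * a k)"
        unfolding R.gradient_norm a_def using sq[OF k] by (simp add: nn_integral_eq_integral)
    qed
    also have "\<dots> = ennreal (\<rho>\<^sup>2 * (\<Sum>k\<in>used. a k))"
      using a_nonneg by (simp add: sum_ennreal sum_distrib_left)
    also have "\<dots> / of_nat (card used) = ennreal (\<rho>\<^sup>2 * (\<Sum>k\<in>used. a k) / real (card used))"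
      unfolding ennreal_of_nat_eq_real_of_nat
      using card_pos a_nonneg by (intro divide_ennreal mult_nonneg_nonneg sum_nonneg) auto
    finally show ?thesis .
  qed

  show ?thesis
  \<comment> \<open>If \<open>\<psi>\<close> is unbounded from below, then \<open>D\<close> is infinite and so is the bound.\<close>
  proof (cases "(INF y. \<psi> y) = -\<infinity>")
    case True
    then have "D = \<infinity>" by (simp add: D env)
    then have rhs: "ereal p * (ereal p1 * D + ereal p2 * D + ereal q1 + ereal q2) = \<infinity>"
      if "0 < p" "0 < p1" "0 < p2" for p p1 p2 q1 q2
      using that by simp
    have "0 < \<eta> * (\<rho> + 2 * l) / real K" "0 < sqrt \<eta> / (sqrt (real K) * \<alpha>)"
      "0 < 2 * \<rho> / (\<rho> - 2 * l - \<kappa>)"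
      using \<eta>1 rho l_nonneg K \<alpha> \<mu> by (auto simp: \<mu>_def)
    then show ?thesis by (simp only: rhs ereal_less_eq(1))
  next
    case False
    have "(INF y. \<psi> y) \<le> \<psi> x1" by (rule INF_lower) simp
    then have "(INF y. \<psi> y) \<noteq> \<infinity>" using x1 \<psi>_eq[of x1] by (auto simp: C_def)
    then obtain v where v: "(INF y. \<psi> y) = ereal v" using False by (cases "INF y. \<psi> y") auto
    have v_le: "v \<le> real_of_ereal (F y) + \<omega>r y" if "y \<in> C" for y
    proof -
      have "ereal v \<le> \<psi> y" unfolding v[symmetric] by (rule INF_lower) simp
      then show ?thesis using that by (simp add: \<psi>_eq')
    qed
    define D' where "D' = R.psi.env x1 - v"
    have DD': "D = ereal D'" by (simp add: D env v D'_def)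
    have D'_nonneg: "0 \<le> D'" using R.env_ge[OF v_le, of x1] by (simp add: D'_def)
    have \<tau>_sum: "(\<Sum>k\<in>used. real (\<tau> k)) \<le> real m * real K"
    proof -
      have "(\<Sum>k\<in>used. real (\<tau> k)) \<le> (\<Sum>k=1..K. real (\<tau> k))"
        using used_sub by (intro sum_mono2) auto
      also have "\<dots> \<le> real m * real K" using total_delay by (simp flip: of_nat_sum of_nat_mult)
      finally show ?thesis .
    qed
    have "(\<Sum>k\<in>used. (real (\<tau> k))\<^sup>2) \<le> (\<Sum>k\<in>used. T * real (\<tau> k))"
      by (intro sum_mono) (auto simp: used_def power2_eq_square intro: mult_right_mono)
    also have "\<dots> = T * (\<Sum>k\<in>used. real (\<tau> k))" by (rule sum_distrib_left[symmetric])
    also have "\<dots> \<le> T * (real m * real K)"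
      using \<tau>_sum r by (intro mult_left_mono) (auto simp: T)
    also have "T = real m * P / r" by (simp add: T P_def field_simps)
    finally have \<tau>2_sum: "(\<Sum>k\<in>used. (real (\<tau> k))\<^sup>2) \<le> real m * P / r * (real m * real K)" .
    have A: "R.A \<le> 2 * c + 2 * (\<rho> + 2 * l)"
      unfolding R.A_def using \<gamma>c c_pos \<kappa>_nonneg l_nonneg by simp
    have KK: "(sqrt (real K))\<^sup>2 = real K" and \<eta>\<eta>: "(sqrt \<eta>)\<^sup>2 = \<eta>" using \<eta>1 by auto
    have rate: "\<rho>\<^sup>2 * (\<Sum>k\<in>used. a k) / real (card used)
      \<le> 2 * \<rho> / \<mu> * ((sqrt \<eta>)\<^sup>2 * (\<rho> + 2 * l) / (sqrt (real K))\<^sup>2 * D' + sqrt \<eta> / (sqrt (real K) * \<alpha>) * D'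
        + 4 * sqrt \<eta> ^ 3 * \<rho> * L\<^sub>f * (L\<^sub>f + L\<^sub>\<omega>) * real m * \<alpha> / sqrt (real K)
        + 8 * sqrt \<eta> ^ 4 * \<rho> * l * (L\<^sub>f + L\<^sub>\<omega>)\<^sup>2 * (real m)\<^sup>2 * \<alpha>\<^sup>2 * P / (r * (sqrt (real K))\<^sup>2))"
    proof (rule rate_from_summed_descent)
      show "\<mu> * \<rho> * (\<Sum>k\<in>used. a k) \<le> R.A * D' + \<rho> * (2 * L\<^sub>f * (L\<^sub>f + L\<^sub>\<omega>) / c * real (card used)
          + 2 * L\<^sub>f * ((L\<^sub>f + L\<^sub>\<omega>) / c) * (\<Sum>k\<in>used. real (\<tau> k))
          + l * ((L\<^sub>f + L\<^sub>\<omega>) / c)\<^sup>2 * (\<Sum>k\<in>used. (real (\<tau> k))\<^sup>2))"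
        using R.summed_descent[OF v_le] by (simp add: \<mu>_def a_def D'_def)
      show "c = sqrt (real K) / (\<alpha> * sqrt \<eta>)" by (rule c_def)
      show "(\<Sum>k\<in>used. real (\<tau> k)) \<le> real m * (sqrt (real K))\<^sup>2" using \<tau>_sum by (simp only: KK)
      show "(\<Sum>k\<in>used. (real (\<tau> k))\<^sup>2) \<le> real m * P / r * (real m * (sqrt (real K))\<^sup>2)"
        using \<tau>2_sum by (simp only: KK)
      show "(sqrt (real K))\<^sup>2 \<le> real (card used) * (sqrt \<eta>)\<^sup>2" using card_used by (simp only: KK \<eta>\<eta>)
    qed (use K \<eta>1 \<alpha> rho l_nonneg \<mu> L\<^sub>f_nonneg L\<omega> D'_nonneg card_pos m P r A in auto)
    have e3: "sqrt \<eta> ^ 3 = \<eta> powr (3 / 2)"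
      using \<eta>1 by (simp add: powr_half_sqrt[symmetric] powr_realpow[symmetric] powr_powr)
    have e4: "sqrt \<eta> ^ 4 = \<eta>\<^sup>2"
      using \<eta>\<eta> by (metis mult_2_right numeral_Bit0 power_add power_mult power2_eq_square mult_2)
    have eP: "X * P / (r * real K) = X / (r * real K powr (1 - \<beta>))" for X
      using K P by (simp add: P_def powr_diff)
    have "\<rho>\<^sup>2 * (\<Sum>k\<in>used. a k) / real (card used)
      \<le> 2 * \<rho> / \<mu> * (\<eta> * (\<rho> + 2 * l) / real K * D' + sqrt \<eta> / (sqrt (real K) * \<alpha>) * D'
        + 4 * \<eta> powr (3 / 2) * \<rho> * L\<^sub>f * (L\<^sub>f + L\<^sub>\<omega>) * real m * \<alpha> / sqrt (real K)
        + 8 * \<eta>\<^sup>2 * \<rho> * l * (L\<^sub>f + L\<^sub>\<omega>)\<^sup>2 * (real m)\<^sup>2 * \<alpha>\<^sup>2 / (r * real K powr (1 - \<beta>)))"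
      using rate unfolding KK \<eta>\<eta> e3 e4 eP .
    moreover have "0 \<le> \<rho>\<^sup>2 * (\<Sum>k\<in>used. a k) / real (card used)"
      using a_nonneg by (simp add: sum_nonneg)
    ultimately show ?thesis
      unfolding lhs DD' \<mu>_def by (simp add: enn2ereal_ennreal)
  qed
qed

end
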